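(* The $f$-BHS problem can be solved by $6f$ agents, starting from a rooted initial configuration (all agents co-located at one safe node), within $3\Delta^{n}(\Delta+1)^{2f+n}(n-1)^{2f}$ rounds, where $\Delta$ is the maximum degree of the footprint $G$ and $n$ its number of nodes; each agent uses $O(\log n)$ bits of memory and each node a whiteboard of $O(\log n)$ bits.
   Context: A time-varying graph (TVG) is $\mathcal{G}=(V,E,\mathbb{T},\rho)$ with discrete rounds $\mathbb{T}=\mathbb{Z}^+$ and $\rho:E\times\mathbb{T}\to\{0,1\}$ indicating whether an edge is present in a round. Its footprint $G=(V,E)$ is an undirected, unweighted, connected graph with $n=|V|$ anonymous nodes; edges at a node $v$ of degree $\delta_v$ carry locally unique port numbers $0,\dots,\delta_v-1$. Each node has a whiteboard which visiting agents can read, write and erase. One node is a black hole, destroying any agent entering it without a trace; other nodes are safe. In $f$-BHS, in each round an adversary may remove at most $f$ edges of $G$, provided the graph remains connected in every round. Agents have distinct IDs from $[1,n^c]$ ($c>1$ constant unknown to them), know their own ID, and have no knowledge of the number of agents, $n$, $\Delta$, the black hole or missing edges. Execution is synchronous; in each round each agent at a safe node performs Look (reads the whiteboard, sees co-located agents and their parameters, learns whether its previous move attempt succeeded), Compute (chooses a port, may write on the whiteboard), Move (attempts to traverse the port; succeeds iff the edge is present that round, otherwise stays). An agent knows the degree of its current node and its entry port but cannot detect a missing incident edge except by trying to traverse it. $f$-BHS is solved when at least one agent survives, learns at least one edge (port) leading to the black hole, and terminates; time is counted in rounds until this happens. *)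

theory Defs
  imports Complex_Main "HOL-Library.Multiset"
begin

section \<open>Port-labelled footprint graph\<close>

text \<open>Nodes are 0..n-1 (anonymous to the agents). deg v is the degree of v,
  nbr v p the node reached from v through port p (p < deg v), and back v p the
  port number of that same edge at the node nbr v p.\<close>

definition Edges :: "nat \<Rightarrow> (nat \<Rightarrow> nat) \<Rightarrow> (nat \<Rightarrow> nat \<Rightarrow> nat) \<Rightarrow> nat set set" where
  "Edges n deg nbr = {{v, nbr v p} | v p. v < n \<and> p < deg v}"

definition connected_on :: "nat \<Rightarrow> nat set set \<Rightarrow> bool" where
  "connected_on n Es \<longleftrightarrow>
     (\<forall>u<n. \<forall>v<n. (u, v) \<in> {(x, y). x < n \<and> y < n \<and> {x, y} \<in> Es}\<^sup>*)"

definition port_graph :: "nat \<Rightarrow> (nat \<Rightarrow> nat) \<Rightarrow> (nat \<Rightarrow> nat \<Rightarrow> nat) \<Rightarrow> (nat \<Rightarrow> nat \<Rightarrow> nat) \<Rightarrow> bool" where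
  "port_graph n deg nbr back \<longleftrightarrow>
     (\<forall>v<n. \<forall>p<deg v. nbr v p < n \<and> nbr v p \<noteq> v \<and> back v p < deg (nbr v p)
                      \<and> nbr (nbr v p) (back v p) = v \<and> back (nbr v p) (back v p) = p)
   \<and> (\<forall>v<n. \<forall>p<deg v. \<forall>q<deg v. nbr v p = nbr v q \<longrightarrow> p = q)
   \<and> connected_on n (Edges n deg nbr)"

definition max_degree :: "nat \<Rightarrow> (nat \<Rightarrow> nat) \<Rightarrow> nat" where
  "max_degree n deg = Max (deg ` {..<n})"

text \<open>Dynamic adversary: present t e says whether edge e is present in round t
  (rounds are 1,2,3,...). At most f edges are missing per round and the graph
  stays connected in every round.\<close>

definition f_adversary :: "nat \<Rightarrow> nat \<Rightarrow> (nat \<Rightarrow> nat) \<Rightarrow> (nat \<Rightarrow> nat \<Rightarrow> nat)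
                          \<Rightarrow> (nat \<Rightarrow> nat set \<Rightarrow> bool) \<Rightarrow> bool" where
  "f_adversary f n deg nbr present \<longleftrightarrow>
     (\<forall>t\<ge>1. card {e \<in> Edges n deg nbr. \<not> present t e} \<le> f
           \<and> connected_on n {e \<in> Edges n deg nbr. present t e})"

section \<open>Agents, algorithms and synchronous executions\<close>

text \<open>Agent memory and whiteboards are bit strings; their length is the number
  of bits used. What an agent sees in its Look phase:\<close>

record view =
  v_mem :: "bool list"                         \<comment> \<open>own memory\<close>
  v_wb :: "bool list"                          \<comment> \<open>whiteboard of current node\<close>
  v_deg :: nat                                 \<comment> \<open>degree of current node\<close>
  v_entry :: "nat option"                      \<comment> \<open>entry port (None before first move)\<close>
  v_lastok :: bool                             \<comment> \<open>did the previous move attempt succeed\<close>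
  v_others :: "(bool list \<times> bool) multiset"   \<comment> \<open>co-located agents: memory, terminated?\<close>

text \<open>An algorithm: initial memory as a function of the agent's ID, and a Compute
  function returning (new memory, port to attempt (None = stay), content written
  to the whiteboard, report). A report Some ps means the agent terminates and
  claims that the port sequence ps, followed from its current node, leads through
  safe nodes over an edge into the black hole.\<close>

record algo =
  a_init :: "nat \<Rightarrow> bool list"
  a_step :: "view \<Rightarrow> bool list \<times> nat option \<times> bool list \<times> nat list option"

record cfg =
  c_pos :: "nat \<Rightarrow> nat"
  c_mem :: "nat \<Rightarrow> bool list"
  c_alive :: "nat \<Rightarrow> bool"
  c_rep :: "nat \<Rightarrow> nat list option"
  c_entry :: "nat \<Rightarrow> nat option"
  c_lastok :: "nat \<Rightarrow> bool"
  c_wb :: "nat \<Rightarrow> bool list"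

definition active :: "cfg \<Rightarrow> nat \<Rightarrow> bool" where
  "active C a \<longleftrightarrow> c_alive C a \<and> c_rep C a = None"

definition view_of :: "nat \<Rightarrow> (nat \<Rightarrow> nat) \<Rightarrow> cfg \<Rightarrow> nat \<Rightarrow> view" where
  "view_of k deg C a =
    (let v = c_pos C a in
     \<lparr> v_mem = c_mem C a, v_wb = c_wb C v, v_deg = deg v, v_entry = c_entry C a,
       v_lastok = c_lastok C a,
       v_others = image_mset (\<lambda>b. (c_mem C b, c_rep C b \<noteq> None))
                    (mset_set {b. b < k \<and> b \<noteq> a \<and> c_alive C b \<and> c_pos C b = v}) \<rparr>)"

text \<open>Result of a move attempt: Some (new node, entry port) iff it succeeds.\<close>

definition try_move :: "(nat \<Rightarrow> nat) \<Rightarrow> (nat \<Rightarrow> nat \<Rightarrow> nat) \<Rightarrow> (nat \<Rightarrow> nat \<Rightarrow> nat)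
                        \<Rightarrow> (nat set \<Rightarrow> bool) \<Rightarrow> nat \<Rightarrow> nat option \<Rightarrow> (nat \<times> nat) option" where
  "try_move deg nbr back pres v mo =
     (case mo of None \<Rightarrow> None
      | Some p \<Rightarrow> if p < deg v \<and> pres {v, nbr v p} then Some (nbr v p, back v p) else None)"

text \<open>Whiteboard access: among the active agents at a node, the write of the one
  with the smallest ID takes effect.\<close>

definition writer :: "nat \<Rightarrow> (nat \<Rightarrow> nat) \<Rightarrow> cfg \<Rightarrow> nat \<Rightarrow> nat \<Rightarrow> bool" where
  "writer k ids C v a \<longleftrightarrow> a < k \<and> active C a \<and> c_pos C a = v \<and>
     (\<forall>b<k. active C b \<and> c_pos C b = v \<and> b \<noteq> a \<longrightarrow> ids a < ids b)"

definition next_cfg :: "algo \<Rightarrow> (nat \<Rightarrow> nat) \<Rightarrow> (nat \<Rightarrow> nat \<Rightarrow> nat) \<Rightarrow> (nat \<Rightarrow> nat \<Rightarrow> nat)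
     \<Rightarrow> nat \<Rightarrow> nat \<Rightarrow> (nat \<Rightarrow> nat) \<Rightarrow> (nat set \<Rightarrow> bool) \<Rightarrow> cfg \<Rightarrow> cfg" where
  "next_cfg alg deg nbr back bh k ids pres C =
    (let out = (\<lambda>a. a_step alg (view_of k deg C a));
         mv = (\<lambda>a. fst (snd (out a)));
         wr = (\<lambda>a. fst (snd (snd (out a))));
         rp = (\<lambda>a. snd (snd (snd (out a))));
         go = (\<lambda>a. active C a \<and> rp a = None);
         tm = (\<lambda>a. try_move deg nbr back pres (c_pos C a) (mv a))
     in \<lparr> c_pos = (\<lambda>a. if go a then (case tm a of None \<Rightarrow> c_pos C a | Some (u, q) \<Rightarrow> u)
                       else c_pos C a),
          c_mem = (\<lambda>a. if active C a then fst (out a) else c_mem C a),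
          c_alive = (\<lambda>a. if go a then (case tm a of None \<Rightarrow> True | Some (u, q) \<Rightarrow> u \<noteq> bh)
                         else c_alive C a),
          c_rep = (\<lambda>a. if active C a then rp a else c_rep C a),
          c_entry = (\<lambda>a. if go a then (case tm a of None \<Rightarrow> c_entry C a | Some (u, q) \<Rightarrow> Some q)
                         else c_entry C a),
          c_lastok = (\<lambda>a. if go a then (mv a = None \<or> tm a \<noteq> None) else c_lastok C a),
          c_wb = (\<lambda>v. if \<exists>a. writer k ids C v a then wr (THE a. writer k ids C v a)
                      else c_wb C v) \<rparr>)"

definition init_cfg :: "algo \<Rightarrow> nat \<Rightarrow> (nat \<Rightarrow> nat) \<Rightarrow> cfg" where
  "init_cfg alg s ids =
     \<lparr> c_pos = (\<lambda>a. s), c_mem = (\<lambda>a. a_init alg (ids a)), c_alive = (\<lambda>a. True),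
       c_rep = (\<lambda>a. None), c_entry = (\<lambda>a. None), c_lastok = (\<lambda>a. True),
       c_wb = (\<lambda>v. []) \<rparr>"

text \<open>run ... t is the configuration after t rounds (rooted start at s with k agents).\<close>

primrec run :: "algo \<Rightarrow> (nat \<Rightarrow> nat) \<Rightarrow> (nat \<Rightarrow> nat \<Rightarrow> nat) \<Rightarrow> (nat \<Rightarrow> nat \<Rightarrow> nat)
     \<Rightarrow> nat \<Rightarrow> nat \<Rightarrow> nat \<Rightarrow> (nat \<Rightarrow> nat) \<Rightarrow> (nat \<Rightarrow> nat set \<Rightarrow> bool) \<Rightarrow> nat \<Rightarrow> cfg" where
  "run alg deg nbr back bh s k ids present 0 = init_cfg alg s ids"
| "run alg deg nbr back bh s k ids present (Suc t) =
     next_cfg alg deg nbr back bh k ids (present (Suc t)) (run alg deg nbr back bh s k ids present t)"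

text \<open>A correct report: following the ports from v visits only safe nodes and the
  last edge enters the black hole.\<close>

fun leads_to_bh :: "(nat \<Rightarrow> nat) \<Rightarrow> (nat \<Rightarrow> nat \<Rightarrow> nat) \<Rightarrow> nat \<Rightarrow> nat \<Rightarrow> nat list \<Rightarrow> bool" where
  "leads_to_bh deg nbr bh v [] = False"
| "leads_to_bh deg nbr bh v (p # ps) =
     (v \<noteq> bh \<and> p < deg v \<and> (if ps = [] then nbr v p = bh else leads_to_bh deg nbr bh (nbr v p) ps))"

definition valid_ids :: "real \<Rightarrow> nat \<Rightarrow> nat \<Rightarrow> (nat \<Rightarrow> nat) \<Rightarrow> bool" where
  "valid_ids c n k ids \<longleftrightarrow> inj_on ids {..<k} \<and> (\<forall>a<k. 1 \<le> ids a \<and> real (ids a) \<le> real n powr c)"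

end

theory Submission
  imports Defs "HOL-Library.FuncSet"
begin

text \<open>
  The \<open>6 f\<close> agents form \<open>2 f\<close> trios. A trio explores an unknown port with a scout; while the scout is
  away it tries to return and the tester tries to follow, so in a round in which the edge is present
  they change places, and if both are gone the keeper knows that the port leads to the black hole.
  Ports known to be safe are crossed by all three at once.

  All trios but one are patient: they wait at their port, at most one per end of an edge, until the
  edge appears, and take the ports of a node in cyclic order. The remaining trio leaves a blocked
  port at once. The number of explored ports grows monotonically; consider a long period in which
  it is constant. If the patient trios return to the same situation after some of them has been
  given a port, then the set of nodes at which ports were handed out is closed under all edges that
  are not missing throughout, which contradicts connectivity. If they are all stuck, their \<open>2 f - 1\<close>
  waiting places account for all \<open>f\<close> missing edges, so the impatient trio walks through a static
  connected graph and cannot fail either. Hence the time is bounded by the number of situations of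
  the patient trios, times that of the impatient one, times the number of exploration steps.

  A patient and the impatient trio that probe the same edge from both ends would block both of its
  ends with a single missing edge; this is avoided by letting their scouts change places.\<close>

section \<open>Memories and whiteboards as bit strings\<close>

text \<open>\<open>f\<close> missing edges have \<open>2 * f\<close> ends, and patient trios may
  wait at both ends of one edge; with all \<open>2 * f\<close> trios patient, nothing in the count
  would exclude that all of them are frozen. When \<open>2 * f - 1\<close> trios are frozen, at most
  one further end is missing. It is the other end of an edge at which a trio already waits, so the
  missing edges cannot vary. The impatient trio cannot be held up while its scout or tester is away
  either, since both ends of its edge would be new. The same count is behind the two candidate ports
  \<open>low\<close> and \<open>high\<close> of a node: at most one of them can be blocked without
  being occupied. One abstract step costs three rounds because an agent learns only whether its own
  move succeeded. It moves in the first round, publishes the outcome in its memory in the second,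
  and in the third the agents at a node draw their conclusions from the published outcomes.\<close>

fun bits :: "nat \<Rightarrow> bool list" where
  "bits m = (if m = 0 then [False] else True # odd m # bits (m div 2))"

declare bits.simps [simp del]

text \<open>Every binary digit is announced by \<open>True\<close> and the end is marked by
  \<open>False\<close>, so codes can be concatenated without separators.\<close>

lemma bits_prefix_free: "bits a @ xs = bits b @ ys \<Longrightarrow> a = b \<and> xs = ys"
proof (induction a arbitrary: b rule: less_induct)
  case (less a)
  show ?case
  proof (cases "a = 0 \<or> b = 0")
    case True
    then show ?thesis using less.prems
      by (subst (asm) bits.simps[of a], subst (asm) bits.simps[of b]) (auto split: if_splits)
  next
    case False
    then have e: "odd a = odd b" "bits (a div 2) @ xs = bits (b div 2) @ ys"
      using less.prems
      by (subst (asm) (1) bits.simps[of a], subst (asm) (1) bits.simps[of b], simp)+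
    have "a div 2 = b div 2 \<and> xs = ys"
      by (rule less.IH) (use False e in auto)
    moreover have "a = b" if "a div 2 = b div 2"
      using that e(1) by (metis odd_iff_mod_2_eq_one even_iff_mod_2_eq_zero mult_div_mod_eq)
    ultimately show ?thesis by auto
  qed
qed

lemma bits_nonempty [simp]: "bits m \<noteq> []"
  by (subst bits.simps) auto

lemma inj_concat_bits: "inj (\<lambda>xs. concat (map bits xs))"
proof (rule injI)
  fix xs ys :: "nat list"
  show "concat (map bits xs) = concat (map bits ys) \<Longrightarrow> xs = ys"
  proof (induction xs arbitrary: ys)
    case Nil
    then show ?case by (cases ys) auto
  next
    case (Cons x xs)
    then obtain y ys' where "ys = y # ys'" by (cases ys) auto
    then show ?case using Cons.prems Cons.IH bits_prefix_free[of x _ y] by fastforce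
  qed
qed

text \<open>Two bits per binary digit and one for the end. Halving \<open>m\<close> saves two bits
  and lowers the logarithm by one; powers of two attain the bound.\<close>

lemma length_bits: "real (length (bits m)) \<le> 3 + 2 * log 2 (real (max 1 m))"
proof (induction m rule: less_induct)
  case (less m)
  show ?case
  proof (cases "m = 0")
    case True
    then show ?thesis by (subst bits.simps) auto
  next
    case False
    show ?thesis
    proof (cases "m = 1")
      case True
      then show ?thesis by (simp add: bits.simps[of "Suc 0"] bits.simps[of 0])
    next
      case m: False
      have "real (length (bits m)) = 2 + real (length (bits (m div 2)))"
        using False by (subst bits.simps) simp
      also have "\<dots> \<le> 2 + (3 + 2 * log 2 (real (max 1 (m div 2))))"
        using less.IH[of "m div 2"] False by simp
      also have "log 2 (real (max 1 (m div 2))) \<le> log 2 (real m / 2)"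
        using m False of_nat_div_le_of_nat[of m 2, where ?'a=real] by (intro log_mono) (auto simp: max_def)
      also have "log 2 (real m / 2) = log 2 (real m) - 1"
        using False by (simp add: log_divide)
      finally show ?thesis using False by (simp add: max_def)
    qed
  qed
qed

lemma length_concat_bits:
  assumes "\<forall>x \<in> set xs. real x \<le> B" "1 \<le> B"
  shows "real (length (concat (map bits xs))) \<le> real (length xs) * (3 + 2 * log 2 B)"
  using assms(1)
proof (induction xs)
  case (Cons x xs)
  have "real (length (bits x)) \<le> 3 + 2 * log 2 (real (max 1 x))" by (rule length_bits)
  also have "log 2 (real (max 1 x)) \<le> log 2 B"
    using Cons.prems assms(2) by (intro log_mono) (auto simp: max_def)
  finally show ?case using Cons by (simp add: algebra_simps)
qed simp

datatype role = Scout | Tester | Keeper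

text \<open>
  A trio is \<open>Idle\<close> when it is gathered and wants a port, \<open>Probe\<close> when its scout tries an
  unknown port, \<open>Verify\<close> when the scout is away (it tries to come back while the tester tries to
  follow), \<open>Recall\<close> when the tester is away and tries to come back, \<open>Cross\<close> when the port is known
  to be safe and all three try it together, and \<open>Found\<close> when scout and tester have both
  vanished.\<close>

datatype mode = Idle | Probe | Verify | Recall | Cross | Found

text \<open>\<open>Fresh i\<close> is the initial memory; the fields of \<open>Agent\<close> are the clock modulo 3, the number of
  the trio, role and mode, the port of the trio at its home node, the entry port of an agent away
  from home, and whether the last move succeeded.\<close>

datatype memory = Fresh nat | Agent nat nat role mode nat nat bool

text \<open>The patient trios and the impatient trio search from separate rotors \<open>rot\<close>
  and \<open>irot\<close>: the situation of the patient trios must not change while only the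
  impatient trio moves.\<close>

record board =
  low :: nat
  high :: nat
  rot :: nat
  irot :: nat

definition role_no :: "role \<Rightarrow> nat" where
  "role_no r = (case r of Scout \<Rightarrow> 0 | Tester \<Rightarrow> 1 | Keeper \<Rightarrow> 2)"

definition role_of :: "nat \<Rightarrow> role" where
  "role_of i = (if i = 0 then Scout else if i = 1 then Tester else Keeper)"

definition mode_no :: "mode \<Rightarrow> nat" where
  "mode_no m = (case m of Idle \<Rightarrow> 0 | Probe \<Rightarrow> 1 | Verify \<Rightarrow> 2 | Recall \<Rightarrow> 3 | Cross \<Rightarrow> 4 | Found \<Rightarrow> 5)"

fun memory_nos :: "memory \<Rightarrow> nat list" where
  "memory_nos (Fresh i) = [i]"
| "memory_nos (Agent c g r m p e b) = [c, g, role_no r, mode_no m, p, e, of_bool b]"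

text \<open>Whiteboards start empty, so the empty string has to denote a meaningful board. With
  \<open>low = high = 0\<close> every port is unknown.\<close>

definition board_nos :: "board \<Rightarrow> nat list" where
  "board_nos w = (if w = \<lparr>low = 0, high = 0, rot = 0, irot = 0\<rparr> then [] else [low w, high w, rot w, irot w])"

definition enc_mem :: "memory \<Rightarrow> bool list" where
  "enc_mem m = concat (map bits (memory_nos m))"

definition enc_board :: "board \<Rightarrow> bool list" where
  "enc_board w = concat (map bits (board_nos w))"

definition "dec_mem = inv enc_mem"
definition "dec_board = inv enc_board"

lemma role_no_inj: "role_no r = role_no r' \<longleftrightarrow> r = r'"
  by (cases r; cases r') (auto simp: role_no_def)

lemma mode_no_inj: "mode_no m = mode_no m' \<longleftrightarrow> m = m'"
  by (cases m; cases m') (auto simp: mode_no_def)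

lemma memory_nos_inj: "memory_nos m = memory_nos m' \<Longrightarrow> m = m'"
  by (cases m; cases m') (auto simp: role_no_inj mode_no_inj of_bool_def split: if_splits)

lemma board_nos_inj: "board_nos w = board_nos w' \<Longrightarrow> w = w'"
  by (auto simp: board_nos_def split: if_splits)

lemma dec_enc_mem [simp]: "dec_mem (enc_mem m) = m"
proof -
  have "inj enc_mem"
    by (intro injI memory_nos_inj) (use inj_concat_bits in \<open>auto simp: enc_mem_def dest: injD\<close>)
  then show ?thesis by (simp add: dec_mem_def)
qed

lemma dec_enc_board [simp]: "dec_board (enc_board w) = w"
proof -
  have "inj enc_board"
    by (intro injI board_nos_inj) (use inj_concat_bits in \<open>auto simp: enc_board_def dest: injD\<close>)
  then show ?thesis by (simp add: dec_board_def)
qed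

section \<open>The local algorithm\<close>

text \<open>A whiteboard has no room for a set of ports. The ports not handed out yet are \<open>low\<close> and those from
  \<open>high\<close> on; only \<open>low\<close> and \<open>high\<close> are handed out, so that one blocked port can be left behind.\<close>

definition unk :: "nat \<Rightarrow> board \<Rightarrow> nat set" where
  "unk d w = {p. p < d \<and> (p = low w \<or> high w \<le> p)}"

definition least_in :: "nat \<Rightarrow> nat set \<Rightarrow> nat" where
  "least_in d S = Min (insert d S)"

text \<open>The surviving ports are rounded up to one port and a final segment, so a dropped port
  above the new \<open>high\<close> counts as unknown again. The value \<open>d\<close> of
  \<open>least_in\<close> means that no port is left.\<close>

definition drop_ports :: "nat \<Rightarrow> nat set \<Rightarrow> board \<Rightarrow> board" where
  "drop_ports d Q w =
     (let S = unk d w - Q; l = least_in d S in w\<lparr>low := l, high := least_in d (S - {l})\<rparr>)"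

definition avail :: "nat \<Rightarrow> nat set \<Rightarrow> board \<Rightarrow> nat \<Rightarrow> bool" where
  "avail d Q w p \<longleftrightarrow> p < d \<and> p \<notin> Q \<and> (p \<in> unk d w \<longrightarrow> p = low w \<or> p = high w)"

definition offset :: "nat \<Rightarrow> nat \<Rightarrow> (nat \<Rightarrow> bool) \<Rightarrow> nat" where
  "offset d a P = (LEAST j. P ((a + j) mod d))"

definition pick :: "nat \<Rightarrow> nat \<Rightarrow> (nat \<Rightarrow> bool) \<Rightarrow> nat option" where
  "pick d a P = (if \<exists>p. P p then Some ((a + offset d a P) mod d) else None)"

definition port_mode :: "nat \<Rightarrow> board \<Rightarrow> nat \<Rightarrow> mode" where
  "port_mode d w p = (if p \<in> unk d w then Probe else Cross)"

text \<open>\<open>Q\<close> are the occupied ports, \<open>X\<close> further ports known to be safe; one patient trio is waiting if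
  \<open>pat\<close>, and the impatient trio wants a port if \<open>imp\<close>.\<close>

definition plan :: "nat \<Rightarrow> board \<Rightarrow> nat set \<Rightarrow> nat set \<Rightarrow> bool \<Rightarrow> bool \<Rightarrow> board \<times> nat option \<times> nat option" where
  "plan d w Q X pat imp =
     (let v = drop_ports d (Q \<union> X) w;
          a = (if pat then pick d (rot v) (avail d Q v) else None);
          b = (if imp \<and> a = None then pick d (irot v) (avail d Q v) else None)
      in (case a of
            Some p \<Rightarrow> drop_ports d (insert p (Q \<union> X)) (v\<lparr>rot := Suc p mod d\<rparr>)
          | None \<Rightarrow> (case b of Some p \<Rightarrow> v\<lparr>irot := Suc p mod d\<rparr> | None \<Rightarrow> v),
          a, b))"

text \<open>While it is gathered, the impatient trio may abandon its port; once its scout or tester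
  is away it has to stay, and the port is occupied.\<close>

definition holds :: "nat \<Rightarrow> mode \<Rightarrow> bool" where
  "holds g m \<longleftrightarrow> m \<noteq> Idle \<and> (g \<noteq> 0 \<or> m \<in> {Verify, Recall, Found})"

text \<open>Trio \<open>0\<close> is the impatient one.\<close>

definition assigned :: "nat \<Rightarrow> board \<Rightarrow> nat set \<Rightarrow> nat set \<Rightarrow> nat set \<Rightarrow> bool \<Rightarrow> nat \<Rightarrow> mode \<Rightarrow> nat \<Rightarrow> mode \<times> nat" where
  "assigned d w Q X I imp g m p =
     (case plan d w Q X (I \<noteq> {}) imp of (w', a, b) \<Rightarrow>
        let v = drop_ports d (Q \<union> X) w in
        if g = 0 \<and> m \<in> {Idle, Probe, Cross} then
          (case b of None \<Rightarrow> (Idle, p) | Some q \<Rightarrow> (port_mode d v q, q))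
        else if g \<noteq> 0 \<and> m = Idle \<and> g = Min I then
          (case a of None \<Rightarrow> (Idle, p) | Some q \<Rightarrow> (port_mode d v q, q))
        else (m, p))"

text \<open>While a scout or tester is away, its entry port is reserved too, so both ends of the
  edge are occupied. A probe whose scout has not left yet reserves at most its own end; this is
  where an exchange of scouts can arise.\<close>

definition occ_of :: "memory set \<Rightarrow> nat set" where
  "occ_of L = {p. \<exists>c g m e b. Agent c g Keeper m p e b \<in> L \<and> holds g m}
     \<union> {e. \<exists>c g p b. Agent c g Scout Verify p e b \<in> L} \<union> {e. \<exists>c g p b. Agent c g Tester Recall p e b \<in> L}"

text \<open>A port which the impatient trio knows to be safe is not occupied, because the trio may
  still leave it, but it must disappear from the unknown ports.\<close>

definition crossed_of :: "memory set \<Rightarrow> nat set" where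
  "crossed_of L = {p. \<exists>c e b. Agent c 0 Keeper Cross p e b \<in> L}"

definition idle_of :: "memory set \<Rightarrow> nat set" where
  "idle_of L = {g. g \<noteq> 0 \<and> (\<exists>c p e b. Agent c g Keeper Idle p e b \<in> L)}"

definition imp_of :: "memory set \<Rightarrow> bool" where
  "imp_of L \<longleftrightarrow> (\<exists>c m p e b. Agent c 0 Keeper m p e b \<in> L \<and> m \<in> {Idle, Probe, Cross})"

definition attempt :: "role \<Rightarrow> mode \<Rightarrow> nat \<Rightarrow> nat \<Rightarrow> nat option" where
  "attempt r m p e =
     (case m of
        Probe \<Rightarrow> (if r = Scout then Some p else None)
      | Verify \<Rightarrow> (case r of Scout \<Rightarrow> Some e | Tester \<Rightarrow> Some p | Keeper \<Rightarrow> None)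
      | Recall \<Rightarrow> (if r = Tester then Some e else None)
      | Cross \<Rightarrow> Some p
      | _ \<Rightarrow> None)"

definition present_role :: "memory set \<Rightarrow> nat \<Rightarrow> role \<Rightarrow> bool" where
  "present_role L g r \<longleftrightarrow> (\<exists>c m p e b. Agent c g r m p e b \<in> L)"

text \<open>The trio whose scout left through port \<open>e\<close> in exchange for a scout that arrived through it.\<close>

definition probers :: "memory set \<Rightarrow> nat \<Rightarrow> nat set" where
  "probers L e = {h. \<exists>c e' b. Agent c h Keeper Probe e e' b \<in> L}"

definition swapped :: "memory set \<Rightarrow> nat \<Rightarrow> bool" where
  "swapped L p \<longleftrightarrow> (\<exists>c g p'. Agent c g Scout Probe p' p True \<in> L)"

text \<open>The result is the trio, mode, port and entry port of an agent after a move.\<close>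

definition resolve :: "memory set \<Rightarrow> nat \<Rightarrow> role \<Rightarrow> mode \<Rightarrow> nat \<Rightarrow> nat \<Rightarrow> bool \<Rightarrow> nat \<times> mode \<times> nat \<times> nat" where
  "resolve L g r m p e b =
     (case m of
        Idle \<Rightarrow> (g, Idle, p, 0)
      | Probe \<Rightarrow>
          if r = Scout then
            if \<not> b then (g, Probe, p, 0)
            else if probers L e \<noteq> {} then (Min (probers L e), Cross, e, 0)
            else (g, Verify, p, e)
          else if present_role L g Scout then (g, Probe, p, 0)
          else if swapped L p then (g, Cross, p, 0)
          else (g, Verify, p, 0)
      | Verify \<Rightarrow>
          (case r of
             Scout \<Rightarrow> if b then (g, Recall, p, 0) else (g, Verify, p, e)
           | Tester \<Rightarrow> if b then (g, Recall, p, e) else (g, Verify, p, 0)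
           | Keeper \<Rightarrow>
               if present_role L g Scout then (g, Recall, p, 0)
               else if present_role L g Tester then (g, Verify, p, 0)
               else (g, Found, p, 0))
      | Recall \<Rightarrow>
          if r = Tester then (if b then (g, Cross, p, 0) else (g, Recall, p, e))
          else if present_role L g Tester then (g, Cross, p, 0)
          else (g, Recall, p, 0)
      | Cross \<Rightarrow> if b then (g, Idle, p, 0) else (g, Cross, p, 0)
      | Found \<Rightarrow> (g, Found, p, 0))"

type_synonym action = "memory \<times> nat option \<times> board \<times> nat list option"

text \<open>In the first round all agents are together, so the rank of an ID among the IDs in view
  is its global rank and fixes trio and role. Afterwards the clock runs through planning and moving
  (0), announcing (1) and resolving (2).\<close>

definition act :: "memory \<Rightarrow> memory set \<Rightarrow> board \<Rightarrow> nat \<Rightarrow> nat option \<Rightarrow> bool \<Rightarrow> action" where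
  "act me L w d ent ok =
     (case me of
        Fresh i \<Rightarrow>
          let k = card {j. j < i \<and> Fresh j \<in> L}
          in (Agent 0 (k div 3) (role_of (k mod 3)) Idle 0 0 False, None, w, None)
      | Agent c g r m p e b \<Rightarrow>
          if c = 0 then
            let Q = occ_of L; X = crossed_of L; I = idle_of L; imp = imp_of L;
                (m', p') = assigned d w Q X I imp g m p
            in (Agent 1 g r m' p' e False, attempt r m' p' e, fst (plan d w Q X (I \<noteq> {}) imp), None)
          else if c = 1 then
            let b' = (ok \<and> attempt r m p e \<noteq> None)
            in (Agent 2 g r m p (if b' then the ent else e) b', None, w, None)
          else
            let (g', m', p', e') = resolve L g r m p e b
            in (Agent 0 g' r m' p' e' False, None, w, if m' = Found then Some [p'] else None))"

definition bhs_algo :: algo where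
  "bhs_algo =
     \<lparr> a_init = (\<lambda>i. enc_mem (Fresh i)),
       a_step = (\<lambda>V.
         let me = dec_mem (v_mem V);
             L = insert me ((\<lambda>x. dec_mem (fst x)) ` set_mset (v_others V));
             (me', mv, w', rep) = act me L (dec_board (v_wb V)) (v_deg V) (v_entry V) (v_lastok V)
         in (enc_mem me', mv, enc_board w', rep)) \<rparr>"

subsection \<open>Port bookkeeping\<close>

lemma least_in_le: "finite S \<Longrightarrow> least_in d S \<le> d"
  by (simp add: least_in_def)

lemma least_in_mem: "finite S \<Longrightarrow> least_in d S < d \<Longrightarrow> least_in d S \<in> S"
  using Min_in[of "insert d S"] by (auto simp: least_in_def)

lemma least_in_lb: "finite S \<Longrightarrow> x \<in> S \<Longrightarrow> least_in d S \<le> x"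
  by (simp add: least_in_def)

lemma finite_unk [simp]: "finite (unk d w)"
  by (simp add: unk_def)

lemma low_drop: "low (drop_ports d Q w) = least_in d (unk d w - Q)"
  and high_drop: "high (drop_ports d Q w) = least_in d (unk d w - Q - {least_in d (unk d w - Q)})"
  and rot_drop [simp]: "rot (drop_ports d Q w) = rot w"
  and irot_drop [simp]: "irot (drop_ports d Q w) = irot w"
  by (simp_all add: drop_ports_def Let_def)

lemma drop_bounds:
  "low (drop_ports d Q w) \<le> high (drop_ports d Q w)" "high (drop_ports d Q w) \<le> d"
  "low (drop_ports d Q w) < d \<Longrightarrow> low (drop_ports d Q w) \<in> unk d w - Q"
  "high (drop_ports d Q w) < d \<Longrightarrow> high (drop_ports d Q w) \<in> unk d w - Q"
  "high (drop_ports d Q w) < d \<Longrightarrow> low (drop_ports d Q w) < high (drop_ports d Q w)"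
proof -
  let ?S = "unk d w - Q"
  let ?l = "least_in d ?S"
  let ?h = "least_in d (?S - {?l})"
  show "high (drop_ports d Q w) \<le> d" by (simp add: high_drop least_in_le)
  show "low (drop_ports d Q w) < d \<Longrightarrow> low (drop_ports d Q w) \<in> unk d w - Q"
    using least_in_mem[of ?S d] by (simp add: low_drop)
  have h: "?h \<in> ?S - {?l}" if "?h < d" using that least_in_mem[of "?S - {?l}" d] by simp
  show "high (drop_ports d Q w) < d \<Longrightarrow> high (drop_ports d Q w) \<in> unk d w - Q"
    using h by (simp add: high_drop)
  show lt: "high (drop_ports d Q w) < d \<Longrightarrow> low (drop_ports d Q w) < high (drop_ports d Q w)"
    using h least_in_lb[of ?S ?h d] by (force simp: high_drop low_drop)
  show "low (drop_ports d Q w) \<le> high (drop_ports d Q w)"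
    using lt least_in_le[of "?S - {?l}" d] least_in_le[of ?S d]
    by (cases "high (drop_ports d Q w) < d") (auto simp: high_drop low_drop)
qed

text \<open>If the new \<open>high\<close> is a port, it is the larger of two old unknown ports and
  therefore at least the old \<open>high\<close>; so the new final segment lies in the old
  one.\<close>

lemma unk_drop_subset:
  assumes "low w \<le> high w"
  shows "unk d (drop_ports d Q w) \<subseteq> unk d w"
proof
  fix p assume p: "p \<in> unk d (drop_ports d Q w)"
  note b = drop_bounds[of d Q w]
  show "p \<in> unk d w"
  proof (cases "p = low (drop_ports d Q w)")
    case True
    then show ?thesis using b(3) p by (auto simp: unk_def)
  next
    case False
    then have h: "high (drop_ports d Q w) \<le> p" "p < d" using p by (auto simp: unk_def)
    then have "high (drop_ports d Q w) \<in> unk d w" "low (drop_ports d Q w) \<in> unk d w"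
      "low (drop_ports d Q w) < high (drop_ports d Q w)" using b by auto
    then have "high w \<le> high (drop_ports d Q w)"
      using assms by (auto simp: unk_def)
    then show ?thesis using h by (auto simp: unk_def)
  qed
qed

lemma unk_drop_supset: "unk d w - Q \<subseteq> unk d (drop_ports d Q w)"
proof
  fix p assume p: "p \<in> unk d w - Q"
  let ?S = "unk d w - Q"
  have "p < d" using p by (auto simp: unk_def)
  moreover have "least_in d (?S - {least_in d ?S}) \<le> p" if "p \<noteq> least_in d ?S"
    using p that by (intro least_in_lb) auto
  ultimately show "p \<in> unk d (drop_ports d Q w)"
    by (auto simp: unk_def low_drop high_drop)
qed

text \<open>Only for the two candidates is dropping certain to be effective, since other dropped
  ports may be absorbed by the final segment. Hence the invariants insist that a port about to be
  dropped is \<open>low\<close> or \<open>high\<close>.\<close>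

lemma unk_drop_candidate:
  assumes "low w \<le> high w" "p \<in> Q" "p = low w \<or> p = high w"
  shows "p \<notin> unk d (drop_ports d Q w)"
proof
  assume p: "p \<in> unk d (drop_ports d Q w)"
  note b = drop_bounds[of d Q w]
  have pd: "p < d" using p by (auto simp: unk_def)
  have "p \<noteq> low (drop_ports d Q w)" using b(3) assms(2) pd by auto
  then have h: "high (drop_ports d Q w) \<le> p" using p by (auto simp: unk_def)
  then have m: "high (drop_ports d Q w) \<in> unk d w - Q" "low (drop_ports d Q w) \<in> unk d w - Q"
      "low (drop_ports d Q w) < high (drop_ports d Q w)" using b pd by auto
  then have "high w \<le> high (drop_ports d Q w)"
    using assms(1) by (auto simp: unk_def)
  moreover have "high (drop_ports d Q w) \<noteq> p" using m assms(2) by auto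
  ultimately show False using h assms(1,3) by auto
qed

lemma unk_rot [simp]: "unk d (w\<lparr>rot := i\<rparr>) = unk d w" "unk d (w\<lparr>irot := i\<rparr>) = unk d w"
  by (simp_all add: unk_def)

lemma avail_drop_low:
  assumes "low (drop_ports d (Q \<union> X) w) < d"
  shows "avail d Q (drop_ports d (Q \<union> X) w) (low (drop_ports d (Q \<union> X) w))"
  using assms drop_bounds(3)[of d "Q \<union> X" w] by (auto simp: avail_def)

lemma avail_drop_high:
  assumes "high (drop_ports d (Q \<union> X) w) < d"
  shows "avail d Q (drop_ports d (Q \<union> X) w) (high (drop_ports d (Q \<union> X) w))"
  using assms drop_bounds(4)[of d "Q \<union> X" w] by (auto simp: avail_def)

text \<open>If the free port is unknown, then \<open>low\<close> is a port and is available. So a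
  search fails only at a node all of whose ports are occupied.\<close>

lemma avail_exists:
  assumes "p < d" "p \<notin> Q"
  shows "\<exists>q. avail d Q (drop_ports d (Q \<union> X) w) q"
proof (cases "p \<in> unk d (drop_ports d (Q \<union> X) w)")
  case True
  then have "low (drop_ports d (Q \<union> X) w) < d"
    using drop_bounds(1)[of d "Q \<union> X" w] by (auto simp: unk_def)
  then show ?thesis using avail_drop_low by blast
next
  case False
  then show ?thesis using assms by (auto simp: avail_def)
qed

lemma pick_SomeD:
  assumes "pick d a P = Some p" "\<And>q. P q \<Longrightarrow> q < d"
  shows "p = (a + offset d a P) mod d" "P p" "p < d" "\<And>j. j < offset d a P \<Longrightarrow> \<not> P ((a + j) mod d)"
proof -
  obtain q where q: "P q" and p: "p = (a + offset d a P) mod d"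
    using assms(1) by (auto simp: pick_def split: if_splits)
  then show "p = (a + offset d a P) mod d" by simp
  have d: "q < d" using q assms(2) by auto
  \<comment> \<open>An offset that leads from \<open>a\<close> to \<open>q\<close> without truncated
    subtraction: \<open>a\<close> and \<open>a * (d - 1)\<close> add up to a multiple of
    \<open>d\<close>.\<close>
  have "(a + (q + a * (d - 1))) mod d = q"
  proof -
    have "a + (q + a * (d - 1)) = q + a * d" using d by (cases d) (auto simp: algebra_simps)
    then show ?thesis using d by (metis mod_mult_self1 mod_less)
  qed
  then have "\<exists>j. P ((a + j) mod d)" using q by metis
  then show "P p" unfolding p offset_def by (rule LeastI_ex)
  then show "p < d" by (rule assms(2))
  show "\<And>j. j < offset d a P \<Longrightarrow> \<not> P ((a + j) mod d)"
    unfolding offset_def by (rule not_less_Least)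
qed

lemma pick_None: "pick d a P = None \<longleftrightarrow> (\<nexists>p. P p)"
  by (auto simp: pick_def)

lemma avail_less: "avail d Q w p \<Longrightarrow> p < d"
  by (simp add: avail_def)

section \<open>The trios as an abstract transition system\<close>

record state =
  hm :: "nat \<Rightarrow> nat"
  md :: "nat \<Rightarrow> mode"
  pt :: "nat \<Rightarrow> nat"
  bd :: "nat \<Rightarrow> board"

locale trios =
  fixes n :: nat and deg :: "nat \<Rightarrow> nat" and nbr bck :: "nat \<Rightarrow> nat \<Rightarrow> nat" and bh G :: nat
  assumes graph: "port_graph n deg nbr bck" and bh: "bh < n" and G: "1 \<le> G" and n2: "2 \<le> n"
begin

lemma nbrD:
  assumes "v < n" "p < deg v"
  shows "nbr v p < n" "nbr v p \<noteq> v" "bck v p < deg (nbr v p)"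
    "nbr (nbr v p) (bck v p) = v" "bck (nbr v p) (bck v p) = p"
  using graph assms by (auto simp: port_graph_def)

lemma nbr_inj: "v < n \<Longrightarrow> p < deg v \<Longrightarrow> q < deg v \<Longrightarrow> nbr v p = nbr v q \<Longrightarrow> p = q"
  using graph by (auto simp: port_graph_def)

definition occ :: "state \<Rightarrow> nat \<Rightarrow> nat set" where
  "occ M u = {pt M g |g. g < G \<and> holds g (md M g) \<and> hm M g = u}
     \<union> {bck (hm M g) (pt M g) |g. g < G \<and> md M g \<in> {Verify, Recall} \<and> nbr (hm M g) (pt M g) = u}"

definition crossed :: "state \<Rightarrow> nat \<Rightarrow> nat set" where
  "crossed M u = {p. p = pt M 0 \<and> md M 0 = Cross \<and> hm M 0 = u}"

definition idle :: "state \<Rightarrow> nat \<Rightarrow> nat set" where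
  "idle M u = {g. g < G \<and> g \<noteq> 0 \<and> md M g = Idle \<and> hm M g = u}"

definition impatient :: "state \<Rightarrow> nat \<Rightarrow> bool" where
  "impatient M u \<longleftrightarrow> hm M 0 = u \<and> md M 0 \<in> {Idle, Probe, Cross}"

text \<open>In mode \<open>Verify\<close> the far node may be \<open>bh\<close>: the scout is then
  already destroyed, although no agent knows it.\<close>

definition loc :: "state \<Rightarrow> nat \<Rightarrow> role \<Rightarrow> nat" where
  "loc M g r =
     (if md M g = Verify \<and> r = Scout \<or> md M g = Recall \<and> r = Tester then nbr (hm M g) (pt M g)
      else if md M g = Found \<and> r \<noteq> Keeper then bh else hm M g)"

text \<open>These are the nodes at which somebody still writes. Of a trio in mode
  \<open>Found\<close> only the keeper survives, and it has terminated.\<close>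

definition lively :: "state \<Rightarrow> nat \<Rightarrow> bool" where
  "lively M u \<longleftrightarrow> u \<noteq> bh \<and> (\<exists>g<G. \<exists>r. loc M g r = u \<and> md M g \<noteq> Found)"

definition plan_at :: "state \<Rightarrow> nat \<Rightarrow> board \<times> nat option \<times> nat option" where
  "plan_at M u = plan (deg u) (bd M u) (occ M u) (crossed M u) (idle M u \<noteq> {}) (impatient M u)"

definition assign :: "state \<Rightarrow> nat \<Rightarrow> mode \<times> nat" where
  "assign M g = assigned (deg (hm M g)) (bd M (hm M g)) (occ M (hm M g)) (crossed M (hm M g))
     (idle M (hm M g)) (impatient M (hm M g)) g (md M g) (pt M g)"

definition planned :: "state \<Rightarrow> state" where
  "planned M = M\<lparr>md := \<lambda>g. fst (assign M g), pt := \<lambda>g. snd (assign M g),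
                 bd := \<lambda>u. if lively M u then fst (plan_at M u) else bd M u\<rparr>"

definition far :: "state \<Rightarrow> nat \<Rightarrow> nat" where
  "far M g = nbr (hm M g) (pt M g)"

definition open_for :: "(nat set \<Rightarrow> bool) \<Rightarrow> state \<Rightarrow> nat \<Rightarrow> bool" where
  "open_for pr M g \<longleftrightarrow> pr {hm M g, far M g}"

definition exchange :: "state \<Rightarrow> nat \<Rightarrow> nat set" where
  "exchange M g = {h. h < G \<and> md M h = Probe \<and> hm M h = far M g \<and> pt M h = bck (hm M g) (pt M g)}"

text \<open>The agents cannot test for \<open>bh\<close>; this rule is realised locally by observing
  who is present after the move.\<close>

definition next_mode :: "(nat set \<Rightarrow> bool) \<Rightarrow> state \<Rightarrow> nat \<Rightarrow> mode" where
  "next_mode pr M g =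
     (if \<not> open_for pr M g then md M g
      else case md M g of
        Probe \<Rightarrow> if far M g \<noteq> bh \<and> exchange M g \<noteq> {} then Cross else Verify
      | Verify \<Rightarrow> if far M g = bh then Found else Recall
      | Recall \<Rightarrow> Cross
      | Cross \<Rightarrow> Idle
      | m \<Rightarrow> m)"

definition moved :: "(nat set \<Rightarrow> bool) \<Rightarrow> state \<Rightarrow> state" where
  "moved pr M = M\<lparr>md := next_mode pr M,
                  hm := \<lambda>g. if md M g = Cross \<and> open_for pr M g then far M g else hm M g\<rparr>"

definition step :: "(nat set \<Rightarrow> bool) \<Rightarrow> state \<Rightarrow> state" where
  "step pr M = moved pr (planned M)"

abbreviation unknown :: "state \<Rightarrow> nat \<Rightarrow> nat set" where
  "unknown M u \<equiv> unk (deg u) (bd M u)"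

section \<open>Invariants and their preservation\<close>

definition board_ok :: "nat \<Rightarrow> board \<Rightarrow> bool" where
  "board_ok d w \<longleftrightarrow> low w \<le> high w \<and> high w \<le> d \<and> rot w < d \<and> irot w < d"

definition consistent :: "state \<Rightarrow> bool" where
  "consistent M \<longleftrightarrow>
     (\<forall>g<G. hm M g < n \<and> hm M g \<noteq> bh \<and> (md M g \<noteq> Idle \<longrightarrow> pt M g < deg (hm M g)))
   \<and> (\<forall>g<G. (md M g \<in> {Recall, Cross} \<longrightarrow> far M g \<noteq> bh) \<and> (md M g = Found \<longrightarrow> far M g = bh))
   \<and> (\<forall>g<G. \<forall>h<G. holds g (md M g) \<longrightarrow> holds h (md M h) \<longrightarrow> hm M g = hm M h \<longrightarrow> pt M g = pt M h \<longrightarrow> g = h)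
   \<and> (\<forall>u<n. \<forall>p<deg u. u \<noteq> bh \<longrightarrow> p \<notin> unknown M u \<longrightarrow> nbr u p = bh \<longrightarrow>
        (\<exists>g<G. holds g (md M g) \<and> hm M g = u \<and> pt M g = p))
   \<and> (\<forall>g<G. g \<noteq> 0 \<longrightarrow> md M g \<noteq> Idle \<longrightarrow> pt M g \<notin> unknown M (hm M g))
   \<and> (md M 0 \<in> {Recall, Found} \<longrightarrow> pt M 0 \<notin> unknown M (hm M 0))
   \<and> (md M 0 \<in> {Verify, Cross} \<longrightarrow> pt M 0 \<in> unknown M (hm M 0) \<longrightarrow>
        pt M 0 \<in> {low (bd M (hm M 0)), high (bd M (hm M 0))})
   \<and> (\<forall>g<G. \<forall>h<G. md M g \<in> {Verify, Recall} \<longrightarrow> far M g \<noteq> bh \<longrightarrow> holds h (md M h) \<longrightarrow>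
        \<not> (hm M h = far M g \<and> pt M h = bck (hm M g) (pt M g)))
   \<and> (\<forall>u<n. u \<noteq> bh \<longrightarrow> board_ok (deg u) (bd M u))"

text \<open>Between planning and moving the impatient trio, too, has its port for itself, so the
  clauses about occupied ports extend to all modes but \<open>Idle\<close>. Only a port that it
  probes is still unknown.\<close>

definition mid :: "state \<Rightarrow> bool" where
  "mid M \<longleftrightarrow>
     (\<forall>g<G. hm M g < n \<and> hm M g \<noteq> bh \<and> (md M g \<noteq> Idle \<longrightarrow> pt M g < deg (hm M g)))
   \<and> (\<forall>g<G. (md M g \<in> {Recall, Cross} \<longrightarrow> far M g \<noteq> bh) \<and> (md M g = Found \<longrightarrow> far M g = bh))
   \<and> (\<forall>g<G. \<forall>h<G. md M g \<noteq> Idle \<longrightarrow> md M h \<noteq> Idle \<longrightarrow> hm M g = hm M h \<longrightarrow> pt M g = pt M h \<longrightarrow> g = h)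
   \<and> (\<forall>u<n. \<forall>p<deg u. u \<noteq> bh \<longrightarrow> p \<notin> unknown M u \<longrightarrow> nbr u p = bh \<longrightarrow>
        (\<exists>g<G. md M g \<noteq> Idle \<and> hm M g = u \<and> pt M g = p))
   \<and> (\<forall>g<G. md M g \<noteq> Idle \<longrightarrow> (g \<noteq> 0 \<or> md M g \<noteq> Probe) \<longrightarrow> pt M g \<notin> unknown M (hm M g))
   \<and> (md M 0 = Probe \<longrightarrow> pt M 0 \<in> unknown M (hm M 0) \<and>
        pt M 0 \<in> {low (bd M (hm M 0)), high (bd M (hm M 0))})
   \<and> (\<forall>g<G. \<forall>h<G. md M g \<in> {Verify, Recall} \<longrightarrow> far M g \<noteq> bh \<longrightarrow> md M h \<noteq> Idle \<longrightarrow>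
        \<not> (hm M h = far M g \<and> pt M h = bck (hm M g) (pt M g)))
   \<and> (\<forall>u<n. u \<noteq> bh \<longrightarrow> board_ok (deg u) (bd M u))"

lemma consistentD:
  assumes "consistent M"
  shows "\<And>g. g < G \<Longrightarrow> hm M g < n" "\<And>g. g < G \<Longrightarrow> hm M g \<noteq> bh"
    "\<And>g. g < G \<Longrightarrow> md M g \<noteq> Idle \<Longrightarrow> pt M g < deg (hm M g)"
    "\<And>g. g < G \<Longrightarrow> md M g = Recall \<or> md M g = Cross \<Longrightarrow> far M g \<noteq> bh"
    "\<And>g. g < G \<Longrightarrow> md M g = Found \<Longrightarrow> far M g = bh"
    "\<And>g h. g < G \<Longrightarrow> h < G \<Longrightarrow> holds g (md M g) \<Longrightarrow> holds h (md M h) \<Longrightarrow> hm M g = hm M h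
        \<Longrightarrow> pt M g = pt M h \<Longrightarrow> g = h"
    "\<And>u p. u < n \<Longrightarrow> p < deg u \<Longrightarrow> u \<noteq> bh \<Longrightarrow> p \<notin> unknown M u \<Longrightarrow> nbr u p = bh
        \<Longrightarrow> \<exists>g<G. holds g (md M g) \<and> hm M g = u \<and> pt M g = p"
    "\<And>g. g < G \<Longrightarrow> g \<noteq> 0 \<Longrightarrow> md M g \<noteq> Idle \<Longrightarrow> pt M g \<notin> unknown M (hm M g)"
    "md M 0 = Recall \<or> md M 0 = Found \<Longrightarrow> pt M 0 \<notin> unknown M (hm M 0)"
    "md M 0 = Verify \<or> md M 0 = Cross \<Longrightarrow> pt M 0 \<in> unknown M (hm M 0) \<Longrightarrow>
        pt M 0 = low (bd M (hm M 0)) \<or> pt M 0 = high (bd M (hm M 0))"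
    "\<And>g h. g < G \<Longrightarrow> h < G \<Longrightarrow> md M g = Verify \<or> md M g = Recall \<Longrightarrow> far M g \<noteq> bh \<Longrightarrow> holds h (md M h)
        \<Longrightarrow> hm M h = far M g \<Longrightarrow> pt M h = bck (hm M g) (pt M g) \<Longrightarrow> False"
    "\<And>u. u < n \<Longrightarrow> u \<noteq> bh \<Longrightarrow> board_ok (deg u) (bd M u)"
  using assms unfolding consistent_def insert_iff empty_iff HOL.simp_thms by (elim conjE; metis)+

lemma midD:
  assumes "mid M"
  shows "\<And>g. g < G \<Longrightarrow> hm M g < n" "\<And>g. g < G \<Longrightarrow> hm M g \<noteq> bh"
    "\<And>g. g < G \<Longrightarrow> md M g \<noteq> Idle \<Longrightarrow> pt M g < deg (hm M g)"
    "\<And>g. g < G \<Longrightarrow> md M g = Recall \<or> md M g = Cross \<Longrightarrow> far M g \<noteq> bh"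
    "\<And>g. g < G \<Longrightarrow> md M g = Found \<Longrightarrow> far M g = bh"
    "\<And>g h. g < G \<Longrightarrow> h < G \<Longrightarrow> md M g \<noteq> Idle \<Longrightarrow> md M h \<noteq> Idle \<Longrightarrow> hm M g = hm M h
        \<Longrightarrow> pt M g = pt M h \<Longrightarrow> g = h"
    "\<And>u p. u < n \<Longrightarrow> p < deg u \<Longrightarrow> u \<noteq> bh \<Longrightarrow> p \<notin> unknown M u \<Longrightarrow> nbr u p = bh
        \<Longrightarrow> \<exists>g<G. md M g \<noteq> Idle \<and> hm M g = u \<and> pt M g = p"
    "\<And>g. g < G \<Longrightarrow> md M g \<noteq> Idle \<Longrightarrow> g \<noteq> 0 \<or> md M g \<noteq> Probe \<Longrightarrow> pt M g \<notin> unknown M (hm M g)"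
    "md M 0 = Probe \<Longrightarrow> pt M 0 \<in> unknown M (hm M 0)"
    "md M 0 = Probe \<Longrightarrow> pt M 0 = low (bd M (hm M 0)) \<or> pt M 0 = high (bd M (hm M 0))"
    "\<And>g h. g < G \<Longrightarrow> h < G \<Longrightarrow> md M g = Verify \<or> md M g = Recall \<Longrightarrow> far M g \<noteq> bh \<Longrightarrow> md M h \<noteq> Idle
        \<Longrightarrow> hm M h = far M g \<Longrightarrow> pt M h = bck (hm M g) (pt M g) \<Longrightarrow> False"
    "\<And>u. u < n \<Longrightarrow> u \<noteq> bh \<Longrightarrow> board_ok (deg u) (bd M u)"
  using assms unfolding mid_def insert_iff empty_iff HOL.simp_thms by (elim conjE; metis)+

definition fresh_board :: "state \<Rightarrow> nat \<Rightarrow> board" where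
  "fresh_board M u = drop_ports (deg u) (occ M u \<union> crossed M u) (bd M u)"

definition patient_choice :: "state \<Rightarrow> nat \<Rightarrow> nat option" where
  "patient_choice M u = (if idle M u \<noteq> {} then
     pick (deg u) (rot (bd M u)) (avail (deg u) (occ M u) (fresh_board M u)) else None)"

definition imp_choice :: "state \<Rightarrow> nat \<Rightarrow> nat option" where
  "imp_choice M u = (if impatient M u \<and> patient_choice M u = None then
     pick (deg u) (irot (bd M u)) (avail (deg u) (occ M u) (fresh_board M u)) else None)"

lemma plan_at_eq:
  "plan_at M u =
     (case patient_choice M u of
        Some p \<Rightarrow> drop_ports (deg u) (insert p (occ M u \<union> crossed M u)) ((fresh_board M u)\<lparr>rot := Suc p mod deg u\<rparr>)
      | None \<Rightarrow> (case imp_choice M u of Some p \<Rightarrow> (fresh_board M u)\<lparr>irot := Suc p mod deg u\<rparr>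
                 | None \<Rightarrow> fresh_board M u),
      patient_choice M u, imp_choice M u)"
  unfolding plan_at_def plan_def Let_def patient_choice_def imp_choice_def fresh_board_def rot_drop irot_drop ..

lemma assign_eq:
  "assign M g =
     (let u = hm M g in
      if g = 0 \<and> md M g \<in> {Idle, Probe, Cross} then
        (case imp_choice M u of None \<Rightarrow> (Idle, pt M g) | Some q \<Rightarrow> (port_mode (deg u) (fresh_board M u) q, q))
      else if g \<noteq> 0 \<and> md M g = Idle \<and> g = Min (idle M u) then
        (case patient_choice M u of None \<Rightarrow> (Idle, pt M g) | Some q \<Rightarrow> (port_mode (deg u) (fresh_board M u) q, q))
      else (md M g, pt M g))"
proof -
  have "plan (deg u) (bd M u) (occ M u) (crossed M u) (idle M u \<noteq> {}) (impatient M u) = plan_at M u" for u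
    by (simp add: plan_at_def)
  then show ?thesis
    unfolding assign_def assigned_def plan_at_eq Let_def fresh_board_def by (simp only: plan_at_eq prod.case fresh_board_def)
qed

lemma lively_home: "consistent M \<or> mid M \<Longrightarrow> g < G \<Longrightarrow> md M g \<noteq> Found \<Longrightarrow> lively M (hm M g)"
  using consistentD(2) midD(2) by (auto simp: lively_def loc_def intro!: exI[of _ g] exI[of _ Keeper])

lemma choiceD:
  assumes "patient_choice M u = Some p \<or> imp_choice M u = Some p"
  shows "avail (deg u) (occ M u) (fresh_board M u) p" "p < deg u" "p \<notin> occ M u"
proof -
  obtain a where a: "pick (deg u) a (avail (deg u) (occ M u) (fresh_board M u)) = Some p"
    using assms by (auto simp: patient_choice_def imp_choice_def split: if_splits)
  show "avail (deg u) (occ M u) (fresh_board M u) p"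
    by (rule pick_SomeD(2)[OF a]) (rule avail_less)
  then show "p < deg u" "p \<notin> occ M u" by (auto simp: avail_def)
qed


lemma assign_cases:
  assumes "g < G"
  obtains
    (same) "assign M g = (md M g, pt M g)" "g = 0 \<Longrightarrow> md M g \<notin> {Idle, Probe, Cross}"
  | (rest) "assign M g = (Idle, pt M g)"
      "g = 0 \<and> md M g \<in> {Idle, Probe, Cross} \<and> imp_choice M (hm M g) = None
       \<or> g \<noteq> 0 \<and> md M g = Idle \<and> g = Min (idle M (hm M g)) \<and> patient_choice M (hm M g) = None"
  | (imp) q where "g = 0" "md M g \<in> {Idle, Probe, Cross}" "imp_choice M (hm M g) = Some q"
      "assign M g = (port_mode (deg (hm M g)) (fresh_board M (hm M g)) q, q)"
  | (patient) q where "g \<noteq> 0" "md M g = Idle" "g = Min (idle M (hm M g))" "patient_choice M (hm M g) = Some q"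
      "assign M g = (port_mode (deg (hm M g)) (fresh_board M (hm M g)) q, q)"
proof (cases "g = 0 \<and> md M g \<in> {Idle, Probe, Cross}")
  case True
  show ?thesis
  proof (cases "imp_choice M (hm M g)")
    case None
    then show ?thesis using True by (intro rest) (auto simp: assign_eq Let_def)
  next
    case (Some q)
    then show ?thesis using True by (intro imp[of q]) (auto simp: assign_eq Let_def)
  qed
next
  case ng: False
  show ?thesis
  proof (cases "g \<noteq> 0 \<and> md M g = Idle \<and> g = Min (idle M (hm M g))")
    case True
    then have e: "assign M g = (case patient_choice M (hm M g) of None \<Rightarrow> (Idle, pt M g)
        | Some q \<Rightarrow> (port_mode (deg (hm M g)) (fresh_board M (hm M g)) q, q))"
      unfolding assign_eq Let_def using ng by presburger
    show ?thesis
    proof (cases "patient_choice M (hm M g)")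
      case None
      then show ?thesis using True e by (intro rest) simp_all
    next
      case (Some q)
      then show ?thesis using True e by (intro patient[of q]) simp_all
    qed
  next
    case False
    show ?thesis
      by (rule same) (use ng False in \<open>auto simp: assign_eq Let_def\<close>)
  qed
qed

lemma planned_simps [simp]:
  "hm (planned M) = hm M"
  "md (planned M) g = fst (assign M g)"
  "pt (planned M) g = snd (assign M g)"
  "bd (planned M) u = (if lively M u then fst (plan_at M u) else bd M u)"
  by (simp_all add: planned_def)

lemma moved_simps [simp]:
  "md (moved pr M) = next_mode pr M"
  "pt (moved pr M) = pt M"
  "bd (moved pr M) = bd M"
  by (simp_all add: moved_def)

lemma hm_moved: "hm (moved pr M) g = (if md M g = Cross \<and> open_for pr M g then far M g else hm M g)"
  by (simp add: moved_def)

lemma fresh_board_simps [simp]: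
  "rot (fresh_board M u) = rot (bd M u)" "irot (fresh_board M u) = irot (bd M u)"
  by (simp_all add: fresh_board_def)

lemma fresh_unk_subset:
  assumes "consistent M" "u < n" "u \<noteq> bh"
  shows "unk (deg u) (fresh_board M u) \<subseteq> unknown M u"
  using consistentD(12)[OF assms] unk_drop_subset by (auto simp: fresh_board_def board_ok_def)

lemma fresh_unk_dropped:
  "p \<in> unknown M u \<Longrightarrow> p \<notin> unk (deg u) (fresh_board M u) \<Longrightarrow> p \<in> occ M u \<or> p \<in> crossed M u"
  using unk_drop_supset[of "deg u" "bd M u" "occ M u \<union> crossed M u"] by (auto simp: fresh_board_def)

lemma plan_unk_subset:
  "unk (deg u) (fst (plan_at M u)) \<subseteq> unk (deg u) (fresh_board M u)"
proof -
  have "low (fresh_board M u) \<le> high (fresh_board M u)" by (simp add: fresh_board_def drop_bounds)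
  then show ?thesis
    using unk_drop_subset[of "(fresh_board M u)\<lparr>rot := Suc p mod deg u\<rparr>" "deg u" for p]
    by (auto simp: plan_at_eq split: option.splits)
qed

lemma plan_unk_dropped:
  assumes "p \<in> unknown M u" "p \<notin> unk (deg u) (fst (plan_at M u))"
  shows "p \<in> occ M u \<or> p \<in> crossed M u \<or> patient_choice M u = Some p"
proof (cases "p \<in> unk (deg u) (fresh_board M u)")
  case True
  show ?thesis
  proof (cases "patient_choice M u")
    case None
    then show ?thesis using assms(2) True by (auto simp: plan_at_eq split: option.splits)
  next
    case (Some q)
    then show ?thesis
      using assms(2) True unk_drop_supset[of "deg u" "(fresh_board M u)\<lparr>rot := Suc q mod deg u\<rparr>" "insert q (occ M u \<union> crossed M u)"]
      by (auto simp: plan_at_eq)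
  qed
next
  case False
  then show ?thesis using assms(1) fresh_unk_dropped by blast
qed

lemma plan_board_ok:
  assumes "consistent M" "u < n" "u \<noteq> bh"
  shows "board_ok (deg u) (fst (plan_at M u))"
proof -
  have "board_ok (deg u) (bd M u)" using consistentD(12)[OF assms] .
  then have "rot (bd M u) < deg u" "irot (bd M u) < deg u" by (auto simp: board_ok_def)
  moreover from this have "Suc q mod deg u < deg u" for q by (intro mod_less_divisor) simp
  ultimately show ?thesis
    by (auto simp: plan_at_eq board_ok_def fresh_board_def drop_bounds split: option.splits)
qed

lemma planned_board_ok: "consistent M \<Longrightarrow> u < n \<Longrightarrow> u \<noteq> bh \<Longrightarrow> board_ok (deg u) (bd (planned M) u)"
  using plan_board_ok consistentD(12) by auto

lemma planned_unk_subset: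
  assumes "consistent M" "u < n" "u \<noteq> bh"
  shows "unknown (planned M) u \<subseteq> unknown M u"
  using fresh_unk_subset[OF assms] plan_unk_subset by auto

lemma holds_occ: "g < G \<Longrightarrow> holds g (md M g) \<Longrightarrow> pt M g \<in> occ M (hm M g)"
  by (auto simp: occ_def)

lemma foreign_occ: "g < G \<Longrightarrow> md M g = Verify \<or> md M g = Recall \<Longrightarrow> bck (hm M g) (pt M g) \<in> occ M (far M g)"
  by (auto simp: occ_def far_def)

text \<open>A known port into the black hole would be occupied and not be chosen. A free port that
  has only just ceased to be unknown is the one that the impatient trio was crossing, which is
  safe.\<close>

lemma choice_safe:
  assumes M: "consistent M" and u: "u < n" "u \<noteq> bh"
    and c: "patient_choice M u = Some p \<or> imp_choice M u = Some p"
    and p: "p \<notin> unk (deg u) (fresh_board M u)"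
  shows "nbr u p \<noteq> bh"
proof
  assume b: "nbr u p = bh"
  note ch = choiceD[OF c]
  show False
  proof (cases "p \<in> unknown M u")
    case True
    then have "p \<in> crossed M u" using p fresh_unk_dropped ch(3) by blast
    then show False using consistentD(4)[OF M, of 0] G b by (auto simp: crossed_def far_def)
  next
    case False
    then show False using consistentD(7)[OF M u(1) ch(2) u(2) _ b] holds_occ ch(3) by blast
  qed
qed

lemma port_mode_cases: "port_mode d w p = Probe \<and> p \<in> unk d w \<or> port_mode d w p = Cross \<and> p \<notin> unk d w"
  by (auto simp: port_mode_def)

text \<open>A chosen port that is unknown is one of the two candidates, for which dropping is
  effective.\<close>

lemma patient_choice_dropped:
  assumes "patient_choice M u = Some p"
  shows "p \<notin> unk (deg u) (fst (plan_at M u))"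
proof (cases "p \<in> unk (deg u) (fresh_board M u)")
  case True
  then have "p = low (fresh_board M u) \<or> p = high (fresh_board M u)"
    using choiceD(1)[of M u p] assms by (auto simp: avail_def)
  moreover have "low (fresh_board M u) \<le> high (fresh_board M u)" by (simp add: fresh_board_def drop_bounds)
  ultimately show ?thesis
    using unk_drop_candidate[of "(fresh_board M u)\<lparr>rot := Suc p mod deg u\<rparr>" p] assms
    by (auto simp: plan_at_eq)
next
  case False
  then show ?thesis using plan_unk_subset by blast
qed

lemma idle_patient: "patient_choice M u \<noteq> None \<Longrightarrow> Min (idle M u) \<in> idle M u"
  by (rule Min_in) (auto simp: patient_choice_def idle_def split: if_splits)

text \<open>A trio that occupies its port keeps it (\<open>upd\<close>); any other trio with a port
  has received one outside \<open>occ\<close> (\<open>new\<close>). Two new ports at one node cannot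
  collide, since a node serves at most one trio per step.\<close>

lemma mid_planned:
  assumes M: "consistent M"
  shows "mid (planned M)"
proof -
  let ?P = "planned M"
  have home: "hm M g < n" "hm M g \<noteq> bh" if "g < G" for g using consistentD(1,2)[OF M that] .
  have live: "lively M (hm M g)" if "g < G" "md M g \<noteq> Found" for g
    using lively_home M that by blast
  have old: "md ?P g \<noteq> Idle \<Longrightarrow> (md ?P g = md M g \<and> pt ?P g = pt M g \<and> holds g (md M g)) \<or>
     (\<exists>q. pt ?P g = q \<and> (g = 0 \<and> imp_choice M (hm M g) = Some q \<or> g \<noteq> 0 \<and> g = Min (idle M (hm M g)) \<and> patient_choice M (hm M g) = Some q)
       \<and> md ?P g = port_mode (deg (hm M g)) (fresh_board M (hm M g)) q \<and> md M g \<noteq> Found)" if "g < G" for g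
    by (rule assign_cases[OF that, of M]; cases "md M g"; cases "g = 0"; simp add: holds_def)
  have upd: "holds g (md M g) \<Longrightarrow> md ?P g = md M g \<and> pt ?P g = pt M g" if "g < G" for g
    by (rule assign_cases[OF that, of M]) (auto simp: holds_def)
  have new: "md ?P g \<noteq> Idle \<Longrightarrow> \<not> holds g (md M g) \<Longrightarrow>
      pt ?P g < deg (hm M g) \<and> pt ?P g \<notin> occ M (hm M g) \<and> lively M (hm M g)
       \<and> (g = 0 \<and> imp_choice M (hm M g) = Some (pt ?P g) \<or> g \<noteq> 0 \<and> g = Min (idle M (hm M g)) \<and> patient_choice M (hm M g) = Some (pt ?P g))
       \<and> (md ?P g = Probe \<and> pt ?P g \<in> unk (deg (hm M g)) (fresh_board M (hm M g))
         \<or> md ?P g = Cross \<and> pt ?P g \<notin> unk (deg (hm M g)) (fresh_board M (hm M g)))" if "g < G" for g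
    using old[OF that] live[OF that] choiceD(2,3)[of M "hm M g" "pt ?P g"] port_mode_cases by fastforce
  have excl: "imp_choice M u = Some p \<Longrightarrow> patient_choice M u = None" for u p
    by (auto simp: imp_choice_def split: if_splits)
  show ?thesis unfolding mid_def
  proof (intro conjI allI impI)
    fix g assume g: "g < G"
    show "hm ?P g < n" "hm ?P g \<noteq> bh" using home[OF g] by auto
    show "pt ?P g < deg (hm ?P g)" if "md ?P g \<noteq> Idle"
      using new[OF g] upd[OF g] that consistentD(3)[OF M g] by (cases "holds g (md M g)") auto
    show "far ?P g \<noteq> bh" if "md ?P g \<in> {Recall, Cross}"
    proof (cases "holds g (md M g)")
      case True
      then show ?thesis using upd[OF g] that consistentD(4)[OF M g] by (auto simp: far_def)
    next
      case False
      then show ?thesis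
        using new[OF g] that choice_safe[OF M home[OF g], of "pt ?P g"] by (auto simp: far_def)
    qed
    show "far ?P g = bh" if "md ?P g = Found"
    proof (cases "holds g (md M g)")
      case True
      then show ?thesis using upd[OF g] that consistentD(5)[OF M g] by (auto simp: far_def)
    qed (use new[OF g] that in auto)
    show "pt ?P g \<notin> unknown ?P (hm ?P g)" if "md ?P g \<noteq> Idle" "g \<noteq> 0 \<or> md ?P g \<noteq> Probe"
    proof (cases "holds g (md M g)")
      case True
      have e: "md ?P g = md M g" "pt ?P g = pt M g" using upd[OF g True] by auto
      have sub: "unknown ?P (hm M g) \<subseteq> unknown M (hm M g)" using planned_unk_subset[OF M home[OF g]] .
      show ?thesis
      proof (cases "pt M g \<in> unknown M (hm M g)")
        case in_unk: True
        \<comment> \<open>Only the impatient trio can occupy a port that is still unknown, namely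
          when its scout has just left. The port is a candidate and is dropped now.\<close>
        have "g = 0" "md M g = Verify"
          using in_unk consistentD(8)[OF M g] consistentD(9)[OF M] True by (auto simp: holds_def)
        then have "pt M g = low (bd M (hm M g)) \<or> pt M g = high (bd M (hm M g))"
          using consistentD(10)[OF M] in_unk by auto
        then have "pt M g \<notin> unk (deg (hm M g)) (fresh_board M (hm M g))"
          unfolding fresh_board_def using consistentD(12)[OF M home[OF g]] holds_occ[OF g True]
          by (intro unk_drop_candidate) (auto simp: board_ok_def)
        then show ?thesis
          using plan_unk_subset[of "hm M g" M] live[OF g] \<open>md M g = Verify\<close> e by auto
      qed (use sub e in auto)
    next
      case False
      note nw = new[OF g that(1) False]
      show ?thesis
      proof (cases "patient_choice M (hm M g) = Some (pt ?P g)")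
        case True
        then show ?thesis using patient_choice_dropped[OF True] nw by auto
      next
        case False
        then show ?thesis using nw that(2) plan_unk_subset[of "hm M g" M] by auto
      qed
    qed
    fix h assume h: "h < G"
    show "g = h" if "md ?P g \<noteq> Idle" "md ?P h \<noteq> Idle" "hm ?P g = hm ?P h" "pt ?P g = pt ?P h"
    proof (cases "holds g (md M g)")
      case gh: True
      show ?thesis
      proof (cases "holds h (md M h)")
        case True
        then show ?thesis using upd[OF g gh] upd[OF h True] consistentD(6)[OF M g h gh True] that by auto
      next
        case False
        then show ?thesis using upd[OF g gh] new[OF h that(2) False] that holds_occ[OF g gh] by auto
      qed
    next
      case gh: False
      show ?thesis
      proof (cases "holds h (md M h)")
        case True
        then show ?thesis using upd[OF h True] new[OF g that(1) gh] that holds_occ[OF h True] by auto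
      next
        case False
        then show ?thesis using new[OF g that(1) gh] new[OF h that(2) False] that excl by force
      qed
    qed
    show "\<not> (hm ?P h = far ?P g \<and> pt ?P h = bck (hm ?P g) (pt ?P g))"
      if "md ?P g \<in> {Verify, Recall}" "far ?P g \<noteq> bh" "md ?P h \<noteq> Idle"
    proof
      assume eq: "hm ?P h = far ?P g \<and> pt ?P h = bck (hm ?P g) (pt ?P g)"
      have "holds g (md M g)" using new[OF g] that(1) by (cases "holds g (md M g)") auto
      then have ge: "md M g = Verify \<or> md M g = Recall" "pt ?P g = pt M g"
        using upd[OF g] that(1) by auto
      then have f: "far ?P g = far M g" by (simp add: far_def)
      show False
      proof (cases "holds h (md M h)")
        case True
        then show False
          using upd[OF h True] eq f ge consistentD(11)[OF M g h ge(1) _ True] that(2) by auto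
      next
        case False
        then show False using new[OF h that(3) False] eq f ge foreign_occ[OF g ge(1)] by auto
      qed
    qed
  next
    fix u p assume u: "u < n" "p < deg u" "u \<noteq> bh" "p \<notin> unknown ?P u" "nbr u p = bh"
    show "\<exists>g<G. md ?P g \<noteq> Idle \<and> hm ?P g = u \<and> pt ?P g = p"
    proof (cases "p \<in> unknown M u")
      case False
      then obtain g where "g < G" "holds g (md M g)" "hm M g = u" "pt M g = p"
        using consistentD(7)[OF M u(1,2,3) _ u(5)] by blast
      then show ?thesis using upd[of g] by (intro exI[of _ g]) (auto simp: holds_def)
    next
      case True
      then have "lively M u" using u(4) by (auto split: if_splits)
      then have "p \<in> occ M u \<or> p \<in> crossed M u \<or> patient_choice M u = Some p"
        using plan_unk_dropped True u(4) by auto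
      \<comment> \<open>The possible reasons for dropping the port: occupied by a trio at home, far
        end of a probed edge, crossed by the impatient trio, newly assigned. The second leads back
        to a safe home and the third is known to be safe, so the port has an owner.\<close>
      then consider g where "g < G" "holds g (md M g)" "hm M g = u" "pt M g = p"
        | g where "g < G" "md M g = Verify \<or> md M g = Recall" "far M g = u" "bck (hm M g) (pt M g) = p"
        | "md M 0 = Cross" "far M 0 = bh"
        | "patient_choice M u = Some p"
        using u(5) by (auto simp: occ_def crossed_def far_def)
      then show ?thesis
      proof cases
        case 1
        then show ?thesis using upd[of g] by (intro exI[of _ g]) (auto simp: holds_def)
      next
        case 2
        then have "nbr u p = hm M g"
          using nbrD(4)[OF home(1)[OF 2(1)] consistentD(3)[OF M 2(1)]] by (auto simp: far_def)
        then show ?thesis using home(2)[OF 2(1)] u(5) by simp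
      next
        case 3
        then show ?thesis using consistentD(4)[OF M, of 0] G by auto
      next
        case 4
        let ?g = "Min (idle M u)"
        have g: "?g \<in> idle M u" using idle_patient 4 by simp
        then have "assign M ?g = (port_mode (deg u) (fresh_board M u) p, p)"
          using 4 by (auto simp: assign_eq idle_def Let_def)
        then show ?thesis using g port_mode_cases[of "deg u" "fresh_board M u" p]
          by (intro exI[of _ ?g]) (auto simp: idle_def)
      qed
    qed
  next
    fix u assume "u < n" "u \<noteq> bh"
    then show "board_ok (deg u) (bd ?P u)" using planned_board_ok[OF M] by blast
  next
    assume z: "md ?P 0 = Probe"
    have "\<not> holds 0 (md M 0)" using upd[of 0] G z by (auto simp: holds_def)
    then have nw: "imp_choice M (hm M 0) = Some (pt ?P 0)" "lively M (hm M 0)"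
       "pt ?P 0 \<in> unk (deg (hm M 0)) (fresh_board M (hm M 0))"
      using new[of 0] G z by auto
    then have "patient_choice M (hm M 0) = None" using excl by auto
    then have b: "bd ?P (hm M 0) = (fresh_board M (hm M 0))\<lparr>irot := Suc (pt ?P 0) mod deg (hm M 0)\<rparr>"
      using nw by (auto simp: plan_at_eq)
    show "pt ?P 0 \<in> unknown ?P (hm ?P 0)" using nw(3) b by (simp del: planned_simps(3) planned_simps(4))
    show "pt ?P 0 \<in> {low (bd ?P (hm ?P 0)), high (bd ?P (hm ?P 0))}"
      using choiceD(1)[of M "hm M 0" "pt ?P 0"] nw b by (auto simp: avail_def)
  qed
qed

text \<open>The delicate clause is that nobody occupies the other end of an edge whose scout has
  just left. A trio there cannot probe, as the scouts would have been exchanged; if it was crossing,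
  it has left through the same present edge; \<open>Verify\<close> and \<open>Recall\<close> were
  excluded before the move; and \<open>Found\<close> would make a safe home the black hole.\<close>

lemma consistent_moved:
  assumes M: "mid M"
  shows "consistent (moved pr M)"
proof -
  let ?N = "moved pr M"
  have home: "hm M g < n" "hm M g \<noteq> bh" if "g < G" for g using midD(1,2)[OF M that] .
  have st: "md ?N g \<noteq> Idle \<Longrightarrow> md M g \<noteq> Idle \<and> hm ?N g = hm M g \<and> far ?N g = far M g" for g
    by (cases "md M g") (auto simp: next_mode_def hm_moved far_def split: if_splits)
  show ?thesis unfolding consistent_def
  proof (intro conjI allI impI)
    fix g assume g: "g < G"
    show "hm ?N g < n"
      using home[OF g] midD(3)[OF M g] nbrD(1) by (auto simp: hm_moved far_def)
    show "hm ?N g \<noteq> bh"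
      using home[OF g] midD(4)[OF M g] by (auto simp: hm_moved)
    show "pt ?N g < deg (hm ?N g)" if "md ?N g \<noteq> Idle"
      using st[OF that] midD(3)[OF M g] by auto
    show "far ?N g \<noteq> bh" if "md ?N g \<in> {Recall, Cross}"
      using st[of g] that midD(4)[OF M g]
      by (cases "md M g") (auto simp: next_mode_def split: if_splits)
    show "far ?N g = bh" if "md ?N g = Found"
      using st[of g] that midD(5)[OF M g]
      by (cases "md M g") (auto simp: next_mode_def split: if_splits)
    show "pt ?N g \<notin> unknown ?N (hm ?N g)" if "g \<noteq> 0" "md ?N g \<noteq> Idle"
      using st[OF that(2)] midD(8)[OF M g] that by auto
    fix h assume h: "h < G"
    show "g = h" if "holds g (md ?N g)" "holds h (md ?N h)" "hm ?N g = hm ?N h" "pt ?N g = pt ?N h"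
      using that st[of g] st[of h] midD(6)[OF M g h] by (auto simp: holds_def)
    show "\<not> (hm ?N h = far ?N g \<and> pt ?N h = bck (hm ?N g) (pt ?N g))"
      if gm: "md ?N g \<in> {Verify, Recall}" and b: "far ?N g \<noteq> bh" and hh: "holds h (md ?N h)"
    proof
      assume eq: "hm ?N h = far ?N g \<and> pt ?N h = bck (hm ?N g) (pt ?N g)"
      have sg: "md M g \<noteq> Idle" "hm ?N g = hm M g" "far ?N g = far M g" using st[of g] gm by auto
      have sh: "md M h \<noteq> Idle" "hm ?N h = hm M h" "far ?N h = far M h" using st[of h] hh by (auto simp: holds_def)
      have e: "hm M h = far M g" "pt M h = bck (hm M g) (pt M g)" using eq sg sh by auto
      have e': "far M h = hm M g" "pt M g = bck (hm M h) (pt M h)"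
        using e nbrD(4,5)[OF home(1)[OF g] midD(3)[OF M g sg(1)]] by (auto simp: far_def)
      show False
      proof (cases "md M g = Verify \<or> md M g = Recall")
        case True
        then show False using midD(11)[OF M g h True _ sh(1) e] b sg by auto
      next
        case False
        then have gp: "md M g = Probe" "open_for pr M g" "exchange M g = {}"
          using gm b sg by (auto simp: next_mode_def split: if_splits mode.splits)
        have op: "open_for pr M h"
          using gp(2) e e' by (auto simp: open_for_def insert_commute)
        have "md M h \<noteq> Probe" using gp(3) e h by (auto simp: exchange_def)
        moreover have "md M h \<noteq> Cross" using hh op by (auto simp: next_mode_def holds_def)
        moreover have "md M h \<noteq> Found" using midD(5)[OF M h] e' home(2)[OF g] by auto
        ultimately have hv: "md M h = Verify \<or> md M h = Recall" using sh(1) by (cases "md M h") auto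
        show False
          using midD(11)[OF M h g hv _ sg(1)] e' home(2)[OF g] by (metis)
      qed
    qed
  next
    fix u p assume u: "u < n" "p < deg u" "u \<noteq> bh" "p \<notin> unknown ?N u" "nbr u p = bh"
    then obtain g where g: "g < G" "md M g \<noteq> Idle" "hm M g = u" "pt M g = p"
      using midD(7)[OF M u(1,2,3) _ u(5)] by auto
    have f: "far M g = bh" using g u by (simp add: far_def)
    have "g \<noteq> 0 \<or> md M g \<noteq> Probe" using midD(9)[OF M] g u(4) by auto
    then have "md M g \<noteq> Cross" "holds g (md ?N g)"
      using midD(4)[OF M g(1)] f g(2)
      by (cases "md M g"; auto simp: holds_def next_mode_def split: if_splits)+
    then show "\<exists>g<G. holds g (md ?N g) \<and> hm ?N g = u \<and> pt ?N g = p"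
      using g by (intro exI[of _ g]) (auto simp: hm_moved)
  next
    assume "md ?N 0 \<in> {Recall, Found}"
    then have "md M 0 \<in> {Verify, Recall, Found}" "hm ?N 0 = hm M 0"
      by (cases "md M 0"; auto simp: next_mode_def hm_moved split: if_splits)+
    then show "pt ?N 0 \<notin> unknown ?N (hm ?N 0)" using midD(8)[OF M, of 0] G by auto
  next
    assume a: "md ?N 0 \<in> {Verify, Cross}" "pt ?N 0 \<in> unknown ?N (hm ?N 0)"
    have "md M 0 \<noteq> Idle" "hm ?N 0 = hm M 0" using st[of 0] a(1) by auto
    then have "md M 0 = Probe" using midD(8)[OF M, of 0] G a(2) by auto
    then show "pt ?N 0 \<in> {low (bd ?N (hm ?N 0)), high (bd ?N (hm ?N 0))}"
      using midD(10)[OF M] \<open>hm ?N 0 = hm M 0\<close> by auto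
  next
    fix u assume "u < n" "u \<noteq> bh"
    then show "board_ok (deg u) (bd ?N u)" using midD(12)[OF M] by simp
  qed
qed

lemma consistent_step: "consistent M \<Longrightarrow> consistent (step pr M)"
  by (simp add: step_def consistent_moved mid_planned)

end

section \<open>Rotors, periodic histories and connectivity\<close>

text \<open>Between equal rotor positions the total advance is a multiple of \<open>d\<close>, and
  it is positive because of \<open>k0\<close>. So it is at least \<open>d\<close>, and the swept
  intervals, which adjoin each other, cover all residues.\<close>

lemma rotor_cover:
  fixes r j :: "nat \<Rightarrow> nat"
  assumes st: "\<And>k. a \<le> k \<Longrightarrow> k < b \<Longrightarrow> r (Suc k) = (if A k then Suc (r k + j k) mod d else r k)"
    and eq: "r b = r a" and ex: "a \<le> k0" "k0 < b" "A k0" and rd: "r a < d" and z: "z < d"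
  shows "\<exists>k\<ge>a. k < b \<and> A k \<and> (\<exists>i\<le>j k. (r k + i) mod d = z)"
proof -
  \<comment> \<open>The total advance before time \<open>k\<close>: an active step inspects the
    positions at distance 0 to \<open>j\<close> and stops just behind the last of them.\<close>
  define c where "c k = (\<Sum>i=a..<k. if A i then Suc (j i) else 0)" for k
  have cS: "c (Suc k) = c k + (if A k then Suc (j k) else 0)" if "a \<le> k" for k
    using that by (simp add: c_def)
  have r: "k \<le> b \<Longrightarrow> r k = (r a + c k) mod d" if "a \<le> k" for k
    using that
  proof (induction k rule: dec_induct)
    case base
    then show ?case using rd by (simp add: c_def)
  next
    case (step k)
    then have "r k = (r a + c k) mod d" by simp
    moreover have "Suc ((r a + c k) mod d + j k) mod d = (r a + (c k + Suc (j k))) mod d"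
      by (metis add_Suc_right add.assoc mod_Suc_eq mod_add_left_eq)
    ultimately show ?case
      using step cS[of k] st[of k] by auto
  qed
  have "Suc (j k0) \<le> c b"
    unfolding c_def using ex member_le_sum[of k0 "{a..<b}" "\<lambda>i. if A i then Suc (j i) else 0"] by simp
  moreover have "(r a + c b) mod d = r a mod d" using r[of b] eq ex rd by simp
  then have "d dvd c b" by (metis add.commute mod_add_cong mod_eq_0_iff_dvd add_diff_cancel_right' diff_zero mod_eq_dvd_iff_nat le_add1 add_diff_cancel_left')
  ultimately have cb: "d \<le> c b" by (intro dvd_imp_le) auto
  \<comment> \<open>The distance from the initial position to \<open>z\<close>; adding
    \<open>d\<close> avoids truncated subtraction.\<close>
  define y where "y = (z + d - r a) mod d"
  have "y < d" using z by (simp add: y_def)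
  then have y: "y < c b" using cb by simp
  have yz: "(r a + y) mod d = z"
  proof -
    have "(r a + y) mod d = (r a + (z + d - r a)) mod d" by (simp add: y_def mod_simps)
    also have "r a + (z + d - r a) = z + d" using rd by simp
    finally show ?thesis using z by simp
  qed
  have "\<exists>k\<ge>a. k < b' \<and> c k \<le> y \<and> y < c (Suc k)" if "a \<le> b'" "y < c b'" for b'
    using that
  proof (induction b' rule: dec_induct)
    case base
    then show ?case by (simp add: c_def)
  next
    case (step k)
    show ?case
    proof (cases "y < c k")
      case True
      then show ?thesis using step by (meson less_Suc_eq)
    next
      case False
      then show ?thesis using step by (intro exI[of _ k]) auto
    qed
  qed
  then obtain k where k: "a \<le> k" "k < b" "c k \<le> y" "y < c (Suc k)" using y ex by (meson le_less_trans less_imp_le)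
  then have A: "A k" "y - c k \<le> j k" using cS[of k] by (auto split: if_splits)
  have "(r k + (y - c k)) mod d = (r a + c k + (y - c k)) mod d"
    using r[of k] k mod_add_left_eq[of "r a + c k" d "y - c k"] by simp
  then have "(r k + (y - c k)) mod d = z" using k yz by simp
  then show ?thesis using k A by blast
qed

text \<open>The condition on the end points closes the interval to a circle: a property that
  persists forwards reaches \<open>b\<close>, re-enters at \<open>a\<close> and so holds
  throughout.\<close>

lemma cyclic_invariant:
  fixes P :: "nat \<Rightarrow> bool"
  assumes st: "\<And>k. a \<le> k \<Longrightarrow> k < b \<Longrightarrow> P k \<Longrightarrow> P (Suc k)" and eq: "P b \<Longrightarrow> P a"
    and k: "a \<le> k" "k \<le> b" "P k" and i: "a \<le> i" "i \<le> b"
  shows "P i"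
proof -
  have up: "j \<le> b \<Longrightarrow> P j" if "i \<le> j" "P i" "a \<le> i" for i j
    using that by (induction j rule: dec_induct) (auto intro: st)
  show ?thesis using up[of k b] up[of a i] k i eq by auto
qed

lemma crossing_edge:
  assumes con: "connected_on n E" and J: "u \<in> J" "u < n" and b: "v < n" "v \<notin> J"
  shows "\<exists>x y. x < n \<and> y < n \<and> x \<in> J \<and> y \<notin> J \<and> {x, y} \<in> E"
proof -
  have "(u, v) \<in> {(x, y). x < n \<and> y < n \<and> {x, y} \<in> E}\<^sup>*"
    using assms by (auto simp: connected_on_def)
  then show ?thesis using b(2)
    by (induction rule: rtrancl_induct) (use J in auto)
qed

context trios begin

section \<open>A monotone progress measure\<close>

text \<open>The stage of exploration of a port, from 0 (new) to 4 (finished). A probe of the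
  impatient trio counts as 0 because it may be abandoned. After an exchange its port may remain at 0
  until the next planning drops it.\<close>

definition lev :: "state \<Rightarrow> nat \<Rightarrow> nat \<Rightarrow> nat" where
  "lev M u p =
     (if \<exists>g<G. hm M g = u \<and> pt M g = p \<and> md M g = Recall then 3
      else if \<exists>g<G. hm M g = u \<and> pt M g = p \<and> md M g \<in> {Verify, Found} then 2
      else if \<exists>g<G. hm M g = u \<and> pt M g = p \<and> md M g = Probe \<and> g \<noteq> 0 then 1
      else if p \<in> unknown M u then 0 else 4)"

lemma lev_cases:
  obtains (recall) g where "lev M u p = 3" "g < G" "hm M g = u" "pt M g = p" "md M g = Recall"
  | (verify) g where "lev M u p = 2" "g < G" "hm M g = u" "pt M g = p" "md M g \<in> {Verify, Found}"
  | (probe) g where "lev M u p = 1" "g < G" "hm M g = u" "pt M g = p" "md M g = Probe" "g \<noteq> 0"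
  | (new) "lev M u p = 0" "p \<in> unknown M u"
      "\<And>g. g < G \<Longrightarrow> hm M g = u \<Longrightarrow> pt M g = p \<Longrightarrow> md M g \<notin> {Verify, Recall, Found} \<and> (md M g = Probe \<longrightarrow> g = 0)"
  | (known) "lev M u p = 4" "p \<notin> unknown M u"
      "\<And>g. g < G \<Longrightarrow> hm M g = u \<Longrightarrow> pt M g = p \<Longrightarrow> md M g \<notin> {Verify, Recall, Found} \<and> (md M g = Probe \<longrightarrow> g = 0)"
proof -
  let ?R = "\<exists>g<G. hm M g = u \<and> pt M g = p \<and> md M g = Recall"
  let ?V = "\<exists>g<G. hm M g = u \<and> pt M g = p \<and> md M g \<in> {Verify, Found}"
  let ?P = "\<exists>g<G. hm M g = u \<and> pt M g = p \<and> md M g = Probe \<and> g \<noteq> 0"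
  have l: "lev M u p = (if ?R then 3 else if ?V then 2 else if ?P then 1 else if p \<in> unknown M u then 0 else 4)"
    by (simp only: lev_def)
  show ?thesis
  proof (cases ?R)
    case True
    then obtain g where "g < G" "hm M g = u" "pt M g = p" "md M g = Recall" by blast
    moreover have "lev M u p = 3" unfolding l if_P[OF True] ..
    ultimately show ?thesis by (rule recall[rotated 1])
  next
    case R: False
    show ?thesis
    proof (cases ?V)
      case True
      then obtain g where "g < G" "hm M g = u" "pt M g = p" "md M g \<in> {Verify, Found}" by blast
      moreover have "lev M u p = 2" unfolding l if_not_P[OF R] if_P[OF True] ..
      ultimately show ?thesis by (rule verify[rotated 1])
    next
      case V: False
      show ?thesis
      proof (cases ?P)
        case True
        then obtain g where "g < G" "hm M g = u" "pt M g = p" "md M g = Probe" "g \<noteq> 0" by blast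
        moreover have "lev M u p = 1" unfolding l if_not_P[OF R] if_not_P[OF V] if_P[OF True] ..
        ultimately show ?thesis by (rule probe[rotated 1])
      next
        case P: False
        have "lev M u p = (if p \<in> unknown M u then 0 else 4)"
          unfolding l if_not_P[OF R] if_not_P[OF V] if_not_P[OF P] ..
        moreover have "md M g \<notin> {Verify, Recall, Found} \<and> (md M g = Probe \<longrightarrow> g = 0)"
          if "g < G" "hm M g = u" "pt M g = p" for g using R V P that by blast
        ultimately show ?thesis using new known by (cases "p \<in> unknown M u") auto
      qed
    qed
  qed
qed

lemma lev_4I:
  assumes "p \<notin> unknown M u" "\<And>g. g < G \<Longrightarrow> hm M g = u \<Longrightarrow> pt M g = p \<Longrightarrow> md M g \<in> {Idle, Cross}"
  shows "lev M u p = 4"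
  by (cases rule: lev_cases[of M u p]) (use assms in force)+

lemma lev_3I: "g < G \<Longrightarrow> hm M g = u \<Longrightarrow> pt M g = p \<Longrightarrow> md M g = Recall \<Longrightarrow> lev M u p = 3"
  unfolding lev_def by (rule if_P) blast

lemma lev_2I:
  assumes "g < G" "hm M g = u" "pt M g = p" "md M g \<in> {Verify, Recall, Found}"
  shows "2 \<le> lev M u p"
proof (cases "\<exists>g<G. hm M g = u \<and> pt M g = p \<and> md M g = Recall")
  case True
  then show ?thesis using lev_3I[of _ M u p] by force
next
  case False
  then have "\<exists>g<G. hm M g = u \<and> pt M g = p \<and> md M g \<in> {Verify, Found}" using assms by blast
  then show ?thesis unfolding lev_def if_not_P[OF False] by simp
qed

lemma lev_le: "lev M u p \<le> 4"
  by (simp add: lev_def)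

lemma lev_0: "p \<in> unknown M u \<Longrightarrow> p \<notin> occ M u \<Longrightarrow> lev M u p = 0"
  by (auto simp: lev_def occ_def holds_def)

lemma lev_0D:
  assumes "lev M u p = 0"
  shows "p \<in> unknown M u" "\<And>g. g < G \<Longrightarrow> hm M g = u \<Longrightarrow> pt M g = p \<Longrightarrow> md M g \<notin> {Recall, Verify, Found}"
    "\<And>g. g < G \<Longrightarrow> hm M g = u \<Longrightarrow> pt M g = p \<Longrightarrow> g \<noteq> 0 \<Longrightarrow> md M g \<noteq> Probe"
  by (cases rule: lev_cases[of M u p]; use assms in \<open>simp; fail\<close>)
    (cases rule: lev_cases[of M u p]; use assms in \<open>auto; fail\<close>)+

lemma port_mode_Probe: "port_mode d w p = Probe \<longleftrightarrow> p \<in> unk d w"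
  by (simp add: port_mode_def)

lemma planned_advanced:
  assumes "g < G" "md (planned M) g \<in> {Verify, Recall, Found}"
  shows "md M g = md (planned M) g" "pt (planned M) g = pt M g"
  by (rule assign_cases[OF assms(1), of M]; use assms(2) in \<open>force simp: port_mode_def split: if_splits\<close>)+

lemma planned_holds:
  assumes "g < G" "holds g (md M g)"
  shows "md (planned M) g = md M g" "pt (planned M) g = pt M g"
  by (rule assign_cases[OF assms(1), of M]; use assms(2) in \<open>force simp: holds_def\<close>)+

lemma planned_probe:
  assumes M: "consistent M" and g: "g < G" "md (planned M) g = Probe" "\<not> (g \<noteq> 0 \<and> md M g = Probe)"
  shows "pt (planned M) g \<in> unk (deg (hm M g)) (fresh_board M (hm M g))"
    "pt (planned M) g \<in> unknown M (hm M g)" "pt (planned M) g \<notin> occ M (hm M g)"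
    "(if g = 0 then imp_choice M (hm M g) else patient_choice M (hm M g)) = Some (pt (planned M) g)"
proof -
  obtain q where q: "pt (planned M) g = q" "q \<in> unk (deg (hm M g)) (fresh_board M (hm M g))"
    "(if g = 0 then imp_choice M (hm M g) else patient_choice M (hm M g)) = Some q"
    by (rule assign_cases[OF g(1), of M])
      (use g in \<open>auto simp: port_mode_Probe\<close>)
  then show "pt (planned M) g \<in> unk (deg (hm M g)) (fresh_board M (hm M g))"
    "(if g = 0 then imp_choice M (hm M g) else patient_choice M (hm M g)) = Some (pt (planned M) g)"
    by auto
  show "pt (planned M) g \<in> unknown M (hm M g)"
    using q fresh_unk_subset[OF M consistentD(1,2)[OF M g(1)]] by blast
  show "pt (planned M) g \<notin> occ M (hm M g)"
    using q choiceD(3)[of M "hm M g" q] by (auto split: if_splits)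
qed

lemma step_origin:
  assumes "g < G" "md (step pr M) g \<notin> {Idle, Cross}"
  shows "hm (step pr M) g = hm M g" "pt (step pr M) g = pt (planned M) g"
    "md (step pr M) g = Recall \<Longrightarrow> md (planned M) g = Recall \<or> md (planned M) g = Verify"
    "md (step pr M) g = Verify \<Longrightarrow> md (planned M) g = Verify \<or> md (planned M) g = Probe"
    "md (step pr M) g = Found \<Longrightarrow> md (planned M) g = Found \<or> md (planned M) g = Verify"
    "md (step pr M) g = Probe \<Longrightarrow> md (planned M) g = Probe"
  using assms(2)
  by (cases "fst (assign M g)"; auto simp: step_def next_mode_def hm_moved split: if_splits)+

lemma step_bd [simp]: "bd (step pr M) = bd (planned M)"
  by (simp add: step_def)

lemma unknown_step_subset: "consistent M \<Longrightarrow> u < n \<Longrightarrow> u \<noteq> bh \<Longrightarrow> unknown (step pr M) u \<subseteq> unknown M u"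
  using planned_unk_subset by simp

lemma step_lev_origin:
  assumes "g < G" "hm (step pr M) g = u" "pt (step pr M) g = p" "md (step pr M) g \<notin> {Idle, Cross}"
  shows "hm M g = u \<and> pt (planned M) g = p \<and> md (planned M) g \<notin> {Idle, Cross}"
  using step_origin[OF assms(1,4)] assms by (cases "md (step pr M) g") auto

text \<open>At levels 1 to 3 the port belongs to exactly one trio, which stays until its work is
  done; unknown ports do not reappear, so level 1 cannot fall to 0; and level 4 is final because
  probes start only at unknown ports.\<close>

lemma lev_mono:
  assumes M: "consistent M" and u: "u < n" "u \<noteq> bh"
  shows "lev M u p \<le> lev (step pr M) u p"
proof -
  let ?N = "step pr M" and ?P = "planned M"
  have mp: "mid ?P" using M by (rule mid_planned)
  have sub: "unknown ?N u \<subseteq> unknown M u" using unknown_step_subset[OF M u] .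
  have uniq: "g = h" if "g < G" "h < G" "hm M g = u" "hm M h = u" "pt ?P g = p" "pt ?P h = p"
     "md ?P g \<noteq> Idle" "md ?P h \<noteq> Idle" for g h
    using midD(6)[OF mp that(1,2,7,8)] that by simp
  have notunk: "p \<notin> unknown ?N u" if "g < G" "hm M g = u" "pt ?P g = p" "md ?P g \<noteq> Idle" "g \<noteq> 0 \<or> md ?P g \<noteq> Probe" for g
    using midD(8)[OF mp that(1,4,5)] that by simp
  show ?thesis
  proof (cases rule: lev_cases[of M u p])
    case r: (recall g)
    note g = r(2-)
    have pg: "md ?P g = Recall" "pt ?P g = p" using planned_holds[of g M] g by (auto simp: holds_def)
    show ?thesis
    proof (cases "md ?N g = Recall")
      case True
      then have "lev ?N u p = 3"
        using step_origin(1,2)[of g pr M] g pg True by (intro lev_3I[of g]) simp_all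
      then show ?thesis using r by simp
    next
      case False
      then have "md ?N g = Cross" using pg(1) by (simp add: step_def next_mode_def split: if_splits)
      have "lev ?N u p = 4"
      proof (intro lev_4I)
        show "p \<notin> unknown ?N u" using notunk[of g] g pg by simp
        show "md ?N h \<in> {Idle, Cross}" if "h < G" "hm ?N h = u" "pt ?N h = p" for h
        proof (rule ccontr)
          assume m: "md ?N h \<notin> {Idle, Cross}"
          then have "h = g" using step_lev_origin[OF that m] uniq[OF that(1) g(1)] g pg by auto
          then show False using m \<open>md ?N g = Cross\<close> by simp
        qed
      qed
      then show ?thesis using r by simp
    qed
  next
    case v: (verify g)
    note g = v(2-)
    have pg: "md ?P g = md M g" "pt ?P g = p" using planned_holds[of g M] g by (auto simp: holds_def)
    have "md ?N g \<in> {Verify, Recall, Found}"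
      using pg(1) g(4) by (auto simp: step_def next_mode_def)
    then have "lev ?N u p \<ge> 2"
      using step_origin(1,2)[of g pr M] g pg by (intro lev_2I[of g]) force+
    then show ?thesis using v by simp
  next
    case p: (probe g)
    note g = p(2-)
    have "p \<notin> unknown ?N u" using consistentD(8)[OF M g(1,5)] g sub by auto
    then have "lev ?N u p \<noteq> 0" using lev_0D(1) by blast
    then show ?thesis using p by simp
  next
    case new
    then show ?thesis by simp
  next
    case d: known
    \<comment> \<open>A trio exploring at a known port must have been there before planning, since a
      new probe requires an unknown port.\<close>
    have no: "\<not> (g < G \<and> hm M g = u \<and> pt ?P g = p \<and> md ?P g \<notin> {Idle, Cross})" for g
    proof
      assume g: "g < G \<and> hm M g = u \<and> pt ?P g = p \<and> md ?P g \<notin> {Idle, Cross}"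
      have "md M g \<in> {Verify, Recall, Found} \<and> pt M g = p \<or> md M g = Probe \<and> g \<noteq> 0 \<and> pt M g = p"
      proof (cases "md ?P g = Probe")
        case True
        show ?thesis
        proof (cases "g \<noteq> 0 \<and> md M g = Probe")
          case True
          then have "pt ?P g = pt M g" using planned_holds(2)[of g M] g by (simp add: holds_def)
          then show ?thesis using True g by simp
        next
          case False
          then show ?thesis using planned_probe(2)[OF M, of g] g d(2) True by simp
        qed
      next
        case False
        then have "md ?P g \<in> {Verify, Recall, Found}" using g by (cases "md ?P g") auto
        then show ?thesis using planned_advanced[of g M] g by metis
      qed
      then show False using d(3)[of g] g by blast
    qed
    have "lev ?N u p = 4"
    proof (intro lev_4I)
      show "p \<notin> unknown ?N u" using d(2) sub by blast
      show "md ?N h \<in> {Idle, Cross}" if "h < G" "hm ?N h = u" "pt ?N h = p" for h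
        using step_lev_origin[OF that] no[of h] that(1) by blast
    qed
    then show ?thesis using d by simp
  qed
qed

section \<open>Steps without progress\<close>

definition quiet :: "(nat set \<Rightarrow> bool) \<Rightarrow> state \<Rightarrow> bool" where
  "quiet pr M \<longleftrightarrow> consistent M \<and> (\<forall>g<G. md M g \<noteq> Found \<and> md (step pr M) g \<noteq> Found)
     \<and> (\<forall>u<n. u \<noteq> bh \<longrightarrow> (\<forall>p<deg u. lev (step pr M) u p = lev M u p))"

lemma quietD:
  assumes "quiet pr M"
  shows "consistent M" "\<And>g. g < G \<Longrightarrow> md M g \<noteq> Found" "\<And>g. g < G \<Longrightarrow> md (step pr M) g \<noteq> Found"
    "\<And>u p. u < n \<Longrightarrow> u \<noteq> bh \<Longrightarrow> p < deg u \<Longrightarrow> lev (step pr M) u p = lev M u p"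
  using assms by (auto simp: quiet_def)

text \<open>If the edge were present, the unique trio responsible for the port would leave its
  current mode, and the level would change.\<close>

lemma quiet_closed:
  assumes q: "quiet pr M" and u: "u < n" "u \<noteq> bh" "p < deg u" and l: "lev M u p \<in> {1, 2, 3}"
  shows "\<not> pr {u, nbr u p}"
proof
  assume op: "pr {u, nbr u p}"
  let ?N = "step pr M" and ?P = "planned M"
  have M: "consistent M" and mp: "mid ?P" using quietD(1)[OF q] mid_planned by auto
  have uniq: "g = h" if "g < G" "h < G" "hm M g = u" "hm M h = u" "pt ?P g = p" "pt ?P h = p"
     "md ?P g \<noteq> Idle" "md ?P h \<noteq> Idle" for g h
    using midD(6)[OF mp that(1,2,7,8)] that by simp
  have le: "lev ?N u p = lev M u p" using quietD(4)[OF q u] .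
  obtain g where g: "g < G" "hm M g = u" "pt M g = p" "holds g (md M g)" "md M g \<notin> {Idle, Cross}"
    and lg: "lev M u p = (case md M g of Recall \<Rightarrow> 3 | Verify \<Rightarrow> 2 | Found \<Rightarrow> 2 | _ \<Rightarrow> 1)"
    by (cases rule: lev_cases[of M u p]) (use l that in \<open>auto simp: holds_def\<close>)
  have pg: "md ?P g = md M g" "pt ?P g = p" using planned_holds[OF g(1,4)] g by auto
  have "open_for pr ?P g" using op g pg by (simp add: open_for_def far_def)
  then have next': "md ?N g = (case md M g of Probe \<Rightarrow> if far ?P g \<noteq> bh \<and> exchange ?P g \<noteq> {} then Cross else Verify
      | Verify \<Rightarrow> Recall | _ \<Rightarrow> Cross)"
    using pg g(5) quietD(2,3)[OF q g(1)] by (cases "md M g") (auto simp: step_def next_mode_def split: if_splits)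
  have o: "h = g" if "h < G" "hm ?N h = u" "pt ?N h = p" "md ?N h \<notin> {Idle, Cross}" for h
  proof -
    have "hm M h = u" "pt ?P h = p" "md ?P h \<notin> {Idle, Cross}"
      using step_lev_origin[OF that(1-4)] by auto
    then show ?thesis using uniq[OF that(1) g(1)] pg g by auto
  qed
  have "lev ?N u p \<noteq> lev M u p"
  proof (cases "md M g")
    case Probe
    then have "lev M u p = 1" using lg by simp
    moreover have "lev ?N u p \<noteq> 1"
    proof
      assume "lev ?N u p = 1"
      then obtain h where h: "h < G" "hm ?N h = u" "pt ?N h = p" "md ?N h = Probe"
        by (cases rule: lev_cases[of ?N u p]) simp_all
      then have "h = g" using o[of h] by simp
      then show False using h(4) next' Probe by (simp split: if_splits)
    qed
    ultimately show ?thesis by simp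
  next
    case Verify
    then have "lev M u p = 2" using lg by simp
    moreover have "lev ?N u p = 3"
      using next' Verify step_origin(1,2)[OF g(1), of pr M] pg g by (intro lev_3I[of g]) auto
    ultimately show ?thesis by simp
  next
    case Recall
    then have "lev M u p = 3" using lg by simp
    moreover have "lev ?N u p \<noteq> 3"
    proof
      assume "lev ?N u p = 3"
      then obtain h where h: "h < G" "hm ?N h = u" "pt ?N h = p" "md ?N h = Recall"
        by (cases rule: lev_cases[of ?N u p]) simp_all
      then have "h = g" using o[of h] by simp
      then show False using h(4) next' Recall by (simp split: if_splits)
    qed
    ultimately show ?thesis by simp
  qed (use g(5) quietD(2)[OF q g(1)] in auto)
  then show False using le by simp
qed

lemma holds_lev:
  assumes "consistent M" "g < G" "holds g (md M g)" "md M g \<noteq> Cross"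
  shows "lev M (hm M g) (pt M g) \<in> {1, 2, 3}"
    "md M g \<in> {Verify, Recall} \<Longrightarrow> lev M (hm M g) (pt M g) \<in> {2, 3}"
proof -
  have nf: "md M g \<notin> {Idle, Cross}" "md M g = Probe \<Longrightarrow> g \<noteq> 0" using assms(3,4) by (auto simp: holds_def)
  show "lev M (hm M g) (pt M g) \<in> {1, 2, 3}"
  proof (cases rule: lev_cases[of M "hm M g" "pt M g"])
    case new
    then show ?thesis using new(3)[OF assms(2) refl refl] nf by (cases "md M g") auto
  next
    case known
    then show ?thesis using known(3)[OF assms(2) refl refl] nf by (cases "md M g") auto
  qed simp_all
  then show "md M g \<in> {Verify, Recall} \<Longrightarrow> lev M (hm M g) (pt M g) \<in> {2, 3}"
    using lev_2I[OF assms(2) refl refl, of M] by auto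
qed

lemma lev_23D:
  assumes "lev M u p \<in> {2, 3}"
  shows "\<exists>g<G. hm M g = u \<and> pt M g = p \<and> md M g \<in> {Verify, Recall, Found}"
  by (cases rule: lev_cases[of M u p]) (use assms in auto)

text \<open>Work is in progress on the edge, at this end or at the other. Level 1 at the other end
  is left out: a scout that has not left yet leaves no trace here, and this end may still be handed
  out.\<close>

definition stuck :: "state \<Rightarrow> nat \<Rightarrow> nat \<Rightarrow> bool" where
  "stuck M u p \<longleftrightarrow> lev M u p \<in> {1, 2, 3} \<or> nbr u p \<noteq> bh \<and> lev M (nbr u p) (bck u p) \<in> {2, 3}"

lemma stuck_closed:
  assumes q: "quiet pr M" and u: "u < n" "u \<noteq> bh" "p < deg u" and s: "stuck M u p"
  shows "\<not> pr {u, nbr u p}"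
  using s quiet_closed[OF q u] quiet_closed[OF q nbrD(1)[OF u(1,3)] _ nbrD(3)[OF u(1,3)]] nbrD(4)[OF u(1,3)]
  unfolding stuck_def by (auto simp: insert_commute)

lemma stuck_step:
  assumes q: "quiet pr M" and u: "u < n" "u \<noteq> bh" "p < deg u"
  shows "stuck (step pr M) u p = stuck M u p"
  using quietD(4)[OF q u] quietD(4)[OF q nbrD(1)[OF u(1,3)] _ nbrD(3)[OF u(1,3)]]
  unfolding stuck_def by auto

text \<open>Separates the occupied ports that depend on the movement of patient trios from the stuck
  ones, which are constant in a quiet period.\<close>

lemma occ_cases:
  assumes M: "consistent M" and nf: "\<forall>g<G. md M g \<noteq> Found" and u: "u < n" "u \<noteq> bh" and p: "p \<in> occ M u"
  obtains g where "g < G" "g \<noteq> 0" "md M g = Cross" "hm M g = u" "pt M g = p"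
  | "stuck M u p"
proof -
  from p consider g where "g < G" "holds g (md M g)" "hm M g = u" "pt M g = p"
    | g where "g < G" "md M g = Verify \<or> md M g = Recall" "far M g = u" "bck (hm M g) (pt M g) = p"
    by (auto simp: occ_def far_def)
  then show ?thesis
  proof cases
    case 1
    then show ?thesis using that holds_lev(1)[OF M 1(1,2)]
      by (cases "md M g = Cross") (auto simp: stuck_def holds_def)
  next
    case 2
    have s: "hm M g < n" "pt M g < deg (hm M g)" "hm M g \<noteq> bh" using consistentD(1,2,3)[OF M 2(1)] 2(2) by auto
    have "nbr u p = hm M g" "bck u p = pt M g" using nbrD(4,5)[OF s(1,2)] 2 by (auto simp: far_def)
    then have "stuck M u p"
      using holds_lev(2)[OF M 2(1)] 2(2) s(3) by (auto simp: stuck_def holds_def)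
    then show ?thesis using that by blast
  qed
qed

text \<open>An unknown port ceases to be unknown as soon as a patient trio receives it, which would
  be progress.\<close>

lemma quiet_patient_choice:
  assumes q: "quiet pr M" and u: "u < n" "u \<noteq> bh" and c: "patient_choice M u = Some p"
  shows "p \<notin> unk (deg u) (fresh_board M u)"
proof
  assume p: "p \<in> unk (deg u) (fresh_board M u)"
  have M: "consistent M" using quietD(1)[OF q] .
  have ch: "p < deg u" "p \<notin> occ M u" using choiceD[of M u p] c by auto
  have "lev M u p = 0" using lev_0 fresh_unk_subset[OF M u] p ch by blast
  then have "lev (step pr M) u p = 0" using quietD(4)[OF q u ch(1)] by simp
  then have "p \<in> unknown (planned M) u" using lev_0D(1)[of "step pr M" u p] by simp
  moreover have "Min (idle M u) \<in> idle M u" using idle_patient c by simp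
  then have "lively M u" using lively_home[of M "Min (idle M u)"] M by (auto simp: idle_def)
  ultimately show False using patient_choice_dropped[OF c] by simp
qed

lemma step_hm: "hm (step pr M) g = (if md (planned M) g = Cross \<and> open_for pr (planned M) g then far (planned M) g else hm M g)"
  by (simp add: step_def hm_moved)

lemma step_md: "md (step pr M) g = next_mode pr (planned M) g"
  and step_pt: "pt (step pr M) g = pt (planned M) g"
  by (simp_all add: step_def)

lemma quiet_holds:
  assumes q: "quiet pr M" and g: "g < G" "holds g (md M g)" and nc: "md M g \<noteq> Cross \<or> \<not> pr {hm M g, far M g}"
  shows "hm (step pr M) g = hm M g" "md (step pr M) g = md M g" "pt (step pr M) g = pt M g"
    "\<not> pr {hm M g, far M g}"
proof -
  have M: "consistent M" using quietD(1)[OF q] .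
  have s: "hm M g < n" "pt M g < deg (hm M g)" "hm M g \<noteq> bh" using consistentD(1,2,3)[OF M g(1)] g(2) by (auto simp: holds_def)
  show cl: "\<not> pr {hm M g, far M g}"
    using nc quiet_closed[OF q s(1,3,2)] holds_lev(1)[OF M g] by (auto simp: far_def)
  have P: "md (planned M) g = md M g" "pt (planned M) g = pt M g" using planned_holds[OF g] by auto
  then have "\<not> open_for pr (planned M) g" using cl by (simp add: open_for_def far_def)
  then show "hm (step pr M) g = hm M g" "md (step pr M) g = md M g" "pt (step pr M) g = pt M g"
    using P by (auto simp: step_hm step_md step_pt next_mode_def)
qed

lemma step_cross:
  assumes "g < G" "holds g (md M g)" "md M g = Cross" "pr {hm M g, far M g}"
  shows "hm (step pr M) g = far M g" "md (step pr M) g = Idle"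
  using planned_holds[OF assms(1,2)] assms(3,4)
  by (auto simp: step_hm step_md next_mode_def open_for_def far_def)

lemma quiet_idle:
  assumes q: "quiet pr M" and g: "g < G" "g \<noteq> 0" "md M g = Idle"
  obtains "hm (step pr M) g = hm M g" "md (step pr M) g = Idle"
      "\<not> (g = Min (idle M (hm M g)) \<and> patient_choice M (hm M g) \<noteq> None)"
  | p where "g = Min (idle M (hm M g))" "patient_choice M (hm M g) = Some p" "pr {hm M g, nbr (hm M g) p}"
      "hm (step pr M) g = nbr (hm M g) p" "md (step pr M) g = Idle"
  | p where "g = Min (idle M (hm M g))" "patient_choice M (hm M g) = Some p" "\<not> pr {hm M g, nbr (hm M g) p}"
      "hm (step pr M) g = hm M g" "md (step pr M) g = Cross" "pt (step pr M) g = p"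
proof -
  have M: "consistent M" using quietD(1)[OF q] .
  have s: "hm M g < n" "hm M g \<noteq> bh" using consistentD(1,2)[OF M g(1)] by auto
  show ?thesis
  proof (cases "g = Min (idle M (hm M g)) \<and> patient_choice M (hm M g) \<noteq> None")
    case True
    then obtain p where p: "patient_choice M (hm M g) = Some p" by auto
    have a: "assign M g = (Cross, p)"
      using True p g port_mode_cases quiet_patient_choice[OF q s p] by (auto simp: assign_eq Let_def port_mode_def)
    show ?thesis
      using that(2)[of p] that(3)[of p] True p a
      by (cases "pr {hm M g, nbr (hm M g) p}")
        (auto simp: step_hm step_md step_pt next_mode_def open_for_def far_def)
  next
    case False
    have a: "fst (assign M g) = Idle"
      by (rule assign_cases[OF g(1), of M]) (use False g in auto)
    show ?thesis using that(1) False a by (auto simp: step_hm step_md next_mode_def)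
  qed
qed

text \<open>The right-hand side depends on levels and stuck ports alone. These are constant in a
  quiet period, and so are therefore the candidates \<open>low\<close> and \<open>high\<close> at
  the time of choice.\<close>

lemma fresh_set_quiet:
  assumes q: "quiet pr M" and u: "u < n" "u \<noteq> bh"
  shows "unknown M u - (occ M u \<union> crossed M u) = {p. p < deg u \<and> lev M u p = 0 \<and> \<not> stuck M u p}"
proof (intro set_eqI iffI)
  have M: "consistent M" using quietD(1)[OF q] .
  fix p
  assume p: "p \<in> unknown M u - (occ M u \<union> crossed M u)"
  then have pd: "p < deg u" by (auto simp: unk_def)
  have l: "lev M u p = 0" using p lev_0 by blast
  have "\<not> stuck M u p"
  proof
    assume "stuck M u p"
    then have v: "nbr u p \<noteq> bh" "lev M (nbr u p) (bck u p) \<in> {2, 3}" using l by (auto simp: stuck_def)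
    obtain g where g: "g < G" "hm M g = nbr u p" "pt M g = bck u p" "md M g \<in> {Verify, Recall, Found}"
      using lev_23D[OF v(2)] by blast
    then have "md M g = Verify \<or> md M g = Recall" using quietD(2)[OF q g(1)] by auto
    then have "p \<in> occ M u"
      using foreign_occ[OF g(1), of M] g(2,3) nbrD(4,5)[OF u(1) pd] by (simp add: far_def)
    then show False using p by blast
  qed
  then show "p \<in> {p. p < deg u \<and> lev M u p = 0 \<and> \<not> stuck M u p}" using pd l by blast
next
  have M: "consistent M" using quietD(1)[OF q] .
  fix p
  assume "p \<in> {p. p < deg u \<and> lev M u p = 0 \<and> \<not> stuck M u p}"
  then have p: "p < deg u" "lev M u p = 0" "\<not> stuck M u p" by auto
  have un: "p \<in> unknown M u" using lev_0D(1)[OF p(2)] .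
  have "p \<notin> occ M u"
  proof
    assume o: "p \<in> occ M u"
    have nf: "\<forall>g<G. md M g \<noteq> Found" using quietD(2)[OF q] by blast
    show False
    proof (cases rule: occ_cases[OF M nf u o])
      case (1 g)
      then show False using consistentD(8)[OF M 1(1,2)] un by auto
    qed (use p in auto)
  qed
  \<comment> \<open>If the port being crossed were still unknown, planning would drop it in this
    very step and raise its level.\<close>
  moreover have "p \<notin> crossed M u"
  proof
    assume c: "p \<in> crossed M u"
    then have c': "md M 0 = Cross" "pt M 0 = p" "hm M 0 = u" by (auto simp: crossed_def)
    have "p = low (bd M u) \<or> p = high (bd M u)" using consistentD(10)[OF M] c' un by auto
    then have "p \<notin> unk (deg u) (fresh_board M u)"
      unfolding fresh_board_def using consistentD(12)[OF M u] c
      by (intro unk_drop_candidate) (auto simp: board_ok_def)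
    then have "p \<notin> unk (deg u) (fst (plan_at M u))" using plan_unk_subset by blast
    moreover have "lively M u" using lively_home[of M 0] M G c' by auto
    ultimately have "p \<notin> unknown (step pr M) u" by simp
    moreover have "lev (step pr M) u p = 0" using quietD(4)[OF q u p(1)] p(2) by simp
    ultimately show False using lev_0D(1) by blast
  qed
  ultimately show "p \<in> unknown M u - (occ M u \<union> crossed M u)" using un by blast
qed

lemma fresh_board_quiet:
  assumes q: "quiet pr M" "quiet pr' M'" and u: "u < n" "u \<noteq> bh"
    and l: "\<And>p. p < deg u \<Longrightarrow> lev M' u p = lev M u p" and s: "\<And>p. p < deg u \<Longrightarrow> stuck M' u p = stuck M u p"
  shows "low (fresh_board M' u) = low (fresh_board M u)" "high (fresh_board M' u) = high (fresh_board M u)"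
proof -
  have "unknown M' u - (occ M' u \<union> crossed M' u) = unknown M u - (occ M u \<union> crossed M u)"
    unfolding fresh_set_quiet[OF q(1) u] fresh_set_quiet[OF q(2) u] using l s by auto
  then show "low (fresh_board M' u) = low (fresh_board M u)" "high (fresh_board M' u) = high (fresh_board M u)"
    by (simp_all add: fresh_board_def low_drop high_drop)
qed

text \<open>Brings planning into the form expected by \<open>rotor_cover\<close>, with the offset of
  the search as advance.\<close>

lemma rot_step:
  assumes M: "consistent M" and u: "u < n" "u \<noteq> bh"
  shows "rot (bd (step pr M) u) = (if patient_choice M u \<noteq> None
      then Suc (rot (bd M u) + offset (deg u) (rot (bd M u)) (avail (deg u) (occ M u) (fresh_board M u))) mod deg u
      else rot (bd M u))"
proof (cases "patient_choice M u")
  case None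
  then show ?thesis by (auto simp: plan_at_eq split: option.splits)
next
  case (Some p)
  then have "Min (idle M u) \<in> idle M u" using idle_patient by simp
  then have "lively M u" using lively_home[of M "Min (idle M u)"] M by (auto simp: idle_def)
  moreover have "p = (rot (bd M u) + offset (deg u) (rot (bd M u)) (avail (deg u) (occ M u) (fresh_board M u))) mod deg u"
    using Some pick_SomeD(1)[of "deg u" "rot (bd M u)" "avail (deg u) (occ M u) (fresh_board M u)" p, OF _ avail_less]
    by (auto simp: patient_choice_def split: if_splits)
  ultimately show ?thesis using Some by (simp add: plan_at_eq mod_Suc_eq)
qed

lemma irot_step:
  assumes M: "consistent M" and u: "u < n" "u \<noteq> bh"
  shows "irot (bd (step pr M) u) = (if imp_choice M u \<noteq> None
      then Suc (irot (bd M u) + offset (deg u) (irot (bd M u)) (avail (deg u) (occ M u) (fresh_board M u))) mod deg u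
      else irot (bd M u))"
proof (cases "imp_choice M u")
  case None
  then show ?thesis by (auto simp: plan_at_eq split: option.splits)
next
  case (Some p)
  then have i: "impatient M u" "patient_choice M u = None" by (auto simp: imp_choice_def split: if_splits)
  then have "lively M u" using lively_home[of M 0] M G by (auto simp: impatient_def)
  moreover have "p = (irot (bd M u) + offset (deg u) (irot (bd M u)) (avail (deg u) (occ M u) (fresh_board M u))) mod deg u"
    using Some pick_SomeD(1)[of "deg u" "irot (bd M u)" "avail (deg u) (occ M u) (fresh_board M u)" p, OF _ avail_less]
    by (auto simp: imp_choice_def split: if_splits)
  ultimately show ?thesis using Some i by (simp add: plan_at_eq mod_Suc_eq)
qed

text \<open>If an unknown port chosen by the impatient trio were open, either its scout would leave
  and raise the level, or it would be exchanged with an opposite scout. That scout would belong to a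
  patient trio probing through an open edge, which a quiet step excludes.\<close>

lemma quiet_imp:
  assumes q: "quiet pr M" and m: "md M 0 \<notin> {Verify, Recall}"
  shows "md (step pr M) 0 \<in> {Idle, Probe, Cross}"
    "imp_choice M (hm M 0) = Some p \<Longrightarrow> p \<in> unk (deg (hm M 0)) (fresh_board M (hm M 0)) \<Longrightarrow> \<not> pr {hm M 0, nbr (hm M 0) p}"
    "imp_choice M (hm M 0) = Some p \<Longrightarrow> pr {hm M 0, nbr (hm M 0) p} \<Longrightarrow> hm (step pr M) 0 = nbr (hm M 0) p"
    "imp_choice M (hm M 0) = Some p \<Longrightarrow> \<not> pr {hm M 0, nbr (hm M 0) p} \<Longrightarrow> hm (step pr M) 0 = hm M 0"
    "imp_choice M (hm M 0) = None \<Longrightarrow> hm (step pr M) 0 = hm M 0"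
proof -
  let ?u = "hm M 0" and ?P = "planned M"
  have M: "consistent M" using quietD(1)[OF q] .
  have mp: "mid ?P" using M by (rule mid_planned)
  have z: "0 < G" using G by simp
  have u: "?u < n" "?u \<noteq> bh" using consistentD(1,2)[OF M z] by auto
  have m': "md M 0 \<in> {Idle, Probe, Cross}" using m quietD(2)[OF q z] by (cases "md M 0") auto
  have a: "assign M 0 = (case imp_choice M ?u of None \<Rightarrow> (Idle, pt M 0)
      | Some p \<Rightarrow> (port_mode (deg ?u) (fresh_board M ?u) p, p))"
    using m' by (auto simp: assign_eq Let_def)
  show cl: "\<not> pr {?u, nbr ?u p}" if p: "imp_choice M ?u = Some p" "p \<in> unk (deg ?u) (fresh_board M ?u)" for p
  proof
    assume op: "pr {?u, nbr ?u p}"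
    have ch: "p < deg ?u" "p \<notin> occ M ?u" using choiceD[of M ?u p] p by auto
    have l0: "lev M ?u p = 0" using lev_0 fresh_unk_subset[OF M u] p ch by blast
    have P: "md ?P 0 = Probe" "pt ?P 0 = p" using a p by (auto simp: port_mode_def)
    have o: "open_for pr ?P 0" using op P by (simp add: open_for_def far_def)
    show False
    proof (cases "far ?P 0 \<noteq> bh \<and> exchange ?P 0 \<noteq> {}")
      case False
      then have "md (step pr M) 0 = Verify" using P o by (simp add: step_md next_mode_def)
      moreover have "hm (step pr M) 0 = ?u" "pt (step pr M) 0 = p" using P by (auto simp: step_hm step_pt)
      ultimately have "lev (step pr M) ?u p \<ge> 2" using z by (intro lev_2I[of 0]) auto
      then show False using l0 quietD(4)[OF q u ch(1)] by simp
    next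
      case True
      then obtain h where h: "h < G" "md ?P h = Probe" "hm M h = nbr ?u p" "pt ?P h = bck ?u p"
        using P by (auto simp: exchange_def far_def)
      \<comment> \<open>The opposite trio lives at a neighbour, and no node is its own
        neighbour.\<close>
      have h0: "h \<noteq> 0" using h(3) nbrD(2)[OF u(1) ch(1)] by metis
      have uh: "hm M h < n" "hm M h \<noteq> bh" using consistentD(1,2)[OF M h(1)] by auto
      have b: "nbr (hm M h) (pt ?P h) = ?u" using h nbrD(4)[OF u(1) ch(1)] by simp
      show False
      proof (cases "md M h = Probe")
        case True
        then have hh: "holds h (md M h)" using h0 by (simp add: holds_def)
        then have "pt M h = pt ?P h" using planned_holds[OF h(1)] by simp
        moreover have "\<not> pr {hm M h, far M h}" using quiet_holds(4)[OF q h(1) hh] True by simp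
        ultimately show False using op b h(3) by (auto simp: far_def insert_commute)
      next
        case False
        then show False
          using planned_probe(1,4)[OF M h(1,2)] h0 quiet_patient_choice[OF q uh, of "pt ?P h"] by auto
      qed
    qed
  qed
  show "md (step pr M) 0 \<in> {Idle, Probe, Cross}"
  proof (cases "imp_choice M ?u")
    case None
    then show ?thesis using a by (auto simp: step_md next_mode_def)
  next
    case (Some p)
    show ?thesis
    proof (cases "p \<in> unk (deg ?u) (fresh_board M ?u)")
      case True
      then have "\<not> pr {?u, nbr ?u p}" using cl Some by blast
      then show ?thesis using a Some True by (auto simp: step_md next_mode_def open_for_def far_def port_mode_def)
    next
      case False
      then show ?thesis using a Some by (auto simp: step_md next_mode_def port_mode_def)
    qed
  qed
  show "hm (step pr M) 0 = nbr ?u p" if "imp_choice M ?u = Some p" "pr {?u, nbr ?u p}" for p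
    using a that cl[OF that(1)] by (auto simp: step_hm open_for_def far_def port_mode_def)
  show "hm (step pr M) 0 = ?u" if "imp_choice M ?u = Some p" "\<not> pr {?u, nbr ?u p}" for p
    using a that by (auto simp: step_hm open_for_def far_def port_mode_def)
  show "hm (step pr M) 0 = ?u" if "imp_choice M ?u = None"
    using a that by (auto simp: step_hm)
qed


lemma quiet_patient:
  assumes q: "quiet pr M" and g: "g < G" "g \<noteq> 0"
  obtains (stay) "hm (step pr M) g = hm M g" "md (step pr M) g = Idle \<longleftrightarrow> md M g = Idle"
      "md M g \<noteq> Idle \<Longrightarrow> pt (step pr M) g = pt M g \<and> \<not> pr {hm M g, far M g}"
      "md M g = Idle \<Longrightarrow> \<not> (g = Min (idle M (hm M g)) \<and> patient_choice M (hm M g) \<noteq> None)"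
  | (leave) p where "hm (step pr M) g = nbr (hm M g) p" "md (step pr M) g = Idle" "p < deg (hm M g)"
      "md M g \<noteq> Idle \<and> pt M g = p
       \<or> md M g = Idle \<and> g = Min (idle M (hm M g)) \<and> patient_choice M (hm M g) = Some p"
  | (take_port) p where "hm (step pr M) g = hm M g" "md (step pr M) g \<noteq> Idle" "pt (step pr M) g = p"
      "md M g = Idle" "g = Min (idle M (hm M g))" "patient_choice M (hm M g) = Some p"
      "\<not> pr {hm M g, nbr (hm M g) p}"
proof (cases "md M g = Idle")
  case True
  show ?thesis
  proof (cases rule: quiet_idle[OF q g True])
    case 1
    then show ?thesis using stay True by simp
  next
    case (2 p)
    then show ?thesis using leave[of p] True choiceD(2)[of M "hm M g" p] by simp
  next
    case (3 p)
    then show ?thesis using take_port[of p] True by simp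
  qed
next
  case False
  then have h: "holds g (md M g)" using g by (simp add: holds_def)
  show ?thesis
  proof (cases "md M g = Cross \<and> pr {hm M g, far M g}")
    case True
    then show ?thesis
      using leave[of "pt M g"] step_cross[OF g(1) h] consistentD(3)[OF quietD(1)[OF q] g(1)] False
      by (simp add: far_def)
  next
    case nc: False
    then show ?thesis using stay quiet_holds[OF q g(1) h] False by auto
  qed
qed

text \<open>Of the mode only whether a trio is idle is recorded. This suffices in a quiet period and
  keeps the number of situations small.\<close>

definition same_patients :: "state \<Rightarrow> state \<Rightarrow> bool" where
  "same_patients S T \<longleftrightarrow>
     (\<forall>g<G. g \<noteq> 0 \<longrightarrow> hm S g = hm T g \<and> (md S g = Idle \<longleftrightarrow> md T g = Idle) \<and> (md S g \<noteq> Idle \<longrightarrow> pt S g = pt T g))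
   \<and> (\<forall>u<n. u \<noteq> bh \<longrightarrow> rot (bd S u) = rot (bd T u))"

end

section \<open>Executions against the adversary\<close>

locale execution = trios n deg nbr bck bh "2 * f" for n deg nbr bck bh f +
  fixes pr :: "nat \<Rightarrow> nat set \<Rightarrow> bool" and M :: "nat \<Rightarrow> state"
  assumes start: "consistent (M 0)" and steps: "M (Suc k) = step (pr k) (M k)"
    and conn: "connected_on n {e \<in> Edges n deg nbr. pr k e}"
    and few: "card {e \<in> Edges n deg nbr. \<not> pr k e} \<le> f"
begin

lemma consistent_M: "consistent (M k)"
  by (induction k) (auto simp: start steps consistent_step)

text \<open>The black hole lies outside \<open>J\<close>, so connectivity in step \<open>k\<close>
  supplies a present edge that leaves \<open>J\<close>.\<close>

lemma no_trap:
  assumes J: "u \<in> J" "\<And>v. v \<in> J \<Longrightarrow> v < n" "bh \<notin> J"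
    and cl: "\<And>v p. v \<in> J \<Longrightarrow> p < deg v \<Longrightarrow> nbr v p \<in> J \<or> \<not> pr k {v, nbr v p}"
  shows False
proof -
  obtain x y where xy: "x < n" "y < n" "x \<in> J" "y \<notin> J" "{x, y} \<in> Edges n deg nbr" "pr k {x, y}"
    using crossing_edge[OF conn[of k] J(1) J(2)[OF J(1)] bh J(3)] by blast
  then obtain v p where vp: "{x, y} = {v, nbr v p}" "v < n" "p < deg v" by (auto simp: Edges_def)
  then consider "x = v" "y = nbr v p" | "y = v" "x = nbr v p" by (auto simp: doubleton_eq_iff)
  then show False
  proof cases
    case 1
    then show False using cl[of x p] xy vp by auto
  next
    case 2
    then show False
      using cl[of x "bck v p"] xy vp nbrD(3,4)[OF vp(2,3)] by auto
  qed
qed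

text \<open>Ends of missing edges are counted instead of edges, because an end is what a trio can
  occupy.\<close>

definition missing :: "nat \<Rightarrow> (nat \<times> nat) set" where
  "missing k = {(u, p). u < n \<and> p < deg u \<and> \<not> pr k {u, nbr u p}}"

definition flip :: "nat \<times> nat \<Rightarrow> nat \<times> nat" where
  "flip x = (nbr (fst x) (snd x), bck (fst x) (snd x))"

lemma flip_missing: "x \<in> missing k \<Longrightarrow> flip x \<in> missing k \<and> flip (flip x) = x \<and> flip x \<noteq> x"
  using nbrD[of "fst x" "snd x"] by (auto simp: missing_def flip_def insert_commute)

lemma finite_missing: "finite (missing k)"
  by (rule finite_subset[of _ "Sigma {..<n} (\<lambda>u. {..<deg u})"]) (auto simp: missing_def)

lemma finite_Edges: "finite (Edges n deg nbr)"
proof -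
  have "Edges n deg nbr = (\<lambda>(v, p). {v, nbr v p}) ` Sigma {..<n} (\<lambda>u. {..<deg u})"
    by (auto simp: Edges_def)
  then show ?thesis by simp
qed

text \<open>Parallel edges are excluded, so an end and its \<open>flip\<close> are the only ends
  that yield the same edge.\<close>

lemma card_missing: "card (missing k) \<le> 2 * f"
proof -
  let ?E = "{e \<in> Edges n deg nbr. \<not> pr k e}" and ?ed = "\<lambda>x. {fst x, nbr (fst x) (snd x)}"
  have fE: "finite ?E" using finite_Edges by simp
  have sub: "missing k \<subseteq> (\<Union>e\<in>?E. {x \<in> missing k. ?ed x = e})"
  proof
    fix x assume x: "x \<in> missing k"
    then have "fst x < n \<and> snd x < deg (fst x)" "\<not> pr k (?ed x)" by (auto simp: missing_def)
    then have "?ed x \<in> ?E" unfolding Edges_def by blast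
    then show "x \<in> (\<Union>e\<in>?E. {x \<in> missing k. ?ed x = e})" using x by blast
  qed
  have fib: "card {x \<in> missing k. ?ed x = e} \<le> 2" for e
  proof (cases "{x \<in> missing k. ?ed x = e} = {}")
    case False
    then obtain x where x: "x \<in> missing k" "?ed x = e" by blast
    have "y = x \<or> y = flip x" if y: "y \<in> missing k" "?ed y = e" for y
    proof -
      have bx: "fst x < n" "snd x < deg (fst x)" "fst y < n" "snd y < deg (fst y)"
        using x(1) y(1) by (auto simp: missing_def)
      have "?ed y = ?ed x" using x y by simp
      then consider (same) "fst y = fst x" "nbr (fst y) (snd y) = nbr (fst x) (snd x)"
        | (other) "fst y = nbr (fst x) (snd x)" "nbr (fst y) (snd y) = fst x"
        unfolding doubleton_eq_iff by blast
      then show ?thesis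
      proof cases
        case same
        then have "snd y = snd x" using nbr_inj[of "fst x" "snd y" "snd x"] bx by simp
        then show ?thesis using same(1) by (simp add: prod_eq_iff)
      next
        case other
        then have "snd y = bck (fst x) (snd x)"
          using nbr_inj[OF bx(3,4), of "bck (fst x) (snd x)"] nbrD(3,4)[OF bx(1,2)] by simp
        then show ?thesis using other(1) by (simp add: flip_def prod_eq_iff)
      qed
    qed
    then have "{x \<in> missing k. ?ed x = e} \<subseteq> {x, flip x}" by blast
    then have "card {x \<in> missing k. ?ed x = e} \<le> card {x, flip x}" by (intro card_mono) auto
    also have "\<dots> \<le> 2" by (simp add: card_insert_if)
    finally show ?thesis .
  next
    case True
    show ?thesis unfolding True by simp
  qed
  have "card (missing k) \<le> card (\<Union>e\<in>?E. {x \<in> missing k. ?ed x = e})"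
    using sub fE finite_missing by (intro card_mono finite_UN_I) auto
  also have "\<dots> \<le> (\<Sum>e\<in>?E. card {x \<in> missing k. ?ed x = e})" by (rule card_UN_le[OF fE])
  also have "\<dots> \<le> (\<Sum>e\<in>?E. 2)" by (intro sum_mono fib)
  also have "\<dots> \<le> 2 * f" using few[of k] by simp
  finally show ?thesis .
qed

abbreviation quiet_on :: "nat \<Rightarrow> nat \<Rightarrow> bool" where
  "quiet_on a b \<equiv> \<forall>k. a \<le> k \<longrightarrow> k < b \<longrightarrow> quiet (pr k) (M k)"

lemma lev_const:
  assumes q: "quiet_on a b" and k: "a \<le> k" "k \<le> b" and u: "u < n" "u \<noteq> bh" "p < deg u"
  shows "lev (M k) u p = lev (M a) u p"
  using k
proof (induction k rule: dec_induct)
  case (step k)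
  then show ?case using quietD(4)[of "pr k" "M k" u p] q u by (auto simp: steps)
qed simp

lemma stuck_const:
  assumes q: "quiet_on a b" and k: "a \<le> k" "k \<le> b" and u: "u < n" "u \<noteq> bh" "p < deg u"
  shows "stuck (M k) u p = stuck (M a) u p"
  using k
proof (induction k rule: dec_induct)
  case (step k)
  then show ?case using stuck_step[of "pr k" "M k" u p] q u by (auto simp: steps)
qed simp

lemma fresh_board_const:
  assumes q: "quiet_on a b" and k: "a \<le> k" "k < b" and i: "a \<le> i" "i < b" and u: "u < n" "u \<noteq> bh"
  shows "low (fresh_board (M k) u) = low (fresh_board (M i) u)"
    "high (fresh_board (M k) u) = high (fresh_board (M i) u)"
proof -
  have qk: "quiet (pr k) (M k)" "quiet (pr i) (M i)" using q k i by auto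
  have l: "lev (M k) u p = lev (M i) u p" if "p < deg u" for p
    using lev_const[OF q _ _ u that, of k] lev_const[OF q _ _ u that, of i] k i by simp
  have s: "stuck (M k) u p = stuck (M i) u p" if "p < deg u" for p
    using stuck_const[OF q _ _ u that, of k] stuck_const[OF q _ _ u that, of i] k i by simp
  show "low (fresh_board (M k) u) = low (fresh_board (M i) u)"
    "high (fresh_board (M k) u) = high (fresh_board (M i) u)"
    using fresh_board_quiet[OF qk(2,1) u l s] by auto
qed

lemma fresh_low_avail:
  assumes "low (fresh_board S u) < deg u"
  shows "avail (deg u) (occ S u) (fresh_board S u) (low (fresh_board S u))"
    "low (fresh_board S u) \<in> unk (deg u) (fresh_board S u)"
  using assms avail_drop_low by (auto simp: fresh_board_def unk_def)

lemma fresh_high_avail: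
  assumes "high (fresh_board S u) < deg u"
  shows "avail (deg u) (occ S u) (fresh_board S u) (high (fresh_board S u))"
    "high (fresh_board S u) \<in> unk (deg u) (fresh_board S u)"
    "low (fresh_board S u) < high (fresh_board S u)"
  using assms avail_drop_high drop_bounds(5) by (auto simp: fresh_board_def unk_def)

text \<open>For a node of \<open>I\<close> the rotor has returned after moving, so each of its ports
  was inspected. An inspected port was handed out, or occupied, or unknown and not a candidate. If
  it led out of \<open>I\<close> through an edge present in step \<open>a\<close>, each case would
  contradict periodicity or quietness; so \<open>I\<close> would trap the patient trios.\<close>

lemma patient_closure:
  assumes q: "quiet_on a b" and same: "same_patients (M a) (M b)"
    and ex: "a \<le> k0" "k0 < b" "u0 < n" "u0 \<noteq> bh" "patient_choice (M k0) u0 \<noteq> None"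
  shows False
proof -
  define I where "I = {u. u < n \<and> u \<noteq> bh \<and> (\<exists>k\<ge>a. k < b \<and> patient_choice (M k) u \<noteq> None)}"
  have home: "hm (M k) g < n" "hm (M k) g \<noteq> bh" if "g < 2 * f" for k g
    using consistentD(1,2)[OF consistent_M that] by auto
  have inI: "hm (M k) g \<in> I" if "a \<le> k" "k < b" "g < 2 * f" "patient_choice (M k) (hm (M k) g) \<noteq> None" for k g
    unfolding I_def using that home by blast
  have sm: "hm (M a) g = hm (M b) g" "md (M a) g = Idle \<longleftrightarrow> md (M b) g = Idle"
    "md (M b) g \<noteq> Idle \<Longrightarrow> pt (M a) g = pt (M b) g" if "g < 2 * f" "g \<noteq> 0" for g
    using same that unfolding same_patients_def by auto
  \<comment> \<open>A trio that moves must return to its situation at time \<open>a\<close>. At a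
    node where no port is handed out, it would neither get away nor acquire the port through which
    it left.\<close>
  have leaveI: "hm (M k) g \<in> I \<and> hm (M (Suc k)) g \<in> I"
    if k: "a \<le> k" "k < b" and g: "g < 2 * f" "g \<noteq> 0" and l: "hm (M (Suc k)) g \<noteq> hm (M k) g" for k g
  proof
    have qk: "quiet (pr k) (M k)" using q k by auto
    obtain p where p: "hm (M (Suc k)) g = nbr (hm (M k) g) p" "md (M (Suc k)) g = Idle"
       "md (M k) g \<noteq> Idle \<or> patient_choice (M k) (hm (M k) g) = Some p"
      by (rule quiet_patient[OF qk g]) (use l in \<open>auto simp: steps\<close>)
    let ?u = "hm (M k) g" and ?v = "hm (M (Suc k)) g"
    show "?u \<in> I"
    proof (rule ccontr)
      assume nI: "?u \<notin> I"
      have "hm (M k) g \<noteq> ?u \<or> md (M k) g = Idle"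
      proof (rule cyclic_invariant[of a b "\<lambda>i. hm (M i) g \<noteq> ?u \<or> md (M i) g = Idle" "Suc k" k])
        fix i assume i: "a \<le> i" "i < b" "hm (M i) g \<noteq> ?u \<or> md (M i) g = Idle"
        have qi: "quiet (pr i) (M i)" using q i by auto
        show "hm (M (Suc i)) g \<noteq> ?u \<or> md (M (Suc i)) g = Idle"
          by (rule quiet_patient[OF qi g]) (use i inI[of i g] g nI in \<open>auto simp: steps\<close>)
      qed (use k sm[OF g] p l in auto)
      then have "md (M k) g = Idle" by simp
      then show False using p(3) inI[OF k g(1)] nI by simp
    qed
    show "?v \<in> I"
    proof (rule ccontr)
      assume nI: "?v \<notin> I"
      have "hm (M k) g = ?v \<and> md (M k) g = Idle"
      proof (rule cyclic_invariant[of a b "\<lambda>i. hm (M i) g = ?v \<and> md (M i) g = Idle" "Suc k" k])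
        fix i assume i: "a \<le> i" "i < b" "hm (M i) g = ?v \<and> md (M i) g = Idle"
        have qi: "quiet (pr i) (M i)" using q i by auto
        have "patient_choice (M i) (hm (M i) g) = None" using inI[OF i(1,2) g(1)] i(3) nI by metis
        then show "hm (M (Suc i)) g = ?v \<and> md (M (Suc i)) g = Idle"
          by - (rule quiet_patient[OF qi g], use i in \<open>auto simp: steps\<close>)
      qed (use k sm[OF g] p in auto)
      then show False using l by simp
    qed
  qed
  \<comment> \<open>By \<open>leaveI\<close> an edge into a node outside \<open>I\<close> is never
    crossed, so a trio that once waits for it waits during the whole period.\<close>
  have keep: "hm (M i) g = u \<and> md (M i) g \<noteq> Idle \<and> pt (M i) g = z"
    if k: "a \<le> k" "k \<le> b" "hm (M k) g = u" "md (M k) g \<noteq> Idle" "pt (M k) g = z"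
      and g: "g < 2 * f" "g \<noteq> 0" and v: "nbr u z \<notin> I" and i: "a \<le> i" "i \<le> b" for k i g u z
  proof (rule cyclic_invariant[of a b "\<lambda>i. hm (M i) g = u \<and> md (M i) g \<noteq> Idle \<and> pt (M i) g = z" k i])
    fix j assume j: "a \<le> j" "j < b" "hm (M j) g = u \<and> md (M j) g \<noteq> Idle \<and> pt (M j) g = z"
    have qj: "quiet (pr j) (M j)" using q j by auto
    show "hm (M (Suc j)) g = u \<and> md (M (Suc j)) g \<noteq> Idle \<and> pt (M (Suc j)) g = z"
    proof (rule quiet_patient[OF qj g])
      fix p assume p: "hm (step (pr j) (M j)) g = nbr (hm (M j) g) p" "p < deg (hm (M j) g)"
        "md (M j) g \<noteq> Idle \<and> pt (M j) g = p
       \<or> md (M j) g = Idle \<and> g = Min (idle (M j) (hm (M j) g)) \<and> patient_choice (M j) (hm (M j) g) = Some p"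
      then have e: "hm (M (Suc j)) g = nbr u z" using j by (simp add: steps)
      have "nbr u z \<noteq> u" using nbrD(2)[OF home(1)[OF g(1)], of p j] p j by auto
      then have "hm (M (Suc j)) g \<in> I" using leaveI[OF j(1,2) g] e j by simp
      then show ?thesis using v e by simp
    qed (use j in \<open>auto simp: steps\<close>)
  qed (use k i sm[OF g] in auto)
  have nf: "\<forall>g<2 * f. md (M k) g \<noteq> Found" if "a \<le> k" "k < b" for k
    using q quietD(2)[of "pr k" "M k"] that by auto
  have cl: "nbr u z \<in> I \<or> \<not> pr a {u, nbr u z}" if u: "u \<in> I" and z: "z < deg u" for u z
  proof (rule ccontr)
    assume "\<not> (nbr u z \<in> I \<or> \<not> pr a {u, nbr u z})"
    then have nI: "nbr u z \<notin> I" and op: "pr a {u, nbr u z}" by auto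
    have un: "u < n" "u \<noteq> bh" using u by (auto simp: I_def)
    obtain k1 where k1: "a \<le> k1" "k1 < b" "patient_choice (M k1) u \<noteq> None" using u by (auto simp: I_def)
    have qa: "quiet (pr a) (M a)" using q k1 by auto
    let ?off = "\<lambda>k. offset (deg u) (rot (bd (M k) u)) (avail (deg u) (occ (M k) u) (fresh_board (M k) u))"
    have cover: "\<exists>k\<ge>a. k < b \<and> patient_choice (M k) u \<noteq> None \<and> (\<exists>i\<le>?off k. (rot (bd (M k) u) + i) mod deg u = y)"
      if "y < deg u" for y
    proof (rule rotor_cover[of a b "\<lambda>k. rot (bd (M k) u)"])
      show "rot (bd (M (Suc k)) u) = (if patient_choice (M k) u \<noteq> None then Suc (rot (bd (M k) u) + ?off k) mod deg u
          else rot (bd (M k) u))" for k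
        using rot_step[OF consistent_M un] by (simp add: steps)
      show "rot (bd (M b) u) = rot (bd (M a) u)" using same un by (auto simp: same_patients_def)
      show "rot (bd (M a) u) < deg u" using consistentD(12)[OF consistent_M un] by (simp add: board_ok_def)
    qed (use k1 that in auto)
    have chosen: "y \<notin> unk (deg u) (fresh_board (M k) u)
        \<and> (\<exists>g<2 * f. g \<noteq> 0 \<and> md (M k) g = Idle \<and> (hm (M (Suc k)) g = nbr u y \<or>
             hm (M (Suc k)) g = u \<and> md (M (Suc k)) g \<noteq> Idle \<and> pt (M (Suc k)) g = y) \<and> hm (M k) g = u)"
      if k: "a \<le> k" "k < b" and y: "patient_choice (M k) u = Some y" for k y
    proof
      have qk: "quiet (pr k) (M k)" using q k by auto
      show "y \<notin> unk (deg u) (fresh_board (M k) u)" using quiet_patient_choice[OF qk un y] .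
      let ?g = "Min (idle (M k) u)"
      have "?g \<in> idle (M k) u" using idle_patient y by simp
      then have g: "?g < 2 * f" "?g \<noteq> 0" "md (M k) ?g = Idle" "hm (M k) ?g = u" by (auto simp: idle_def)
      have "hm (M (Suc k)) ?g = nbr u y \<or> hm (M (Suc k)) ?g = u \<and> md (M (Suc k)) ?g \<noteq> Idle \<and> pt (M (Suc k)) ?g = y"
        by (rule quiet_patient[OF qk g(1,2)]) (use g y in \<open>auto simp: steps\<close>)
      then show "\<exists>g<2 * f. g \<noteq> 0 \<and> md (M k) g = Idle \<and> (hm (M (Suc k)) g = nbr u y \<or>
             hm (M (Suc k)) g = u \<and> md (M (Suc k)) g \<noteq> Idle \<and> pt (M (Suc k)) g = y) \<and> hm (M k) g = u"
        using g by blast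
    qed
    have rots: "(rot (bd (M k) u) + ?off k) mod deg u = y" if "patient_choice (M k) u = Some y" for k y
      using that pick_SomeD(1)[of "deg u" "rot (bd (M k) u)" "avail (deg u) (occ (M k) u) (fresh_board (M k) u)" y, OF _ avail_less]
      by (auto simp: patient_choice_def split: if_splits)
    have skipped: "\<not> avail (deg u) (occ (M k) u) (fresh_board (M k) u) ((rot (bd (M k) u) + i) mod deg u)"
      if "i < ?off k" for k i using that unfolding offset_def by (rule not_less_Least)
    obtain k i where k: "a \<le> k" "k < b" "patient_choice (M k) u \<noteq> None" and i: "i \<le> ?off k"
      "(rot (bd (M k) u) + i) mod deg u = z" using cover[OF z] by blast
    show False
    proof (cases "i = ?off k")
      case True
      then have y: "patient_choice (M k) u = Some z" using rots k i by auto
      obtain g where g: "g < 2 * f" "g \<noteq> 0" "md (M k) g = Idle" "hm (M k) g = u"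
        "hm (M (Suc k)) g = nbr u z \<or> hm (M (Suc k)) g = u \<and> md (M (Suc k)) g \<noteq> Idle \<and> pt (M (Suc k)) g = z"
        using chosen[OF k(1,2) y] by blast
      show False
      proof (cases "hm (M (Suc k)) g = nbr u z")
        case True
        then show False
          using leaveI[OF k(1,2) g(1,2)] nI g(4) nbrD(2)[OF un(1) z] by simp
      next
        case False
        then show False using keep[of "Suc k" g u z k] g k nI by auto
      qed
    next
      case False
      then have na: "\<not> avail (deg u) (occ (M k) u) (fresh_board (M k) u) z" using skipped[of i k] i by simp
      show False
      proof (cases "z \<in> occ (M k) u")
        case True
        show False
        proof (cases rule: occ_cases[OF consistent_M[of k] nf[OF k(1,2)] un True])
          case (1 g)
          then have ha: "hm (M a) g = u \<and> md (M a) g \<noteq> Idle \<and> pt (M a) g = z"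
            using keep[of k g u z a] k nI by auto
          have hs: "hm (M (Suc a)) g = u \<and> md (M (Suc a)) g \<noteq> Idle"
            using keep[of k g u z "Suc a"] k nI 1 by auto
          show False
            by (rule quiet_patient[OF qa 1(1,2)]) (use ha hs op in \<open>auto simp: steps far_def\<close>)
        next
          case 2
          then have "stuck (M a) u z" using stuck_const[OF q k(1) _ un z] k by auto
          then show False using stuck_closed[OF qa un z] op by blast
        qed
      next
        case False
        \<comment> \<open>The port was passed over as an unknown port behind \<open>high\<close>.
          Then \<open>low\<close> is a port as well, always available, and when the rotor reaches it
          a patient trio receives an unknown port.\<close>
        then have "high (fresh_board (M k) u) \<le> z" using na z by (auto simp: avail_def unk_def)
        then have l: "low (fresh_board (M k) u) < deg u"
          using z drop_bounds(1)[of "deg u" "occ (M k) u \<union> crossed (M k) u" "bd (M k) u"]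
          by (simp add: fresh_board_def)
        let ?l = "low (fresh_board (M k) u)"
        obtain k' i' where k': "a \<le> k'" "k' < b" "patient_choice (M k') u \<noteq> None" and i': "i' \<le> ?off k'"
          "(rot (bd (M k') u) + i') mod deg u = ?l" using cover[OF l] by blast
        have le: "?l = low (fresh_board (M k') u)" using fresh_board_const(1)[OF q k(1,2) k'(1,2) un] .
        then have av: "avail (deg u) (occ (M k') u) (fresh_board (M k') u) ?l" "?l \<in> unk (deg u) (fresh_board (M k') u)"
          using fresh_low_avail[of "M k'" u] l by auto
        then have "i' = ?off k'" using skipped[of i' k'] i' by (metis le_neq_implies_less)
        then have "patient_choice (M k') u = Some ?l" using rots k' i' by auto
        then show False using chosen[OF k'(1,2)] av by blast
      qed
    qed
  qed
  show False
  proof (rule no_trap[of u0 I a])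
    show "u0 \<in> I" unfolding I_def using ex by blast
  qed (use cl in \<open>auto simp: I_def\<close>)
qed

text \<open>A trio that receives a port moves or ceases to be idle, so constancy excludes choices.
  An idle trio that finds no port sits at a node all of whose ports are occupied and therefore
  blocked, which connectivity forbids; so all patient trios are waiting.\<close>

lemma patients_frozen_closed:
  assumes q: "quiet_on a b" and same: "\<forall>k. a \<le> k \<longrightarrow> k \<le> b \<longrightarrow> same_patients (M a) (M k)"
    and k: "a \<le> k" "k < b"
  shows "\<And>u. u < n \<Longrightarrow> u \<noteq> bh \<Longrightarrow> patient_choice (M k) u = None"
    "\<And>u p. u < n \<Longrightarrow> u \<noteq> bh \<Longrightarrow> p < deg u \<Longrightarrow> p \<in> occ (M k) u \<Longrightarrow> \<not> pr k {u, nbr u p}"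
    "\<And>g. g < 2 * f \<Longrightarrow> g \<noteq> 0 \<Longrightarrow> md (M k) g \<noteq> Idle \<and> hm (M k) g = hm (M a) g \<and> pt (M k) g = pt (M a) g
        \<and> \<not> pr k {hm (M a) g, far (M a) g}"
proof -
  have qk: "quiet (pr k) (M k)" using q k by auto
  have home: "hm (M k) g < n" "hm (M k) g \<noteq> bh" if "g < 2 * f" for k g
    using consistentD(1,2)[OF consistent_M that] by auto
  have sm: "hm (M (Suc k)) g = hm (M k) g" "md (M (Suc k)) g = Idle \<longleftrightarrow> md (M k) g = Idle"
     "hm (M a) g = hm (M k) g" "md (M a) g = Idle \<longleftrightarrow> md (M k) g = Idle"
     "md (M a) g \<noteq> Idle \<Longrightarrow> pt (M a) g = pt (M k) g"
    if "g < 2 * f" "g \<noteq> 0" for g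
  proof -
    have "same_patients (M a) (M k)" "same_patients (M a) (M (Suc k))" using same k by auto
    then show "hm (M (Suc k)) g = hm (M k) g" "md (M (Suc k)) g = Idle \<longleftrightarrow> md (M k) g = Idle"
     "hm (M a) g = hm (M k) g" "md (M a) g = Idle \<longleftrightarrow> md (M k) g = Idle"
     "md (M a) g \<noteq> Idle \<Longrightarrow> pt (M a) g = pt (M k) g"
      using that unfolding same_patients_def by metis+
  qed
  show nc: "patient_choice (M k) u = None" if u: "u < n" "u \<noteq> bh" for u
  proof (rule ccontr)
    assume c: "patient_choice (M k) u \<noteq> None"
    let ?g = "Min (idle (M k) u)"
    have "?g \<in> idle (M k) u" using idle_patient c by simp
    then have g: "?g < 2 * f" "?g \<noteq> 0" "md (M k) ?g = Idle" "hm (M k) ?g = u" by (auto simp: idle_def)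
    show False
    proof (rule quiet_patient[OF qk g(1,2)])
      fix p assume "hm (step (pr k) (M k)) ?g = nbr (hm (M k) ?g) p" "p < deg (hm (M k) ?g)"
      then show False using sm(1)[OF g(1,2)] nbrD(2)[OF home(1)[OF g(1)], of p k] by (simp add: steps)
    qed (use g c sm(1,2)[OF g(1,2)] in \<open>auto simp: steps\<close>)
  qed
  have hold_closed: "\<not> pr k {hm (M k) g, far (M k) g}" if g: "g < 2 * f" "g \<noteq> 0" "md (M k) g \<noteq> Idle" for g
  proof (rule quiet_patient[OF qk g(1,2)])
    fix p assume "hm (step (pr k) (M k)) g = nbr (hm (M k) g) p" "p < deg (hm (M k) g)"
    then show ?thesis using sm(1)[OF g(1,2)] nbrD(2)[OF home(1)[OF g(1)], of p k] by (simp add: steps)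
  qed (use g in auto)
  have nf: "\<forall>g<2 * f. md (M k) g \<noteq> Found" using quietD(2)[OF qk] by auto
  show oc: "\<not> pr k {u, nbr u p}" if u: "u < n" "u \<noteq> bh" and p: "p < deg u" "p \<in> occ (M k) u" for u p
  proof (cases rule: occ_cases[OF consistent_M[of k] nf u p(2)])
    case (1 g)
    then show ?thesis using hold_closed[OF 1(1,2)] by (auto simp: far_def)
  next
    case 2
    then show ?thesis using stuck_closed[OF qk u p(1)] by blast
  qed
  fix g assume g: "g < 2 * f" "g \<noteq> 0"
  have ni: "md (M k) g \<noteq> Idle"
  proof
    assume i: "md (M k) g = Idle"
    let ?u = "hm (M k) g"
    have "idle (M k) ?u \<noteq> {}" using g i by (auto simp: idle_def)
    then have "\<nexists>p. avail (deg ?u) (occ (M k) ?u) (fresh_board (M k) ?u) p"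
      using nc[OF home(1)[OF g(1)] home(2)[OF g(1)], of k] by (simp only: patient_choice_def if_True pick_None not_False_eq_True simp_thms)
    then have all: "p \<in> occ (M k) ?u" if "p < deg ?u" for p
      using avail_exists[OF that] unfolding fresh_board_def by blast
    show False
      by (rule no_trap[of ?u "{?u}" k]) (use home[OF g(1), of k] all oc in auto)
  qed
  then show "md (M k) g \<noteq> Idle \<and> hm (M k) g = hm (M a) g \<and> pt (M k) g = pt (M a) g
        \<and> \<not> pr k {hm (M a) g, far (M a) g}"
    using sm[OF g] hold_closed[OF g] by (auto simp: far_def)
qed

text \<open>Between \<open>c\<close> and \<open>d\<close> the impatient trio walks in a circle and
  its rotors return. The set \<open>J\<close> of visited nodes is closed, because every port of
  \<open>J\<close> was tried, or is blocked for the whole period.\<close>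

lemma frozen_contradiction:
  assumes f: "1 \<le> f" and q: "quiet_on a b" and same: "\<forall>k. a \<le> k \<longrightarrow> k \<le> b \<longrightarrow> same_patients (M a) (M k)"
    and c: "a \<le> c" "c < d" "d \<le> b" and imp: "hm (M c) 0 = hm (M d) 0"
      "\<And>u. u < n \<Longrightarrow> u \<noteq> bh \<Longrightarrow> irot (bd (M c) u) = irot (bd (M d) u)"
  shows False
proof -
  note frozen = patients_frozen_closed[OF q same]
  have z: "0 < 2 * f" using f by simp
  have home: "hm (M k) g < n" "hm (M k) g \<noteq> bh" if "g < 2 * f" for k g
    using consistentD(1,2)[OF consistent_M that] by auto
  define H where "H = (\<lambda>g. (hm (M a) g, pt (M a) g)) ` {1..<2 * f}"
  have pat: "md (M k) g \<noteq> Idle" "hm (M k) g = hm (M a) g" "pt (M k) g = pt (M a) g" "\<not> pr k {hm (M a) g, far (M a) g}"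
    if "a \<le> k" "k < b" "g < 2 * f" "g \<noteq> 0" for k g
    using frozen(3)[OF that(1,2,3,4)] by auto
  have ab: "a < b" using c by simp
  have inj: "inj_on (\<lambda>g. (hm (M a) g, pt (M a) g)) {1..<2 * f}"
  proof (rule inj_onI)
    fix g h assume gh: "g \<in> {1..<2 * f}" "h \<in> {1..<2 * f}" "(hm (M a) g, pt (M a) g) = (hm (M a) h, pt (M a) h)"
    then have "holds g (md (M a) g)" "holds h (md (M a) h)"
      using pat(1)[of a g] pat(1)[of a h] ab by (auto simp: holds_def)
    then show "g = h" using consistentD(6)[OF consistent_M[of a], of g h] gh by auto
  qed
  have cH: "card H = 2 * f - 1" unfolding H_def using card_image[OF inj] by simp
  have fH: "finite H" by (simp add: H_def)
  have Hmiss: "H \<subseteq> missing k" if k: "a \<le> k" "k < b" for k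
  proof
    fix x assume "x \<in> H"
    then obtain g where g: "g < 2 * f" "g \<noteq> 0" "x = (hm (M a) g, pt (M a) g)" by (auto simp: H_def)
    have "pt (M a) g < deg (hm (M a) g)" using consistentD(3)[OF consistent_M[of a] g(1)] pat(1)[of a g] ab g by auto
    then show "x \<in> missing k"
      using pat(4)[OF k g(1,2)] g home[OF g(1)] by (auto simp: missing_def far_def)
  qed
  have Hocc: "p \<in> occ (M k) u" if k: "a \<le> k" "k < b" and x: "(u, p) \<in> H" for k u p
  proof -
    obtain g where g: "g < 2 * f" "g \<noteq> 0" "u = hm (M a) g" "p = pt (M a) g" using x by (auto simp: H_def)
    then show ?thesis using holds_occ[of g "M k"] pat[OF k g(1,2)] by (auto simp: holds_def)
  qed
  \<comment> \<open>\<open>H\<close> has \<open>2 * f - 1\<close> elements, so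
    \<open>missing k\<close> has room for only one more end; its flip is missing too and must lie in
    \<open>H\<close>.\<close>
  have odd: "flip x \<in> H" if k: "a \<le> k" "k < b" and x: "x \<in> missing k" "x \<notin> H" for k x
  proof -
    have "insert x H = missing k"
    proof (rule card_seteq[OF finite_missing])
      show "insert x H \<subseteq> missing k" using Hmiss[OF k] x by auto
      show "card (missing k) \<le> card (insert x H)"
        using card_missing[of k] cH fH x z by simp
    qed
    then show ?thesis using flip_missing[OF x(1)] by blast
  qed
  \<comment> \<open>An edge with an end in \<open>H\<close> is missing throughout. Together with
    \<open>odd\<close>, every edge that is missing at some time is missing all the time.\<close>
  have always: "\<not> pr i {u, nbr u p}" if x: "(u, p) \<in> H \<or> flip (u, p) \<in> H" "u < n" "p < deg u" and i: "a \<le> i" "i < b" for u p i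
  proof -
    have "(u, p) \<in> missing i"
    proof (cases "(u, p) \<in> H")
      case False
      then have "flip (u, p) \<in> missing i" using x Hmiss[OF i] by blast
      moreover have "flip (flip (u, p)) = (u, p)" using nbrD(4,5)[OF x(2,3)] by (simp add: flip_def)
      ultimately show ?thesis using flip_missing by metis
    qed (use Hmiss[OF i] in blast)
    then show ?thesis by (simp add: missing_def)
  qed
  have two: False if k: "a \<le> k" "k < b" and x: "x \<in> missing k" "y \<in> missing k" "x \<notin> H" "y \<notin> H" "x \<noteq> y" for k x y
  proof -
    have "card (insert x (insert y H)) \<le> card (missing k)"
      using Hmiss[OF k] x by (intro card_mono finite_missing) auto
    then show False using card_missing[of k] x fH cH z by simp
  qed
  have quiet: "quiet (pr k) (M k)" if "a \<le> k" "k < b" for k using q that by auto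
  \<comment> \<open>While the scout or tester of trio 0 is away, no patient trio occupies either end
    of its edge, which makes two missing ends outside \<open>H\<close>.\<close>
  have imp_mode: "md (M k) 0 \<notin> {Verify, Recall}" if k: "a \<le> k" "k < b" for k
  proof
    assume m: "md (M k) 0 \<in> {Verify, Recall}"
    let ?x = "(hm (M k) 0, pt (M k) 0)"
    have h0: "holds 0 (md (M k) 0)" "md (M k) 0 \<noteq> Cross" using m by (auto simp: holds_def)
    have d: "pt (M k) 0 < deg (hm (M k) 0)" using consistentD(3)[OF consistent_M z] m by auto
    have mx: "?x \<in> missing k"
      using quiet_holds(4)[OF quiet[OF k] z h0(1)] h0(2) home[OF z] d by (auto simp: missing_def far_def)
    have nx: "?x \<notin> H"
    proof
      assume "?x \<in> H"
      then obtain g where g: "g < 2 * f" "g \<noteq> 0" "hm (M k) 0 = hm (M a) g" "pt (M k) 0 = pt (M a) g" by (auto simp: H_def)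
      then have "holds g (md (M k) g)" using pat(1)[OF k] by (simp add: holds_def)
      then show False using consistentD(6)[OF consistent_M z g(1) h0(1)] pat(2,3)[OF k g(1,2)] g by simp
    qed
    have nfx: "flip ?x \<notin> H"
    proof
      assume "flip ?x \<in> H"
      then obtain g where g: "g < 2 * f" "g \<noteq> 0" "far (M k) 0 = hm (M a) g" "bck (hm (M k) 0) (pt (M k) 0) = pt (M a) g"
        by (auto simp: H_def flip_def far_def)
      then have "holds g (md (M k) g)" using pat(1)[OF k] by (simp add: holds_def)
      moreover have "far (M k) 0 \<noteq> bh" using g home[of g a] by simp
      ultimately show False
        using consistentD(11)[OF consistent_M z g(1), of k] m pat(2,3)[OF k g(1,2)] g by auto
    qed
    show False using two[OF k mx _ nx nfx] flip_missing[OF mx] by auto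
  qed
  have choice: "\<exists>p. imp_choice (M k) (hm (M k) 0) = Some p" if k: "a \<le> k" "k < b" for k
  proof -
    let ?u = "hm (M k) 0"
    have u: "?u < n" "?u \<noteq> bh" using home[OF z] by auto
    have "md (M k) 0 \<in> {Idle, Probe, Cross}"
      using imp_mode[OF k] quietD(2)[OF quiet[OF k] z] by (cases "md (M k) 0") auto
    then have im: "impatient (M k) ?u" by (simp add: impatient_def)
    have "\<exists>p<deg ?u. p \<notin> occ (M k) ?u"
    proof (rule ccontr)
      assume "\<not> ?thesis"
      then have "\<not> pr k {?u, nbr ?u p}" if "p < deg ?u" for p
        using frozen(2)[OF k u that] that by blast
      then show False by (intro no_trap[of ?u "{?u}" k]) (use u in auto)
    qed
    then have "\<exists>p. avail (deg ?u) (occ (M k) ?u) (fresh_board (M k) ?u) p"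
      unfolding fresh_board_def using avail_exists by blast
    then show ?thesis using im frozen(1)[OF k u] by (auto simp: imp_choice_def pick_def)
  qed
  define J where "J = {u. \<exists>k\<ge>c. k < d \<and> hm (M k) 0 = u}"
  have cl: "nbr u y \<in> J \<or> (u, y) \<in> H \<or> flip (u, y) \<in> H \<or> stuck (M a) u y"
    if u: "u \<in> J" and y: "y < deg u" for u y
  proof (rule ccontr)
    assume neg: "\<not> (nbr u y \<in> J \<or> (u, y) \<in> H \<or> flip (u, y) \<in> H \<or> stuck (M a) u y)"
    obtain k1 where k1: "c \<le> k1" "k1 < d" "hm (M k1) 0 = u" using u by (auto simp: J_def)
    have un: "u < n" "u \<noteq> bh" using k1 home[OF z] by auto
    let ?off = "\<lambda>k. offset (deg u) (irot (bd (M k) u)) (avail (deg u) (occ (M k) u) (fresh_board (M k) u))"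
    have nochoice: "imp_choice (M k) u = None" if "hm (M k) 0 \<noteq> u" for k
      using that by (simp add: imp_choice_def impatient_def)
    have cover: "\<exists>k\<ge>c. k < d \<and> hm (M k) 0 = u \<and> (\<exists>i\<le>?off k. (irot (bd (M k) u) + i) mod deg u = y)"
      if "y < deg u" for y
    proof (rule rotor_cover[of c d "\<lambda>k. irot (bd (M k) u)"])
      fix k assume k: "c \<le> k" "k < d"
      show "irot (bd (M (Suc k)) u) = (if hm (M k) 0 = u then Suc (irot (bd (M k) u) + ?off k) mod deg u
          else irot (bd (M k) u))"
        using irot_step[OF consistent_M un, of "pr k" k] choice[of k] nochoice[of k] k c by (auto simp: steps)
    next
      show "irot (bd (M d) u) = irot (bd (M c) u)" using imp(2)[OF un] by simp
      show "irot (bd (M c) u) < deg u" using consistentD(12)[OF consistent_M un] by (simp add: board_ok_def)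
    qed (use k1 that in auto)
    have rots: "(irot (bd (M k) u) + ?off k) mod deg u = y" if "imp_choice (M k) u = Some y" for k y
      using that pick_SomeD(1)[of "deg u" "irot (bd (M k) u)" "avail (deg u) (occ (M k) u) (fresh_board (M k) u)" y, OF _ avail_less]
      by (auto simp: imp_choice_def split: if_splits)
    have skipped: "\<not> avail (deg u) (occ (M k) u) (fresh_board (M k) u) ((irot (bd (M k) u) + i) mod deg u)"
      if "i < ?off k" for k i using that unfolding offset_def by (rule not_less_Least)
    have blocked: "(u, x) \<in> missing k \<and> (u, x) \<notin> H" if k: "c \<le> k" "k < d" "hm (M k) 0 = u" "imp_choice (M k) u = Some x"
       "\<not> pr k {u, nbr u x}" for k x
      using choiceD[of "M k" u x] that Hocc[of k u x] un c by (auto simp: missing_def)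
    obtain k i where k: "c \<le> k" "k < d" "hm (M k) 0 = u" and i: "i \<le> ?off k"
      "(irot (bd (M k) u) + i) mod deg u = y" using cover[OF y] by blast
    have kab: "a \<le> k" "k < b" using k c by auto
    show False
    proof (cases "i = ?off k")
      case True
      obtain x where "imp_choice (M k) u = Some x" using choice[OF kab] k by auto
      then have ch: "imp_choice (M k) u = Some y" using rots True i by auto
      show False
      proof (cases "pr k {u, nbr u y}")
        case True
        then have "hm (M (Suc k)) 0 = nbr u y"
          using quiet_imp(3)[OF quiet[OF kab] imp_mode[OF kab], of y] ch k by (simp add: steps)
        \<comment> \<open>The interval excludes \<open>d\<close>, but arriving at time
          \<open>d\<close> means being at the node visited at time \<open>c\<close>.\<close>
        then have "nbr u y \<in> J"
        proof (cases "Suc k < d")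
          case False
          then have "Suc k = d" using k by simp
          then have "hm (M c) 0 = nbr u y" using \<open>hm (M (Suc k)) 0 = nbr u y\<close> imp(1) by simp
          then show ?thesis using c(2) by (auto simp: J_def)
        next
          case True
          then show ?thesis unfolding J_def using k \<open>hm (M (Suc k)) 0 = nbr u y\<close>
            by (intro CollectI exI[of _ "Suc k"]) simp
        qed
        then show False using neg by blast
      next
        case False
        then have "(u, y) \<in> missing k" "(u, y) \<notin> H" using blocked[OF k ch] by auto
        then show False using odd[OF kab] neg by blast
      qed
    next
      case False
      then have na: "\<not> avail (deg u) (occ (M k) u) (fresh_board (M k) u) y" using skipped[of i k] i by simp
      have nf: "\<forall>g<2 * f. md (M k) g \<noteq> Found" using quietD(2)[OF quiet[OF kab]] by auto
      have no: "y \<notin> occ (M k) u"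
      proof
        assume o: "y \<in> occ (M k) u"
        show False
        proof (cases rule: occ_cases[OF consistent_M[of k] nf un o])
          case (1 g)
          then have "(u, y) \<in> H" using pat(2,3)[OF kab 1(1,2)] by (auto simp: H_def)
          then show False using neg by blast
        next
          case 2
          then show False using stuck_const[OF q kab(1) _ un y] kab neg by auto
        qed
      qed
      let ?l = "low (fresh_board (M k) u)" and ?h = "high (fresh_board (M k) u)"
      \<comment> \<open>A port that is passed over without being occupied is unknown and lies behind
        both candidates. So both are ports, both were tried, and both were found blocked: two
        missing ends outside \<open>H\<close>.\<close>
      have "?h \<le> y" using na no y by (auto simp: avail_def unk_def)
      then have h: "?h < deg u" "?l < ?h" using y fresh_high_avail(3)[of "M k" u] by auto
      have missed: "(u, x) \<in> missing c \<and> (u, x) \<notin> H" if x: "x = ?l \<or> x = ?h" for x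
      proof -
        have xd: "x < deg u" using x h by auto
        obtain k' i' where k': "c \<le> k'" "k' < d" "hm (M k') 0 = u" and i': "i' \<le> ?off k'"
          "(irot (bd (M k') u) + i') mod deg u = x" using cover[OF xd] by blast
        have kab': "a \<le> k'" "k' < b" using k' c by auto
        have e: "?l = low (fresh_board (M k') u)" "?h = high (fresh_board (M k') u)"
          using fresh_board_const[OF q kab kab' un] by auto
        then have av: "avail (deg u) (occ (M k') u) (fresh_board (M k') u) x" "x \<in> unk (deg u) (fresh_board (M k') u)"
          using fresh_low_avail[of "M k'" u] fresh_high_avail[of "M k'" u] x h by auto
        then have "i' = ?off k'" using skipped[of i' k'] i' by (metis le_neq_implies_less)
        moreover obtain x' where "imp_choice (M k') u = Some x'" using choice[OF kab'] k' by auto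
        ultimately have ch: "imp_choice (M k') u = Some x" using rots i' by auto
        have "\<not> pr k' {u, nbr u x}"
          using quiet_imp(2)[OF quiet[OF kab'] imp_mode[OF kab'], of x] ch k' av by auto
        then have m: "(u, x) \<in> missing k'" "(u, x) \<notin> H" using blocked[OF k' ch] by auto
        \<comment> \<open>The two candidates are tried at different times; by \<open>odd\<close> and
          \<open>always\<close> both are also missing at the common time \<open>c\<close>.\<close>
        then have "flip (u, x) \<in> H" using odd[OF kab'] by blast
        then have "\<not> pr c {u, nbr u x}" using always[of u x c] un xd c by auto
        then show ?thesis using m un xd by (simp add: missing_def)
      qed
      show False
        using two[of c "(u, ?l)" "(u, ?h)"] missed[of ?l] missed[of ?h] h c by auto
    qed
  qed
  show False
  proof (rule no_trap[of "hm (M c) 0" J a])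
    show "hm (M c) 0 \<in> J" using c by (auto simp: J_def)
    fix v p assume v: "v \<in> J" "p < deg v"
    then have vn: "v < n" "v \<noteq> bh" using home[OF z] by (auto simp: J_def)
    show "nbr v p \<in> J \<or> \<not> pr a {v, nbr v p}"
      using cl[OF v] always[of v p a] stuck_closed[OF quiet[of a] vn v(2)] ab vn v by auto
  qed (use home[OF z] in \<open>auto simp: J_def\<close>)
qed

text \<open>Without choices an idle trio remains idle. By periodicity no trio can then become idle,
  so none crosses its port.\<close>

lemma patients_still:
  assumes q: "quiet_on a b" and same: "same_patients (M a) (M b)"
    and nc: "\<And>k u. a \<le> k \<Longrightarrow> k < b \<Longrightarrow> u < n \<Longrightarrow> u \<noteq> bh \<Longrightarrow> patient_choice (M k) u = None"
    and k: "a \<le> k" "k \<le> b"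
  shows "same_patients (M a) (M k)"
proof -
  have st: "hm (M (Suc i)) g = hm (M i) g \<and> (md (M (Suc i)) g = Idle \<longleftrightarrow> md (M i) g = Idle)
        \<and> (md (M i) g \<noteq> Idle \<longrightarrow> pt (M (Suc i)) g = pt (M i) g)"
    if i: "a \<le> i" "i < b" and g: "g < 2 * f" "g \<noteq> 0" for i g
  proof -
    have idle_step: "md (M (Suc j)) g = Idle \<and> hm (M (Suc j)) g = hm (M j) g"
      if j: "a \<le> j" "j < b" "md (M j) g = Idle" for j
    proof -
      have qj: "quiet (pr j) (M j)" using q j by auto
      have "patient_choice (M j) (hm (M j) g) = None" using nc[OF j(1,2)] consistentD(1,2)[OF consistent_M g(1)] by blast
      then show ?thesis by - (rule quiet_patient[OF qj g], use j in \<open>auto simp: steps\<close>)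
    qed
    have qi: "quiet (pr i) (M i)" using q i by auto
    show ?thesis
    proof (cases "md (M i) g = Idle")
      case True
      then show ?thesis using idle_step[OF i True] by simp
    next
      case False
      have "md (M (Suc i)) g \<noteq> Idle"
      proof
        assume "md (M (Suc i)) g = Idle"
        then have "md (M i) g = Idle"
          using cyclic_invariant[of a b "\<lambda>j. md (M j) g = Idle" "Suc i" i] idle_step i same g
          by (auto simp: same_patients_def)
        then show False using False by simp
      qed
      then show ?thesis
        by - (rule quiet_patient[OF qi g], use False in \<open>auto simp: steps\<close>)
    qed
  qed
  show ?thesis using k
  proof (induction k rule: dec_induct)
    case base
    then show ?case by (simp add: same_patients_def)
  next
    case (step i)
    have i: "a \<le> i" "i < b" using step by auto
    have "rot (bd (M (Suc i)) u) = rot (bd (M i) u)" if "u < n" "u \<noteq> bh" for u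
      using rot_step[OF consistent_M that, of "pr i" i] nc[OF i that] by (simp add: steps)
    moreover have "same_patients (M a) (M i)" using step by simp
    ultimately show ?case using st[OF i] unfolding same_patients_def by metis
  qed
qed

definition safe :: "nat set" where
  "safe = {u. u < n \<and> u \<noteq> bh}"

lemma safe: "finite safe" "card safe = n - 1"
proof -
  have "safe = {..<n} - {bh}" by (auto simp: safe_def)
  then show "finite safe" "card safe = n - 1" using bh by (auto simp: card_Diff_singleton_if)
qed

definition progress :: "nat \<Rightarrow> nat" where
  "progress k = (\<Sum>x\<in>Sigma safe (\<lambda>u. {..<deg u}). lev (M k) (fst x) (snd x))"

lemma progress_mono: "i \<le> k \<Longrightarrow> progress i \<le> progress k"
proof (induction k rule: dec_induct)
  case (step k)
  have "progress k \<le> progress (Suc k)"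
    unfolding progress_def steps by (intro sum_mono lev_mono consistent_M) (auto simp: safe_def)
  then show ?case using step by simp
qed simp

lemma quiet_if_progress_eq:
  assumes "progress (Suc k) = progress k" "\<forall>g<2 * f. md (M k) g \<noteq> Found \<and> md (M (Suc k)) g \<noteq> Found"
  shows "quiet (pr k) (M k)"
  unfolding quiet_def
proof (intro conjI allI impI)
  show "consistent (M k)" by (rule consistent_M)
  fix u p assume u: "u < n" "u \<noteq> bh" "p < deg u"
  let ?S = "Sigma safe (\<lambda>u. {..<deg u})"
  have "lev (M k) (fst (u, p)) (snd (u, p)) = lev (M (Suc k)) (fst (u, p)) (snd (u, p))"
  proof (rule sum_mono_inv[of "\<lambda>x. lev (M k) (fst x) (snd x)" ?S "\<lambda>x. lev (M (Suc k)) (fst x) (snd x)"])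
    show "(\<Sum>x\<in>?S. lev (M k) (fst x) (snd x)) = (\<Sum>x\<in>?S. lev (M (Suc k)) (fst x) (snd x))"
      using assms(1) by (simp add: progress_def)
    show "lev (M k) (fst x) (snd x) \<le> lev (M (Suc k)) (fst x) (snd x)" if "x \<in> ?S" for x
      unfolding steps using that by (intro lev_mono consistent_M) (auto simp: safe_def)
  qed (use u safe(1) in \<open>auto simp: safe_def\<close>)
  then show "lev (step (pr k) (M k)) u p = lev (M k) u p" by (simp add: steps)
next
  fix g assume "g < 2 * f"
  then show "md (M k) g \<noteq> Found" "md (step (pr k) (M k)) g \<noteq> Found" using assms(2) by (auto simp: steps)
qed

lemma pigeonhole_nat:
  fixes h :: "nat \<Rightarrow> 'a"
  assumes "\<And>i. i \<le> N \<Longrightarrow> h i \<in> S" "finite S" "card S \<le> N"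
  shows "\<exists>i j. i < j \<and> j \<le> N \<and> h i = h j"
proof -
  have "\<not> inj_on h {..N}"
  proof
    assume "inj_on h {..N}"
    then have "card {..N} \<le> card S" using assms(1,2) by (intro card_inj_on_le[of h]) auto
    then show False using assms(3) by simp
  qed
  then obtain i j where "i \<le> N" "j \<le> N" "i \<noteq> j" "h i = h j" by (auto simp: inj_on_def)
  then show ?thesis by (cases "i < j") (metis, metis linorder_neqE_nat)
qed

text \<open>\<open>R\<close> counts the positions of the impatient trio together with the values of
  its rotors. \<open>N\<close> counts the values of the patient rotors together with home and port
  of each of the \<open>2 * f - 1\<close> patient trios, with one extra value for having no port.
  The factor 4 is the top level of a port.\<close>

lemma found_in_time:
  assumes f: "1 \<le> f" and D: "\<And>u. u < n \<Longrightarrow> deg u \<le> D"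
  defines "R \<equiv> (n - 1) * D ^ (n - 1)"
  defines "N \<equiv> D ^ (n - 1) * ((n - 1) * (D + 1)) ^ (2 * f - 1)"
  shows "\<exists>k \<le> (4 * ((n - 1) * D) + 1) * (N * R). \<exists>g<2 * f. md (M k) g = Found"
proof (rule ccontr)
  assume nf': "\<not> ?thesis"
  define B where "B = 4 * ((n - 1) * D)"
  have nf: "md (M k) g \<noteq> Found" if "k \<le> (B + 1) * (N * R)" "g < 2 * f" for k g
    using nf' that by (auto simp: B_def)
  have z: "0 < 2 * f" using f by simp
  have home: "hm (M k) g \<in> safe" if "g < 2 * f" for k g
    using consistentD(1,2)[OF consistent_M that] by (auto simp: safe_def)
  have bound: "progress k \<le> B" for k
  proof -
    have "progress k \<le> (\<Sum>x\<in>Sigma safe (\<lambda>u. {..<deg u}). 4)"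
      unfolding progress_def by (intro sum_mono lev_le)
    also have "\<dots> = 4 * (\<Sum>u\<in>safe. deg u)" using safe(1) by (simp add: card_SigmaI)
    also have "(\<Sum>u\<in>safe. deg u) \<le> (\<Sum>u\<in>safe. D)" using D by (intro sum_mono) (auto simp: safe_def)
    finally show ?thesis using safe(2) by (simp add: B_def)
  qed
  \<comment> \<open>There are \<open>B + 1\<close> blocks of \<open>N * R\<close> steps, and strict
    growth over all of them would exceed the bound \<open>B\<close>.\<close>
  have "\<exists>j\<le>B. progress (j * (N * R)) = progress (Suc j * (N * R))"
  proof (rule ccontr)
    assume "\<not> ?thesis"
    then have neq: "j \<le> B \<Longrightarrow> progress (j * (N * R)) \<noteq> progress (Suc j * (N * R))" for j by blast
    have "j \<le> Suc B \<Longrightarrow> j \<le> progress (j * (N * R))" for j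
    proof (induction j)
      case (Suc j)
      have "progress (j * (N * R)) \<le> progress (Suc j * (N * R))" by (intro progress_mono) simp
      then show ?case using Suc neq[of j] by simp
    qed simp
    from this[of "Suc B"] show False using bound[of "Suc B * (N * R)"] by simp
  qed
  then obtain j where j: "j \<le> B" "progress (j * (N * R)) = progress (Suc j * (N * R))" by blast
  define s where "s = j * (N * R)"
  have "Suc j * (N * R) \<le> (B + 1) * (N * R)" using j(1) by (intro mult_right_mono) auto
  then have sT: "s + N * R \<le> (B + 1) * (N * R)" by (simp add: s_def)
  have q: "quiet_on s (s + N * R)"
  proof (intro allI impI)
    fix k assume k: "s \<le> k" "k < s + N * R"
    have "progress (Suc k) = progress k"
      using progress_mono[of s k] progress_mono[of k "Suc k"] progress_mono[of "Suc k" "s + N * R"] j(2) k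
      by (simp add: s_def add.commute)
    then show "quiet (pr k) (M k)" using nf sT k by (intro quiet_if_progress_eq) auto
  qed
  \<comment> \<open>\<open>D\<close> exceeds all port numbers and so can encode that a trio is
    idle.\<close>
  define key where "key k = (restrict (\<lambda>u. rot (bd (M k) u)) safe,
     restrict (\<lambda>g. (hm (M k) g, if md (M k) g = Idle then D else pt (M k) g)) {1..<2 * f})" for k
  define imp_key where "imp_key k = (hm (M k) 0, restrict (\<lambda>u. irot (bd (M k) u)) safe)" for k
  have rotD: "rot (bd (M k) u) < D" "irot (bd (M k) u) < D" if "u \<in> safe" for k u
    using consistentD(12)[OF consistent_M, of u k] that D[of u] by (auto simp: safe_def board_ok_def)
  have ptD: "pt (M k) g < D" if "g < 2 * f" "md (M k) g \<noteq> Idle" for k g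
    using consistentD(3)[OF consistent_M that] D[OF consistentD(1)[OF consistent_M that(1)]] by (rule less_le_trans)
  let ?K = "(PiE safe (\<lambda>_. {..<D})) \<times> (PiE {1..<2 * f} (\<lambda>_. safe \<times> {..D}))"
  have cK: "card ?K = N" "finite ?K"
    using safe by (auto simp: card_cartesian_product card_PiE N_def intro!: finite_PiE finite_cartesian_product)
  have "key k \<in> ?K" for k
    unfolding key_def using rotD home ptD by (auto simp: less_imp_le)
  \<comment> \<open>The samples are \<open>R\<close> steps apart, so that two equal ones leave
    enough time for a second pigeonhole argument, on the impatient trio.\<close>
  then have "\<exists>i j. i < j \<and> j \<le> N \<and> key (s + i * R) = key (s + j * R)"
    using cK by (intro pigeonhole_nat[of N "\<lambda>i. key (s + i * R)" ?K]) auto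
  then obtain i j where ij: "i < j" "j \<le> N" "key (s + i * R) = key (s + j * R)" by blast
  define a where "a = s + i * R"
  define b where "b = s + j * R"
  have "Suc i * R \<le> j * R" using ij by (intro mult_right_mono) auto
  then have ab: "a + R \<le> b" by (simp add: a_def b_def)
  have "j * R \<le> N * R" using ij by (intro mult_right_mono) auto
  have q': "quiet_on a b"
  proof (intro allI impI)
    fix k assume "a \<le> k" "k < b"
    then have "s \<le> k" "k < s + N * R" using \<open>j * R \<le> N * R\<close> unfolding a_def b_def by linarith+
    then show "quiet (pr k) (M k)" using q by blast
  qed
  have same: "same_patients (M a) (M b)"
  proof -
    have e1: "restrict (\<lambda>u. rot (bd (M a) u)) safe = restrict (\<lambda>u. rot (bd (M b) u)) safe"
      and e2: "restrict (\<lambda>g. (hm (M a) g, if md (M a) g = Idle then D else pt (M a) g)) {1..<2 * f}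
        = restrict (\<lambda>g. (hm (M b) g, if md (M b) g = Idle then D else pt (M b) g)) {1..<2 * f}"
      using ij(3)[folded a_def b_def] unfolding key_def by simp_all
    have "rot (bd (M a) u) = rot (bd (M b) u)" if "u < n" "u \<noteq> bh" for u
      using fun_cong[OF e1, of u] that by (simp add: safe_def)
    moreover have "hm (M a) g = hm (M b) g \<and> (md (M a) g = Idle \<longleftrightarrow> md (M b) g = Idle) \<and> (md (M a) g \<noteq> Idle \<longrightarrow> pt (M a) g = pt (M b) g)"
      if "g < 2 * f" "g \<noteq> 0" for g
      using fun_cong[OF e2, of g] that ptD[of g a] ptD[of g b] by (auto split: if_splits)
    ultimately show ?thesis by (simp add: same_patients_def)
  qed
  have R0: "0 < R"
    using n2 rotD[of "hm (M 0) 0" 0] home[OF z, of 0] by (auto simp: R_def)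
  show False
  proof (cases "\<exists>k u. a \<le> k \<and> k < b \<and> u < n \<and> u \<noteq> bh \<and> patient_choice (M k) u \<noteq> None")
    case True
    then show False using patient_closure[OF q' same] by blast
  next
    case False
    then have still: "\<forall>k. a \<le> k \<longrightarrow> k \<le> b \<longrightarrow> same_patients (M a) (M k)"
      using patients_still[OF q' same] by blast
    let ?L = "safe \<times> PiE safe (\<lambda>_. {..<D})"
    have cL: "card ?L = R" "finite ?L"
      using safe by (auto simp: card_cartesian_product card_PiE R_def intro!: finite_PiE finite_cartesian_product)
    have "imp_key k \<in> ?L" for k unfolding imp_key_def using rotD home[OF z] by auto
    then have "\<exists>i j. i < j \<and> j \<le> R \<and> imp_key (a + i) = imp_key (a + j)"
      using cL by (intro pigeonhole_nat[of R "\<lambda>i. imp_key (a + i)" ?L]) auto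
    then obtain i j where i: "i < j" "j \<le> R" "imp_key (a + i) = imp_key (a + j)" by blast
    have e: "restrict (\<lambda>u. irot (bd (M (a + i)) u)) safe = restrict (\<lambda>u. irot (bd (M (a + j)) u)) safe"
      using i(3) by (simp add: imp_key_def)
    have "irot (bd (M (a + i)) u) = irot (bd (M (a + j)) u)" if "u < n" "u \<noteq> bh" for u
      using fun_cong[OF e, of u] that by (simp add: safe_def)
    then show False
      using frozen_contradiction[OF f q' still, of "a + i" "a + j"] i ab by (auto simp: imp_key_def)
  qed
qed

end

section \<open>Executions of the concrete algorithm\<close>

definition seen :: "'x set \<Rightarrow> ('x \<Rightarrow> memory) \<Rightarrow> ('x \<Rightarrow> nat) \<Rightarrow> nat \<Rightarrow> memory set" where
  "seen X mm pos u = mm ` {x \<in> X. pos x = u}"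

text \<open>The agents \<open>a < k\<close> play the parts \<open>\<beta> a\<close>, where the part \<open>x\<close> is located at \<open>pos x\<close> (at the
  black hole if destroyed), with memory \<open>mm x\<close> and report \<open>rp x\<close>.\<close>

definition fits :: "nat \<Rightarrow> 'x set \<Rightarrow> nat \<Rightarrow> (nat \<Rightarrow> 'x) \<Rightarrow> ('x \<Rightarrow> nat) \<Rightarrow> ('x \<Rightarrow> memory)
    \<Rightarrow> ('x \<Rightarrow> nat list option) \<Rightarrow> (nat \<Rightarrow> board) \<Rightarrow> cfg \<Rightarrow> bool" where
  "fits bh X k \<beta> pos mm rp w C \<longleftrightarrow>
     \<beta> ` {..<k} = X
   \<and> (\<forall>a<k. c_pos C a = pos (\<beta> a) \<and> c_alive C a = (pos (\<beta> a) \<noteq> bh) \<and> c_rep C a = rp (\<beta> a)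
        \<and> (pos (\<beta> a) \<noteq> bh \<longrightarrow> c_mem C a = enc_mem (mm (\<beta> a))))
   \<and> (\<forall>u. c_wb C u = enc_board (w u))"

lemma fits_view:
  assumes fit: "fits bh X k \<beta> pos mm rp w C" and a: "a < k" "pos (\<beta> a) \<noteq> bh"
  shows "a_step bhs_algo (view_of k deg C a) =
    (case act (mm (\<beta> a)) (seen X mm pos (pos (\<beta> a))) (w (pos (\<beta> a))) (deg (pos (\<beta> a))) (c_entry C a) (c_lastok C a) of
       (m, mv, w', rep) \<Rightarrow> (enc_mem m, mv, enc_board w', rep))"
proof -
  let ?V = "view_of k deg C a" and ?u = "pos (\<beta> a)"
  have ag: "c_pos C b = pos (\<beta> b)" "c_alive C b = (pos (\<beta> b) \<noteq> bh)"
     "pos (\<beta> b) \<noteq> bh \<Longrightarrow> dec_mem (c_mem C b) = mm (\<beta> b)" if "b < k" for b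
    using fit that by (auto simp: fits_def)
  have im: "\<beta> ` {..<k} = X" using fit by (simp add: fits_def)
  have me: "dec_mem (v_mem ?V) = mm (\<beta> a)" using ag(3)[OF a] by (simp add: view_of_def Let_def)
  let ?S = "{b. b < k \<and> b \<noteq> a \<and> c_alive C b \<and> c_pos C b = c_pos C a}"
  have "(\<lambda>x. dec_mem (fst x)) ` set_mset (v_others ?V) = (\<lambda>b. dec_mem (c_mem C b)) ` ?S"
    by (simp add: view_of_def Let_def image_image)
  also have "insert (mm (\<beta> a)) ((\<lambda>b. dec_mem (c_mem C b)) ` ?S) = seen X mm pos ?u"
  proof (intro equalityI subsetI)
    fix m assume "m \<in> insert (mm (\<beta> a)) ((\<lambda>b. dec_mem (c_mem C b)) ` ?S)"
    then consider "m = mm (\<beta> a)" | b where "b < k" "c_alive C b" "c_pos C b = c_pos C a" "m = dec_mem (c_mem C b)"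
      by blast
    then show "m \<in> seen X mm pos ?u"
    proof cases
      case 1
      then show ?thesis using im a by (auto simp: seen_def)
    next
      case 2
      then have "m = mm (\<beta> b)" "pos (\<beta> b) = ?u" using ag[OF 2(1)] ag(1)[OF a(1)] by auto
      then show ?thesis using im 2(1) by (auto simp: seen_def)
    qed
  next
    fix m assume "m \<in> seen X mm pos ?u"
    then obtain b where b: "b < k" "m = mm (\<beta> b)" "pos (\<beta> b) = ?u" using im by (auto simp: seen_def)
    then have "dec_mem (c_mem C b) = m" "c_alive C b" "c_pos C b = c_pos C a"
      using ag[OF b(1)] ag(1)[OF a(1)] a(2) by auto
    then show "m \<in> insert (mm (\<beta> a)) ((\<lambda>b. dec_mem (c_mem C b)) ` ?S)"
      using b by (cases "b = a") (simp, blast)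
  qed
  finally have L: "insert (mm (\<beta> a)) ((\<lambda>x. dec_mem (fst x)) ` set_mset (v_others ?V)) = seen X mm pos ?u" .
  have "v_wb ?V = enc_board (w ?u)" "v_deg ?V = deg ?u" "v_entry ?V = c_entry C a" "v_lastok ?V = c_lastok C a"
    using fit a ag(1)[OF a(1)] by (auto simp: view_of_def Let_def fits_def)
  then show ?thesis
    unfolding bhs_algo_def algo.simps Let_def me L by simp
qed

lemma next_cfg_sel:
  fixes alg deg nbr bck bh k ids pres C
  defines "C' \<equiv> next_cfg alg deg nbr bck bh k ids pres C"
  assumes s: "a_step alg (view_of k deg C a) = (m, mv, w, rep)"
  shows "c_mem C' a = (if active C a then m else c_mem C a)"
    "c_rep C' a = (if active C a then rep else c_rep C a)"
    "c_pos C' a = (if active C a \<and> rep = None then (case try_move deg nbr bck pres (c_pos C a) mv of None \<Rightarrow> c_pos C a | Some (u, q) \<Rightarrow> u) else c_pos C a)"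
    "c_alive C' a = (if active C a \<and> rep = None then (case try_move deg nbr bck pres (c_pos C a) mv of None \<Rightarrow> True | Some (u, q) \<Rightarrow> u \<noteq> bh) else c_alive C a)"
    "c_entry C' a = (if active C a \<and> rep = None then (case try_move deg nbr bck pres (c_pos C a) mv of None \<Rightarrow> c_entry C a | Some (u, q) \<Rightarrow> Some q) else c_entry C a)"
    "c_lastok C' a = (if active C a \<and> rep = None then mv = None \<or> try_move deg nbr bck pres (c_pos C a) mv \<noteq> None else c_lastok C a)"
  unfolding C'_def next_cfg_def Let_def cfg.simps s prod.sel by (rule refl)+

lemma next_cfg_wb:
  "c_wb (next_cfg alg deg nbr bck bh k ids pres C) v =
     (if \<exists>a. writer k ids C v a
      then fst (snd (snd (a_step alg (view_of k deg C (THE a. writer k ids C v a))))) else c_wb C v)"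
  unfolding next_cfg_def Let_def cfg.simps by (rule refl)

text \<open>The new board \<open>w'\<close> is a function of the node: all active agents at a node
  write the same, whichever of them is the writer. Where no active agent is present, the board has
  to remain as it was.\<close>

lemma fits_next:
  fixes nbr bck :: "nat \<Rightarrow> nat \<Rightarrow> nat" and pres :: "nat set \<Rightarrow> bool" and \<beta> :: "nat \<Rightarrow> 'x"
  assumes fit: "fits bh X k \<beta> pos mm rp w C" and ids: "inj_on ids {..<k}"
    and out: "\<forall>a<k. pos (\<beta> a) \<noteq> bh \<longrightarrow> rp (\<beta> a) = None \<longrightarrow>
      act (mm (\<beta> a)) (seen X mm pos (pos (\<beta> a))) (w (pos (\<beta> a))) (deg (pos (\<beta> a))) (c_entry C a) (c_lastok C a)
        = (mm' (\<beta> a), mv (\<beta> a), w' (pos (\<beta> a)), rp' (\<beta> a))"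
    and same: "\<forall>u. (\<forall>x\<in>X. pos x = u \<longrightarrow> u \<noteq> bh \<longrightarrow> rp x \<noteq> None) \<longrightarrow> w' u = w u"
  defines "C' \<equiv> next_cfg bhs_algo deg nbr bck bh k ids pres C"
  shows "\<And>u. c_wb C' u = enc_board (w' u)"
    "\<And>a. a < k \<Longrightarrow> \<not> (pos (\<beta> a) \<noteq> bh \<and> rp (\<beta> a) = None) \<Longrightarrow> c_pos C' a = c_pos C a \<and> c_mem C' a = c_mem C a
        \<and> c_alive C' a = c_alive C a \<and> c_rep C' a = c_rep C a"
    "\<And>a. a < k \<Longrightarrow> pos (\<beta> a) \<noteq> bh \<Longrightarrow> rp (\<beta> a) = None \<Longrightarrow>
        c_mem C' a = enc_mem (mm' (\<beta> a)) \<and> c_rep C' a = rp' (\<beta> a)"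
    "\<And>a. a < k \<Longrightarrow> pos (\<beta> a) \<noteq> bh \<Longrightarrow> rp (\<beta> a) = None \<Longrightarrow> rp' (\<beta> a) \<noteq> None \<or> try_move deg nbr bck pres (pos (\<beta> a)) (mv (\<beta> a)) = None \<Longrightarrow>
        c_pos C' a = pos (\<beta> a) \<and> c_alive C' a"
    "\<And>a. a < k \<Longrightarrow> pos (\<beta> a) \<noteq> bh \<Longrightarrow> rp (\<beta> a) = None \<Longrightarrow> rp' (\<beta> a) = None \<Longrightarrow>
        c_lastok C' a = (mv (\<beta> a) = None \<or> try_move deg nbr bck pres (pos (\<beta> a)) (mv (\<beta> a)) \<noteq> None)"
    "\<And>a v q. a < k \<Longrightarrow> pos (\<beta> a) \<noteq> bh \<Longrightarrow> rp (\<beta> a) = None \<Longrightarrow> rp' (\<beta> a) = None \<Longrightarrow>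
        try_move deg nbr bck pres (pos (\<beta> a)) (mv (\<beta> a)) = Some (v, q) \<Longrightarrow>
        c_pos C' a = v \<and> c_alive C' a = (v \<noteq> bh) \<and> c_entry C' a = Some q"
proof -
  have im: "\<beta> ` {..<k} = X" using fit by (simp add: fits_def)
  have ag: "c_pos C a = pos (\<beta> a)" "active C a \<longleftrightarrow> pos (\<beta> a) \<noteq> bh \<and> rp (\<beta> a) = None" if "a < k" for a
    using fit that by (auto simp: fits_def active_def)
  have st: "a_step bhs_algo (view_of k deg C a) = (enc_mem (mm' (\<beta> a)), mv (\<beta> a), enc_board (w' (pos (\<beta> a))), rp' (\<beta> a))"
    if "a < k" "active C a" for a
  proof -
    have x: "pos (\<beta> a) \<noteq> bh" "rp (\<beta> a) = None" using ag(2)[OF that(1)] that(2) by auto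
    show ?thesis using fits_view[OF fit that(1) x(1), of deg] unfolding out[rule_format, OF that(1) x] by simp
  qed
  show "c_wb C' u = enc_board (w' u)" for u
  proof (cases "\<exists>a<k. active C a \<and> c_pos C a = u")
    case True
    let ?A = "{a. a < k \<and> active C a \<and> c_pos C a = u}"
    have fin: "finite (ids ` ?A)" "ids ` ?A \<noteq> {}" using True by auto
    from Min_in[OF fin] obtain a where a: "a \<in> ?A" "ids a = Min (ids ` ?A)" by (elim imageE) simp
    have lt: "ids a < ids b" if "b \<in> ?A" "b \<noteq> a" for b
    proof -
      have "ids a \<le> ids b" unfolding a(2) using that(1) fin(1) by (intro Min_le imageI)
      moreover have "ids a \<noteq> ids b" using inj_onD[OF ids, of a b] that a(1) by auto
      ultimately show ?thesis by simp
    qed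
    have wr: "writer k ids C u a" using a(1) lt by (auto simp: writer_def)
    have un: "b = a" if "writer k ids C u b" for b
      using that wr unfolding writer_def by (metis less_asym)
    have the: "(THE b. writer k ids C u b) = a" using wr un by (rule the_equality)
    have "\<exists>a. writer k ids C u a" using wr by blast
    moreover have "pos (\<beta> a) = u" using a(1) ag(1) by auto
    moreover have "a < k" "active C a" using a(1) by auto
    ultimately show ?thesis
      unfolding C'_def next_cfg_wb the using st[of a] by simp
  next
    case False
    then have "\<nexists>b. writer k ids C u b" by (auto simp: writer_def)
    then have "c_wb C' u = c_wb C u" unfolding C'_def next_cfg_wb by (rule if_not_P)
    also have "\<dots> = enc_board (w u)" using fit by (simp add: fits_def)
    also have "w u = w' u"
    proof (rule sym, rule same[rule_format])
      fix x assume "x \<in> X" "pos x = u" "u \<noteq> bh"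
      then obtain a where "a < k" "\<beta> a = x" using im by auto
      then show "rp x \<noteq> None" using False ag[of a] \<open>pos x = u\<close> \<open>u \<noteq> bh\<close> by auto
    qed
    finally show ?thesis .
  qed
  show "c_pos C' a = c_pos C a \<and> c_mem C' a = c_mem C a \<and> c_alive C' a = c_alive C a \<and> c_rep C' a = c_rep C a"
    if "a < k" "\<not> (pos (\<beta> a) \<noteq> bh \<and> rp (\<beta> a) = None)" for a
  proof -
    obtain m mv w rep where s: "a_step bhs_algo (view_of k deg C a) = (m, mv, w, rep)" by (metis surj_pair)
    show ?thesis using ag(2)[OF that(1)] that(2) unfolding C'_def next_cfg_sel[OF s] by simp
  qed
  fix a assume a: "a < k" "pos (\<beta> a) \<noteq> bh" "rp (\<beta> a) = None"
  then have ac: "active C a" using ag(2) by simp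
  note sel = next_cfg_sel[OF st[OF a(1) ac], of nbr bck bh ids pres, folded C'_def]
  show "c_mem C' a = enc_mem (mm' (\<beta> a)) \<and> c_rep C' a = rp' (\<beta> a)"
    unfolding sel using ac by simp
  show "rp' (\<beta> a) \<noteq> None \<or> try_move deg nbr bck pres (pos (\<beta> a)) (mv (\<beta> a)) = None \<Longrightarrow> c_pos C' a = pos (\<beta> a) \<and> c_alive C' a"
    unfolding sel ag(1)[OF a(1)] using ac by (auto simp: active_def)
  show "rp' (\<beta> a) = None \<Longrightarrow> c_lastok C' a = (mv (\<beta> a) = None \<or> try_move deg nbr bck pres (pos (\<beta> a)) (mv (\<beta> a)) \<noteq> None)"
    unfolding sel ag(1)[OF a(1)] using ac by simp
  fix v q
  show "rp' (\<beta> a) = None \<Longrightarrow> try_move deg nbr bck pres (pos (\<beta> a)) (mv (\<beta> a)) = Some (v, q) \<Longrightarrow>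
      c_pos C' a = v \<and> c_alive C' a = (v \<noteq> bh) \<and> c_entry C' a = Some q"
    unfolding sel ag(1)[OF a(1)] using ac by simp
qed

section \<open>Simulation of an abstract step by three rounds\<close>

context trios begin

definition away :: "state \<Rightarrow> nat \<Rightarrow> role \<Rightarrow> bool" where
  "away M g r \<longleftrightarrow> md M g = Verify \<and> r = Scout \<or> md M g = Recall \<and> r = Tester"

definition entry :: "state \<Rightarrow> nat \<Rightarrow> role \<Rightarrow> nat" where
  "entry M g r = (if away M g r then bck (hm M g) (pt M g) else 0)"

text \<open>The clock of a trio in mode \<open>Found\<close> is frozen at 0, because its keeper
  terminates when it resolves and has just reset its clock.\<close>

definition mem_at :: "nat \<Rightarrow> state \<Rightarrow> nat \<times> role \<Rightarrow> memory" where
  "mem_at c M = (\<lambda>(g, r). Agent (if md M g = Found then 0 else c) g r (md M g) (pt M g) (entry M g r) False)"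

definition report :: "state \<Rightarrow> nat \<times> role \<Rightarrow> nat list option" where
  "report M = (\<lambda>(g, r). if md M g = Found \<and> r = Keeper then Some [pt M g] else None)"

abbreviation "parts \<equiv> {..<G} \<times> (UNIV :: role set)"
abbreviation "place M \<equiv> (\<lambda>(g, r). loc M g r)"

lemma loc_Keeper [simp]: "loc M g Keeper = hm M g"
  by (simp add: loc_def)

lemma seen_mem:
  assumes u: "u \<noteq> bh"
  shows "occ_of (seen parts (mem_at c M) (place M) u) = occ M u"
    "crossed_of (seen parts (mem_at c M) (place M) u) = crossed M u"
    "idle_of (seen parts (mem_at c M) (place M) u) = idle M u"
    "imp_of (seen parts (mem_at c M) (place M) u) = impatient M u"
proof -
  have mem: "Agent c' g r m p e b \<in> seen parts (mem_at c M) (place M) u \<longleftrightarrow>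
     g < G \<and> loc M g r = u \<and> c' = (if md M g = Found then 0 else c) \<and> m = md M g \<and> p = pt M g \<and> e = entry M g r \<and> b = False" for c' g r m p e b
    by (auto simp: seen_def mem_at_def image_iff)
  have z: "0 < G" using G by simp
  show "occ_of (seen parts (mem_at c M) (place M) u) = occ M u"
  proof -
    have "occ_of (seen parts (mem_at c M) (place M) u) =
        {pt M g |g. g < G \<and> holds g (md M g) \<and> hm M g = u} \<union> {entry M g Scout |g. g < G \<and> loc M g Scout = u \<and> md M g = Verify}
        \<union> {entry M g Tester |g. g < G \<and> loc M g Tester = u \<and> md M g = Recall}"
      unfolding occ_of_def mem by auto
    also have "\<dots> = occ M u"
      unfolding occ_def Un_assoc by (rule arg_cong2[of _ _ _ _ "(\<union>)"]) (auto simp: entry_def away_def loc_def)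
    finally show ?thesis .
  qed
  show "crossed_of (seen parts (mem_at c M) (place M) u) = crossed M u"
    unfolding crossed_of_def mem crossed_def using z by auto
  show "idle_of (seen parts (mem_at c M) (place M) u) = idle M u"
    unfolding idle_of_def mem idle_def by auto
  show "imp_of (seen parts (mem_at c M) (place M) u) = impatient M u"
    unfolding imp_of_def mem impatient_def using z by auto
qed

lemma loc_planned: "g < G \<Longrightarrow> loc (planned M) g r = loc M g r"
  by (rule assign_cases[of g M]) (auto simp: loc_def port_mode_def split: if_splits)

lemma found_planned: "g < G \<Longrightarrow> md (planned M) g = Found \<longleftrightarrow> md M g = Found"
  by (rule assign_cases[of g M]) (auto simp: port_mode_def split: if_splits)

lemma entry_planned: "g < G \<Longrightarrow> entry (planned M) g r = entry M g r"
  by (rule assign_cases[of g M]) (auto simp: entry_def away_def port_mode_def split: if_splits)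

lemma loc_home_or_away: "loc M g r \<noteq> bh \<Longrightarrow> loc M g r = (if away M g r then far M g else hm M g)"
  by (auto simp: loc_def away_def far_def)

lemma plan_round:
  assumes M: "consistent M" and g: "g < G" and alive: "loc M g r \<noteq> bh" and nr: "report M (g, r) = None"
  shows "act (mem_at 0 M (g, r)) (seen parts (mem_at 0 M) (place M) (loc M g r)) (bd M (loc M g r)) (deg (loc M g r)) en ok
    = (mem_at 1 (planned M) (g, r), attempt r (md (planned M) g) (pt (planned M) g) (entry (planned M) g r),
       bd (planned M) (loc M g r), None)"
proof -
  let ?u = "loc M g r"
  have nF: "md M g \<noteq> Found" using alive nr by (cases r) (auto simp: loc_def report_def)
  have lv: "lively M ?u" unfolding lively_def using alive g nF by blast
  have as: "assigned (deg ?u) (bd M ?u) (occ M ?u) (crossed M ?u) (idle M ?u) (impatient M ?u) g (md M g) (pt M g) = assign M g"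
  \<comment> \<open>An agent away from home evaluates the data of a foreign node, but in
    \<open>Verify\<close> and \<open>Recall\<close> mode and port are kept whatever these data
    are.\<close>
  proof (cases "away M g r")
    case True
    then have "md M g = Verify \<or> md M g = Recall" by (auto simp: away_def)
    then show ?thesis by (auto simp: assign_def assigned_def Let_def split: prod.splits)
  next
    case False
    then have "?u = hm M g" using loc_home_or_away[OF alive] by simp
    then show ?thesis by (simp add: assign_def)
  qed
  have pl: "fst (plan (deg ?u) (bd M ?u) (occ M ?u) (crossed M ?u) (idle M ?u \<noteq> {}) (impatient M ?u)) = bd (planned M) ?u"
    using lv by (simp add: plan_at_def)
  have fp: "md (planned M) g \<noteq> Found" using nF found_planned[OF g] by blast
  have m0: "mem_at 0 M (g, r) = Agent 0 g r (md M g) (pt M g) (entry M g r) False" using nF by (simp add: mem_at_def)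
  have m1: "mem_at 1 (planned M) (g, r) = Agent 1 g r (fst (assign M g)) (snd (assign M g)) (entry M g r) False"
    using fp entry_planned[OF g] by (simp add: mem_at_def)
  show ?thesis
    unfolding m0 m1 act_def memory.case Let_def seen_mem[OF alive] as pl
    using entry_planned[OF g, of M r] by (simp add: case_prod_beta)
qed

definition went :: "(nat set \<Rightarrow> bool) \<Rightarrow> state \<Rightarrow> nat \<Rightarrow> role \<Rightarrow> bool" where
  "went pr P g r \<longleftrightarrow> attempt r (md P g) (pt P g) (entry P g r) \<noteq> None \<and> loc P g r \<noteq> bh \<and> open_for pr P g"

definition arrival :: "state \<Rightarrow> nat \<Rightarrow> role \<Rightarrow> nat" where
  "arrival P g r = (if away P g r then pt P g else bck (hm P g) (pt P g))"

definition new_place :: "(nat set \<Rightarrow> bool) \<Rightarrow> state \<Rightarrow> nat \<times> role \<Rightarrow> nat" where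
  "new_place pr P = (\<lambda>(g, r). if went pr P g r then (if away P g r then hm P g else far P g) else loc P g r)"

lemma attempt_move:
  assumes P: "mid P" and g: "g < G" and alive: "loc P g r \<noteq> bh"
  shows "try_move deg nbr bck pr (loc P g r) (attempt r (md P g) (pt P g) (entry P g r)) =
     (if went pr P g r then Some (if away P g r then hm P g else far P g, arrival P g r) else None)"
proof (cases "attempt r (md P g) (pt P g) (entry P g r)")
  case None
  then show ?thesis by (simp add: try_move_def went_def)
next
  case (Some q)
  then have ni: "md P g \<noteq> Idle" by (auto simp: attempt_def)
  have h: "hm P g < n" "pt P g < deg (hm P g)" using midD(1,3)[OF P g] ni by auto
  note nb = nbrD[OF h]
  show ?thesis
  proof (cases "away P g r")
    case True
    then have "q = bck (hm P g) (pt P g)" using Some by (auto simp: away_def attempt_def entry_def)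
    then show ?thesis
      using Some True nb loc_home_or_away[OF alive] alive
      by (simp add: try_move_def went_def arrival_def far_def open_for_def insert_commute)
  next
    case False
    then have "q = pt P g" using Some by (auto simp: away_def attempt_def split: mode.splits role.splits if_splits)
    then show ?thesis
      using Some False h loc_home_or_away[OF alive] alive
      by (simp add: try_move_def went_def arrival_def far_def open_for_def)
  qed
qed

definition mem_moved :: "(nat set \<Rightarrow> bool) \<Rightarrow> state \<Rightarrow> nat \<times> role \<Rightarrow> memory" where
  "mem_moved pr P = (\<lambda>(g, r). Agent (if md P g = Found then 0 else 2) g r (md P g) (pt P g)
      (if went pr P g r then arrival P g r else entry P g r) (went pr P g r))"

lemma announce_round:
  assumes g: "g < G" and nF: "md P g \<noteq> Found"
    and ok: "ok = (attempt r (md P g) (pt P g) (entry P g r) = None \<or> went pr P g r)"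
    and en: "went pr P g r \<Longrightarrow> en = Some (arrival P g r)"
  shows "act (mem_at 1 P (g, r)) L w d en ok = (mem_moved pr P (g, r), None, w, None)"
proof -
  have w: "went pr P g r \<Longrightarrow> attempt r (md P g) (pt P g) (entry P g r) \<noteq> None" by (simp add: went_def)
  show ?thesis
    using nF ok en w by (auto simp: act_def mem_at_def mem_moved_def Let_def)
qed

text \<open>After an exchange each scout continues as the scout of the trio at whose home it has
  arrived. It is the casting of agents that changes, while the abstract trios stay where they
  are.\<close>

definition swap :: "(nat set \<Rightarrow> bool) \<Rightarrow> state \<Rightarrow> nat \<times> role \<Rightarrow> nat \<times> role" where
  "swap pr P = (\<lambda>(g, r). (if r = Scout \<and> md P g = Probe \<and> open_for pr P g \<and> exchange P g \<noteq> {}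
      then Min (exchange P g) else g, r))"

text \<open>A port belongs to at most one trio, so exchanges match trios in pairs across an
  edge.\<close>

lemma exchange_sym:
  assumes P: "mid P" and g: "g < G" "md P g = Probe" and h: "h \<in> exchange P g"
  shows "exchange P g = {h}" "exchange P h = {g}" "h < G" "md P h = Probe" "hm P h = far P g"
    "pt P h = bck (hm P g) (pt P g)" "far P h = hm P g" "pt P g = bck (hm P h) (pt P h)"
    "open_for pr P h = open_for pr P g"
proof -
  show a: "h < G" "md P h = Probe" "hm P h = far P g" "pt P h = bck (hm P g) (pt P g)"
    using h by (auto simp: exchange_def)
  have hg: "hm P g < n" "pt P g < deg (hm P g)" using midD(1,3)[OF P g(1)] g(2) by auto
  show b: "far P h = hm P g" "pt P g = bck (hm P h) (pt P h)"
    using a nbrD(4,5)[OF hg] by (auto simp: far_def)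
  show "exchange P g = {h}"
    using h a midD(6)[OF P] by (auto simp: exchange_def)
  show "exchange P h = {g}"
    using g a b midD(6)[OF P] unfolding exchange_def by (auto; metis mode.distinct(1))
  show "open_for pr P h = open_for pr P g" using a b by (simp add: open_for_def insert_commute)
qed

text \<open>Applying \<open>swap\<close> twice restores every part.\<close>

lemma swap_parts:
  assumes P: "mid P" shows "swap pr P ` parts = parts"
proof
  show "swap pr P ` parts \<subseteq> parts"
  proof
    fix x assume "x \<in> swap pr P ` parts"
    then obtain g r where gr: "g < G" "x = swap pr P (g, r)" by auto
    show "x \<in> parts"
    proof (cases "md P g = Probe \<and> exchange P g \<noteq> {}")
      case True
      then have "Min (exchange P g) \<in> exchange P g" by (intro Min_in) (auto simp: exchange_def)
      then show ?thesis using gr by (auto simp: swap_def exchange_def)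
    qed (use gr in \<open>auto simp: swap_def\<close>)
  qed
  show "parts \<subseteq> swap pr P ` parts"
  proof
    fix x assume x: "x \<in> parts"
    obtain g r where gr: "x = (g, r)" "g < G" using x by auto
    show "x \<in> swap pr P ` parts"
    proof (cases "r = Scout \<and> md P g = Probe \<and> open_for pr P g \<and> exchange P g \<noteq> {}")
      case True
      then obtain h where h: "h \<in> exchange P g" by blast
      note e = exchange_sym[OF P gr(2) _ h]
      have "swap pr P (h, r) = x"
        using True gr e by (simp add: swap_def)
      then show ?thesis using e(3) True by (intro image_eqI[of _ _ "(h, r)"]) auto
    next
      case False
      then have "swap pr P (g, r) = x" using gr by (auto simp: swap_def)
      then show ?thesis using x gr by (metis image_eqI)
    qed
  qed
qed


lemma new_place_cases:
  assumes P: "mid P" and g: "g < G"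
  shows "md P g = Idle \<Longrightarrow> \<not> went pr P g r \<and> new_place pr P (g, r) = hm P g"
    "md P g = Probe \<Longrightarrow> went pr P g Scout = open_for pr P g
       \<and> new_place pr P (g, Scout) = (if open_for pr P g then far P g else hm P g)"
    "md P g = Probe \<Longrightarrow> r \<noteq> Scout \<Longrightarrow> \<not> went pr P g r \<and> new_place pr P (g, r) = hm P g"
    "md P g = Verify \<Longrightarrow> went pr P g Scout = (far P g \<noteq> bh \<and> open_for pr P g)
       \<and> new_place pr P (g, Scout) = (if far P g \<noteq> bh \<and> open_for pr P g then hm P g else far P g)"
    "md P g = Verify \<Longrightarrow> went pr P g Tester = open_for pr P g
       \<and> new_place pr P (g, Tester) = (if open_for pr P g then far P g else hm P g)"
    "md P g = Verify \<Longrightarrow> \<not> went pr P g Keeper \<and> new_place pr P (g, Keeper) = hm P g"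
    "md P g = Recall \<Longrightarrow> went pr P g Tester = open_for pr P g
       \<and> new_place pr P (g, Tester) = (if open_for pr P g then hm P g else far P g)"
    "md P g = Recall \<Longrightarrow> r \<noteq> Tester \<Longrightarrow> \<not> went pr P g r \<and> new_place pr P (g, r) = hm P g"
    "md P g = Cross \<Longrightarrow> went pr P g r = open_for pr P g
       \<and> new_place pr P (g, r) = (if open_for pr P g then far P g else hm P g)"
    "md P g = Found \<Longrightarrow> \<not> went pr P g r \<and> new_place pr P (g, r) = (if r = Keeper then hm P g else bh)"
  using midD(2,4)[OF P g]
  by (auto simp: went_def new_place_def attempt_def loc_def away_def far_def split: role.splits)

lemma far_home:
  assumes P: "mid P" and g: "g < G" "md P g \<noteq> Idle"
  shows "far P g \<noteq> hm P g"
  using nbrD(2)[OF midD(1)[OF P g(1)] midD(3)[OF P g]] by (simp add: far_def)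

lemma swap_id: "\<not> (r = Scout \<and> md P g = Probe \<and> open_for pr P g \<and> exchange P g \<noteq> {}) \<Longrightarrow> swap pr P (g, r) = (g, r)"
  by (auto simp: swap_def)

lemma new_place_moved:
  assumes P: "mid P" and g: "g < G"
  shows "place (moved pr P) (swap pr P (g, r)) = new_place pr P (g, r)"
proof (cases "r = Scout \<and> md P g = Probe \<and> open_for pr P g \<and> exchange P g \<noteq> {}")
  case True
  then obtain h where h: "h \<in> exchange P g" by blast
  note e = exchange_sym[OF P g _ h]
  have "far P h \<noteq> bh" using e(7) midD(2)[OF P g] True by simp
  then have "md (moved pr P) h = Cross" using e True by (auto simp: next_mode_def)
  then show ?thesis
    using e True new_place_cases(2)[OF P g, where pr = pr] by (simp add: swap_def loc_def hm_moved)
next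
  case False
  note c = new_place_cases[OF P g, where pr = pr]
  note b = midD(2,4,5)[OF P g]
  have "loc (moved pr P) g r = new_place pr P (g, r)"
  proof (cases "md P g")
    case Idle
    then show ?thesis using c(1)[of r] by (simp add: loc_def next_mode_def hm_moved)
  next
    case Probe
    have "exchange P g = {}" if "far P g = bh" using that midD(2)[OF P] by (auto simp: exchange_def)
    then show ?thesis using Probe c(2) c(3)[of r] False
      by (cases r) (auto simp: loc_def next_mode_def hm_moved far_def)
  next
    case Verify
    then show ?thesis using c(4,5,6) by (cases r) (auto simp: loc_def next_mode_def hm_moved far_def)
  next
    case Recall
    then show ?thesis using c(7) c(8)[of r] b by (cases r) (auto simp: loc_def next_mode_def hm_moved far_def)
  next
    case Cross
    then show ?thesis using c(9)[of r] by (cases r) (auto simp: loc_def next_mode_def hm_moved far_def)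
  next
    case Found
    then show ?thesis using c(10)[of r] by (cases r) (auto simp: loc_def next_mode_def hm_moved far_def)
  qed
  then show ?thesis using swap_id[OF False] by simp
qed

text \<open>All members of a trio reach the same conclusion from different evidence: an agent that
  tried to move from its own flag, one that waited from who is present at the home node.\<close>

lemma resolve_round:
  assumes P: "mid P" and g: "g < G" and alive: "new_place pr P (g, r) \<noteq> bh" and nr: "report P (g, r) = None"
  shows "act (mem_moved pr P (g, r)) (seen parts (mem_moved pr P) (new_place pr P) (new_place pr P (g, r))) w d en ok
    = (mem_at 0 (moved pr P) (swap pr P (g, r)), None, w, report (moved pr P) (swap pr P (g, r)))"
proof -
  let ?u = "new_place pr P (g, r)" and ?N = "moved pr P"
  let ?L = "seen parts (mem_moved pr P) (new_place pr P) ?u"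
  note c = new_place_cases[OF P g, where pr = pr]
  have mem: "Agent c' g' r' m p e b \<in> ?L \<longleftrightarrow>
     g' < G \<and> new_place pr P (g', r') = ?u \<and> c' = (if md P g' = Found then 0 else 2) \<and> m = md P g' \<and> p = pt P g'
      \<and> e = (if went pr P g' r' then arrival P g' r' else entry P g' r') \<and> b = went pr P g' r'" for c' g' r' m p e b
    by (auto simp: seen_def mem_moved_def image_iff)
  have nF: "md P g \<noteq> Found" using alive nr c(10)[of r] by (cases r) (auto simp: report_def)
  have pres: "present_role ?L g r' \<longleftrightarrow> new_place pr P (g, r') = ?u" for r'
    unfolding present_role_def mem using g by auto
  have prob: "probers ?L e = {h. h < G \<and> md P h = Probe \<and> pt P h = e \<and> hm P h = ?u}" for e
    unfolding probers_def mem using new_place_cases(3)[OF P, of _ Keeper pr] by auto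
  have sw: "swapped ?L p \<longleftrightarrow> (\<exists>h<G. md P h = Probe \<and> open_for pr P h \<and> far P h = ?u \<and> bck (hm P h) (pt P h) = p)" for p
  proof -
    have "swapped ?L p \<longleftrightarrow> (\<exists>h<G. md P h = Probe \<and> went pr P h Scout \<and> new_place pr P (h, Scout) = ?u \<and> arrival P h Scout = p)"
      unfolding swapped_def mem by auto
    also have "\<dots> \<longleftrightarrow> (\<exists>h<G. md P h = Probe \<and> open_for pr P h \<and> far P h = ?u \<and> bck (hm P h) (pt P h) = p)"
    proof -
      have "md P h = Probe \<and> went pr P h Scout \<and> new_place pr P (h, Scout) = ?u \<and> arrival P h Scout = p \<longleftrightarrow>
          md P h = Probe \<and> open_for pr P h \<and> far P h = ?u \<and> bck (hm P h) (pt P h) = p" if "h < G" for h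
        using new_place_cases(2)[OF P that, where pr = pr] by (auto simp: arrival_def away_def)
      then show ?thesis by blast
    qed
    finally show ?thesis .
  qed
  have e0: "entry P g r = (if away P g r then bck (hm P g) (pt P g) else 0)" by (simp add: entry_def)
  have key: "resolve ?L g r (md P g) (pt P g) (if went pr P g r then arrival P g r else entry P g r) (went pr P g r)
     = (fst (swap pr P (g, r)), md ?N (fst (swap pr P (g, r))), pt ?N (fst (swap pr P (g, r))), entry ?N (fst (swap pr P (g, r))) r)"
  proof (cases "md P g")
    case Idle
    then show ?thesis using c(1)[of r] by (simp add: resolve_def swap_id next_mode_def entry_def away_def)
  next
    case Probe
    note fh = far_home[OF P g]
    have exb: "exchange P g = {}" if "far P g = bh" using that midD(2)[OF P] by (auto simp: exchange_def)
    show ?thesis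
    proof (cases "r = Scout")
      case True
      show ?thesis
      proof (cases "open_for pr P g")
        case False
        then show ?thesis using True Probe c(2) by (simp add: resolve_def swap_id next_mode_def entry_def away_def)
      next
        case op: True
        have u: "?u = far P g" using c(2) Probe op True by simp
        have ar: "arrival P g r = bck (hm P g) (pt P g)" using Probe by (simp add: arrival_def away_def)
        have pe: "probers ?L (bck (hm P g) (pt P g)) = exchange P g" unfolding prob unfolding u exchange_def by auto
        have wt: "went pr P g r" using c(2) Probe op True by simp
        show ?thesis
        proof (cases "exchange P g = {}")
          case False
          then obtain h where h: "h \<in> exchange P g" by blast
          note e = exchange_sym[OF P g Probe h]
          have "far P h \<noteq> bh" using e(7) midD(2)[OF P g] by simp
          then have "md ?N h = Cross" using e op by (auto simp: next_mode_def)
          moreover have "swap pr P (g, r) = (h, r)" using True Probe op e(1) by (simp add: swap_def)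
          ultimately show ?thesis
            using Probe True wt ar pe e(1,6) by (simp add: resolve_def entry_def away_def)
        next
          case ex: True
          then have "md ?N g = Verify" using Probe op by (simp add: next_mode_def)
          then show ?thesis
            using Probe True wt ar pe ex by (simp add: resolve_def swap_id entry_def away_def hm_moved)
        qed
      qed
    next
      case nS: False
      have u: "?u = hm P g" using c(3)[OF Probe nS] by simp
      have sid: "swap pr P (g, r) = (g, r)" using nS by (simp add: swap_id)
      have ent: "entry ?N g r = 0" if "md ?N g \<noteq> Recall" using that nS by (simp add: entry_def away_def)
      show ?thesis
      proof (cases "open_for pr P g")
        case False
        then have "present_role ?L g Scout" unfolding pres unfolding u using c(2)[OF Probe] by simp
        moreover have "md ?N g = Probe" using Probe False by (simp add: next_mode_def)
        ultimately show ?thesis using Probe nS sid ent by (simp add: resolve_def)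
      next
        case op: True
        then have np: "\<not> present_role ?L g Scout" unfolding pres unfolding u using c(2)[OF Probe] fh Probe by simp
        have "swapped ?L (pt P g) \<longleftrightarrow> exchange P g \<noteq> {}"
        proof
          assume "swapped ?L (pt P g)"
          then obtain h where h: "h < G" "md P h = Probe" "far P h = hm P g" "bck (hm P h) (pt P h) = pt P g"
            unfolding sw unfolding u by blast
          have hh: "hm P h < n" "pt P h < deg (hm P h)" using midD(1,3)[OF P h(1)] h(2) by auto
          have "hm P h = far P g" "pt P h = bck (hm P g) (pt P g)"
            using nbrD(4,5)[OF hh] h by (auto simp: far_def)
          then show "exchange P g \<noteq> {}" using h by (auto simp: exchange_def)
        next
          assume "exchange P g \<noteq> {}"
          then obtain h where h: "h \<in> exchange P g" by blast
          note e = exchange_sym[OF P g Probe h]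
          show "swapped ?L (pt P g)" unfolding sw unfolding u using e op by auto
        qed
        moreover have "md ?N g = (if exchange P g \<noteq> {} then Cross else Verify)"
          using Probe op exb by (auto simp: next_mode_def)
        ultimately show ?thesis using Probe nS sid ent np by (simp add: resolve_def)
      qed
    qed
  next
    case Verify
    note fh = far_home[OF P g]
    have sid: "swap pr P (g, r') = (g, r')" for r' using Verify by (simp add: swap_id)
    have N: "md ?N g = (if open_for pr P g then if far P g = bh then Found else Recall else Verify)" "hm ?N g = hm P g"
      using Verify by (auto simp: next_mode_def hm_moved)
    show ?thesis
    proof (cases r)
      case Scout
      have "far P g \<noteq> bh" using alive c(4)[OF Verify] Scout by auto
      then show ?thesis
        using c(4)[OF Verify] Scout Verify N by (auto simp: resolve_def sid entry_def away_def)
    next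
      case Tester
      have "open_for pr P g \<Longrightarrow> far P g \<noteq> bh" using alive c(5)[OF Verify] Tester by auto
      then show ?thesis
        using c(5)[OF Verify] Tester Verify N by (auto simp: resolve_def sid entry_def away_def arrival_def)
    next
      case Keeper
      have u: "?u = hm P g" using c(6)[OF Verify] Keeper by simp
      \<comment> \<open>The keeper's evidence: a tester still at home reveals a missing edge; if the
        tester has left and the scout has not returned, the far node has destroyed both.\<close>
      have "present_role ?L g Scout \<longleftrightarrow> far P g \<noteq> bh \<and> open_for pr P g"
        unfolding pres unfolding u using c(4)[OF Verify] fh Verify by auto
      moreover have "present_role ?L g Tester \<longleftrightarrow> \<not> open_for pr P g"
        unfolding pres unfolding u using c(5)[OF Verify] fh Verify by auto
      ultimately show ?thesis
        using Keeper Verify N by (auto simp: resolve_def sid entry_def away_def)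
    qed
  next
    case Recall
    note fh = far_home[OF P g]
    have sid: "swap pr P (g, r') = (g, r')" for r' using Recall by (simp add: swap_id)
    have N: "md ?N g = (if open_for pr P g then Cross else Recall)" "hm ?N g = hm P g"
      using Recall by (auto simp: next_mode_def hm_moved)
    show ?thesis
    proof (cases "r = Tester")
      case True
      then show ?thesis
        using c(7)[OF Recall] Recall N by (auto simp: resolve_def sid entry_def away_def)
    next
      case False
      have u: "?u = hm P g" using c(8)[OF Recall False] by simp
      have "present_role ?L g Tester \<longleftrightarrow> open_for pr P g"
        unfolding pres unfolding u using c(7)[OF Recall] fh Recall by auto
      then show ?thesis
        using False Recall N by (auto simp: resolve_def sid entry_def away_def)
    qed
  next
    case Cross
    have sid: "swap pr P (g, r') = (g, r')" for r' using Cross by (simp add: swap_id)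
    show ?thesis
      using c(9)[OF Cross, of r] Cross by (auto simp: resolve_def sid entry_def away_def next_mode_def)
  qed (use nF in auto)
  obtain g' where g': "swap pr P (g, r) = (g', r)" by (simp add: swap_def)
  have pl: "loc ?N g' r \<noteq> bh" using new_place_moved[OF P g, of pr r] g' alive by simp
  have rp: "report ?N (g', r) = (if md ?N g' = Found then Some [pt ?N g'] else None)"
    using pl by (cases r) (auto simp: report_def loc_def)
  have m2: "mem_moved pr P (g, r) = Agent 2 g r (md P g) (pt P g)
      (if went pr P g r then arrival P g r else entry P g r) (went pr P g r)"
    using nF by (simp add: mem_moved_def)
  have m0: "mem_at 0 ?N (g', r) = Agent 0 g' r (md ?N g') (pt ?N g') (entry ?N g' r) False"
    by (simp add: mem_at_def)
  show ?thesis
    unfolding m2 act_def memory.case Let_def key unfolding g' m0 rp by simp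
qed


lemma report_planned: "g < G \<Longrightarrow> report (planned M) (g, r) = report M (g, r)"
  using found_planned[of g M] planned_advanced(2)[of g M] by (auto simp: report_def)

lemma dead_stays: "place P x = bh \<Longrightarrow> new_place pr P x = bh"
  by (cases x) (auto simp: new_place_def went_def)

lemma found_stays: "md P g = Found \<Longrightarrow> new_place pr P (g, r) = place P (g, r) \<and> \<not> went pr P g r \<and> entry P g r = 0"
  by (auto simp: new_place_def went_def attempt_def entry_def away_def)

lemma reportD: "report P (g, r) = Some ps \<Longrightarrow> md P g = Found \<and> r = Keeper \<and> ps = [pt P g]"
  by (auto simp: report_def split: if_splits)

text \<open>Nobody attempts a move in the second and third round, so the edges \<open>pr2\<close>
  and \<open>pr3\<close> are arbitrary there. The last three claims trace the memory of destroyed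
  agents, about which \<open>fits\<close> is silent but which the memory bound covers.\<close>

lemma three_rounds:
  fixes pr pr2 pr3 :: "nat set \<Rightarrow> bool"
  assumes M: "consistent M" and ids: "inj_on ids {..<k}"
    and fit0: "fits bh parts k \<beta> (place M) (mem_at 0 M) (report M) (bd M) C0"
  defines "P \<equiv> planned M" and "N \<equiv> moved pr (planned M)"
    and "C1 \<equiv> next_cfg bhs_algo deg nbr bck bh k ids pr C0"
  defines "C2 \<equiv> next_cfg bhs_algo deg nbr bck bh k ids pr2 C1"
  defines "C3 \<equiv> next_cfg bhs_algo deg nbr bck bh k ids pr3 C2"
  shows "fits bh parts k \<beta> (new_place pr P) (mem_at 1 P) (report P) (bd P) C1"
    "fits bh parts k \<beta> (new_place pr P) (mem_moved pr P) (report P) (bd P) C2"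
    "fits bh parts k (swap pr P \<circ> \<beta>) (place N) (mem_at 0 N) (report N) (bd N) C3"
    "\<And>a. a < k \<Longrightarrow> c_mem C1 a = c_mem C0 a \<or> (\<exists>x\<in>parts. c_mem C1 a = enc_mem (mem_at 1 P x))"
    "\<And>a. a < k \<Longrightarrow> c_mem C2 a = c_mem C1 a \<or> (\<exists>x\<in>parts. c_mem C2 a = enc_mem (mem_moved pr P x))"
    "\<And>a. a < k \<Longrightarrow> c_mem C3 a = c_mem C2 a \<or> (\<exists>x\<in>parts. c_mem C3 a = enc_mem (mem_at 0 N x))"
proof -
  have mP: "mid P" unfolding P_def using M by (rule mid_planned)
  have NP: "N = moved pr P" by (simp only: N_def P_def)
  have iN: "consistent N" unfolding N_def using mP[unfolded P_def] by (rule consistent_moved)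
  have im: "\<beta> ` {..<k} = parts" using fit0 by (simp add: fits_def)
  have part: "\<exists>g r. \<beta> a = (g, r) \<and> g < G" if "a < k" for a using im that by (cases "\<beta> a") force
  have pl: "place P (g, r) = place M (g, r)" "report P (g, r) = report M (g, r)" "entry P g r = entry M g r"
    "md P g = Found \<longleftrightarrow> md M g = Found" if "g < G" for g r
    unfolding P_def using loc_planned[OF that] report_planned[OF that] entry_planned[OF that] found_planned[OF that] by auto
  have nF: "md P g \<noteq> Found" if "place P (g, r) \<noteq> bh" "report P (g, r) = None" for g r
    using that by (cases r) (auto simp: loc_def report_def)
  define tr where "tr x = attempt (snd x) (md P (fst x)) (pt P (fst x)) (entry P (fst x) (snd x))" for x
  have out1: "act (mem_at 0 M (\<beta> a)) (seen parts (mem_at 0 M) (place M) (place M (\<beta> a))) (bd M (place M (\<beta> a))) (deg (place M (\<beta> a))) (c_entry C0 a) (c_lastok C0 a)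
      = (mem_at 1 P (\<beta> a), tr (\<beta> a), bd P (place M (\<beta> a)), None)"
    if a: "a < k" "place M (\<beta> a) \<noteq> bh" "report M (\<beta> a) = None" for a
  proof -
    obtain g r where gr: "\<beta> a = (g, r)" "g < G" using part a(1) by blast
    then show ?thesis using plan_round[OF M gr(2), of r] a by (simp add: tr_def P_def)
  qed
  have same1: "bd P u = bd M u" if "\<And>x. x \<in> parts \<Longrightarrow> place M x = u \<Longrightarrow> u \<noteq> bh \<Longrightarrow> report M x \<noteq> None" for u
  proof -
    have "\<not> lively M u"
    proof
      assume "lively M u"
      then obtain g r where "u \<noteq> bh" "g < G" "loc M g r = u" "md M g \<noteq> Found" by (auto simp: lively_def)
      then show False using that[of "(g, r)"] by (simp add: report_def)
    qed
    then show ?thesis by (simp add: P_def)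
  qed
  have o1: "\<forall>a<k. place M (\<beta> a) \<noteq> bh \<longrightarrow> report M (\<beta> a) = None \<longrightarrow>
    act (mem_at 0 M (\<beta> a)) (seen parts (mem_at 0 M) (place M) (place M (\<beta> a))) (bd M (place M (\<beta> a))) (deg (place M (\<beta> a))) (c_entry C0 a) (c_lastok C0 a)
      = (mem_at 1 P (\<beta> a), tr (\<beta> a), bd P (place M (\<beta> a)), None)" by (intro allI impI) (rule out1)
  have s1: "\<forall>u. (\<forall>x\<in>parts. place M x = u \<longrightarrow> u \<noteq> bh \<longrightarrow> report M x \<noteq> None) \<longrightarrow> bd P u = bd M u" by (intro allI impI same1) blast
  note n1 = fits_next[OF fit0 ids, where pres = pr and nbr = nbr and bck = bck and deg = deg and mm' = "mem_at 1 P"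
      and mv = tr and w' = "bd P" and rp' = "\<lambda>_. None", OF o1 s1, folded C1_def]
  have tm: "try_move deg nbr bck pr (place M (g, r)) (tr (g, r)) =
     (if went pr P g r then Some (new_place pr P (g, r), arrival P g r) else None)"
    if "g < G" "place M (g, r) \<noteq> bh" for g r
    using attempt_move[OF mP that(1), of r pr] that pl(1)[OF that(1), of r] by (simp add: tr_def new_place_def)
  have stay: "new_place pr P (g, r) = place M (g, r)" if "g < G" "\<not> went pr P g r" for g r
    using pl(1)[OF that(1), of r] that by (simp add: new_place_def)
  show fit1: "fits bh parts k \<beta> (new_place pr P) (mem_at 1 P) (report P) (bd P) C1"
    unfolding fits_def
  proof (intro conjI allI)
    show "\<beta> ` {..<k} = parts" by (rule im)
    show "c_wb C1 u = enc_board (bd P u)" for u by (rule n1(1))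
    fix a
    show "a < k \<longrightarrow> c_pos C1 a = new_place pr P (\<beta> a) \<and> c_alive C1 a = (new_place pr P (\<beta> a) \<noteq> bh)
      \<and> c_rep C1 a = report P (\<beta> a) \<and> (new_place pr P (\<beta> a) \<noteq> bh \<longrightarrow> c_mem C1 a = enc_mem (mem_at 1 P (\<beta> a)))"
    proof
    assume a: "a < k"
    obtain g r where gr: "\<beta> a = (g, r)" "g < G" using part a by blast
    have c0: "c_pos C0 a = place M (\<beta> a)" "c_alive C0 a = (place M (\<beta> a) \<noteq> bh)" "c_rep C0 a = report M (\<beta> a)"
      "place M (\<beta> a) \<noteq> bh \<Longrightarrow> c_mem C0 a = enc_mem (mem_at 0 M (\<beta> a))"
      using fit0 a by (auto simp: fits_def)
    show "c_pos C1 a = new_place pr P (\<beta> a) \<and> c_alive C1 a = (new_place pr P (\<beta> a) \<noteq> bh)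
      \<and> c_rep C1 a = report P (\<beta> a) \<and> (new_place pr P (\<beta> a) \<noteq> bh \<longrightarrow> c_mem C1 a = enc_mem (mem_at 1 P (\<beta> a)))"
    proof (cases "place M (\<beta> a) \<noteq> bh \<and> report M (\<beta> a) = None")
      case True
      then have l: "place M (\<beta> a) \<noteq> bh" "report M (\<beta> a) = None" by auto
      have "c_pos C1 a = new_place pr P (\<beta> a) \<and> c_alive C1 a = (new_place pr P (\<beta> a) \<noteq> bh)"
      proof (cases "went pr P g r")
        case True
        then show ?thesis using n1(6)[OF a l] tm[OF gr(2), of r] l gr by simp
      next
        case False
        then show ?thesis using n1(4)[OF a l] tm[OF gr(2), of r] stay[OF gr(2) False] l gr by simp
      qed
      then show ?thesis using n1(3)[OF a l] pl(2)[OF gr(2), of r] gr l by simp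
    next
      case False
      note u = n1(2)[OF a False]
      show ?thesis
      proof (cases "place M (\<beta> a) = bh")
        case True
        then have "new_place pr P (\<beta> a) = bh" using dead_stays[of P "\<beta> a" pr] pl(1)[OF gr(2), of r] gr by simp
        then show ?thesis using u c0 True pl(2)[OF gr(2), of r] gr by simp
      next
        case al: False
        then obtain ps where "report M (g, r) = Some ps" using False gr by auto
        then have F: "md M g = Found" "md P g = Found" "r = Keeper" using reportD pl(4)[OF gr(2)] by auto
        have "pt P g = pt M g" using planned_advanced(2)[OF gr(2), of M] F by (simp add: P_def)
        then have "mem_at 1 P (g, r) = mem_at 0 M (g, r)" using F pl(3)[OF gr(2), of r] by (simp add: mem_at_def)
        moreover have "new_place pr P (g, r) = place M (g, r)" using found_stays[OF F(2)] pl(1)[OF gr(2), of r] by simp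
        ultimately show ?thesis using u c0 al pl(2)[OF gr(2), of r] gr by simp
      qed
    qed
    qed
  qed
  have live: "place M (\<beta> a) \<noteq> bh \<and> report M (\<beta> a) = None"
    if a: "a < k" "new_place pr P (\<beta> a) \<noteq> bh" "report P (\<beta> a) = None" for a
  proof -
    obtain g r where gr: "\<beta> a = (g, r)" "g < G" using part a(1) by blast
    then show ?thesis using a dead_stays[of P "\<beta> a" pr] pl(1,2)[OF gr(2), of r] by auto
  qed
  have out2: "act (mem_at 1 P (\<beta> a)) (seen parts (mem_at 1 P) (new_place pr P) (new_place pr P (\<beta> a))) (bd P (new_place pr P (\<beta> a)))
        (deg (new_place pr P (\<beta> a))) (c_entry C1 a) (c_lastok C1 a)
      = (mem_moved pr P (\<beta> a), None, bd P (new_place pr P (\<beta> a)), None)"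
    if a: "a < k" "new_place pr P (\<beta> a) \<noteq> bh" "report P (\<beta> a) = None" for a
  proof -
    obtain g r where gr: "\<beta> a = (g, r)" "g < G" using part a by blast
    have l: "place M (\<beta> a) \<noteq> bh" "report M (\<beta> a) = None" using live[OF a] by auto
    have "md P g \<noteq> Found" using nF[of g r] l pl(1,2)[OF gr(2), of r] gr by simp
    moreover have "c_lastok C1 a = (attempt r (md P g) (pt P g) (entry P g r) = None \<or> went pr P g r)"
      using n1(5)[OF a(1) l] tm[OF gr(2), of r] l gr by (simp add: tr_def)
    moreover have "c_entry C1 a = Some (arrival P g r)" if "went pr P g r"
      using n1(6)[OF a(1) l] tm[OF gr(2), of r] l gr that by simp
    ultimately show ?thesis unfolding gr(1) by (intro announce_round[OF gr(2)]) auto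
  qed
  have o2: "\<forall>a<k. new_place pr P (\<beta> a) \<noteq> bh \<longrightarrow> report P (\<beta> a) = None \<longrightarrow>
    act (mem_at 1 P (\<beta> a)) (seen parts (mem_at 1 P) (new_place pr P) (new_place pr P (\<beta> a))) (bd P (new_place pr P (\<beta> a)))
        (deg (new_place pr P (\<beta> a))) (c_entry C1 a) (c_lastok C1 a)
      = (mem_moved pr P (\<beta> a), None, bd P (new_place pr P (\<beta> a)), None)" by (intro allI impI) (rule out2)
  have s2: "\<forall>u. (\<forall>x\<in>parts. new_place pr P x = u \<longrightarrow> u \<noteq> bh \<longrightarrow> report P x \<noteq> None) \<longrightarrow> bd P u = bd P u" by blast
  note n2 = fits_next[OF fit1 ids, where pres = pr2 and nbr = nbr and bck = bck and deg = deg and mm' = "mem_moved pr P"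
      and mv = "\<lambda>_. None" and w' = "bd P" and rp' = "\<lambda>_. None", OF o2 s2, folded C2_def]
  have nomove: "try_move deg nbr bck prx v None = None" for prx v by (simp add: try_move_def)
  show fit2: "fits bh parts k \<beta> (new_place pr P) (mem_moved pr P) (report P) (bd P) C2"
    unfolding fits_def
  proof (intro conjI allI)
    show "\<beta> ` {..<k} = parts" by (rule im)
    show "c_wb C2 u = enc_board (bd P u)" for u by (rule n2(1))
    fix a
    show "a < k \<longrightarrow> c_pos C2 a = new_place pr P (\<beta> a) \<and> c_alive C2 a = (new_place pr P (\<beta> a) \<noteq> bh)
      \<and> c_rep C2 a = report P (\<beta> a) \<and> (new_place pr P (\<beta> a) \<noteq> bh \<longrightarrow> c_mem C2 a = enc_mem (mem_moved pr P (\<beta> a)))"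
    proof
    assume a: "a < k"
    obtain g r where gr: "\<beta> a = (g, r)" "g < G" using part a by blast
    have c1: "c_pos C1 a = new_place pr P (\<beta> a)" "c_alive C1 a = (new_place pr P (\<beta> a) \<noteq> bh)" "c_rep C1 a = report P (\<beta> a)"
      "new_place pr P (\<beta> a) \<noteq> bh \<Longrightarrow> c_mem C1 a = enc_mem (mem_at 1 P (\<beta> a))"
      using fit1 a by (auto simp: fits_def)
    show "c_pos C2 a = new_place pr P (\<beta> a) \<and> c_alive C2 a = (new_place pr P (\<beta> a) \<noteq> bh)
      \<and> c_rep C2 a = report P (\<beta> a) \<and> (new_place pr P (\<beta> a) \<noteq> bh \<longrightarrow> c_mem C2 a = enc_mem (mem_moved pr P (\<beta> a)))"
    proof (cases "new_place pr P (\<beta> a) \<noteq> bh \<and> report P (\<beta> a) = None")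
      case True
      then have l: "new_place pr P (\<beta> a) \<noteq> bh" "report P (\<beta> a) = None" by auto
      show ?thesis using n2(3)[OF a l] n2(4)[OF a l] l by (simp add: nomove)
    next
      case False
      note u = n2(2)[OF a False]
      have "mem_moved pr P (g, r) = mem_at 1 P (g, r)" if al: "new_place pr P (g, r) \<noteq> bh"
      proof -
        obtain ps where "report P (g, r) = Some ps" using False gr al by auto
        then have "md P g = Found" using reportD by blast
        then show ?thesis using found_stays[of P g pr r] by (simp add: mem_moved_def mem_at_def)
      qed
      then show ?thesis using u c1 gr by auto
    qed
    qed
  qed
  have out3: "act (mem_moved pr P (\<beta> a)) (seen parts (mem_moved pr P) (new_place pr P) (new_place pr P (\<beta> a))) (bd P (new_place pr P (\<beta> a)))
        (deg (new_place pr P (\<beta> a))) (c_entry C2 a) (c_lastok C2 a)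
      = (mem_at 0 N (swap pr P (\<beta> a)), None, bd P (new_place pr P (\<beta> a)), report N (swap pr P (\<beta> a)))"
    if a: "a < k" "new_place pr P (\<beta> a) \<noteq> bh" "report P (\<beta> a) = None" for a
  proof -
    obtain g r where gr: "\<beta> a = (g, r)" "g < G" using part a by blast
    have x: "new_place pr P (g, r) \<noteq> bh" "report P (g, r) = None" using a gr by auto
    show ?thesis unfolding gr(1) NP by (rule resolve_round[OF mP gr(2) x])
  qed
  have o3: "\<forall>a<k. new_place pr P (\<beta> a) \<noteq> bh \<longrightarrow> report P (\<beta> a) = None \<longrightarrow>
    act (mem_moved pr P (\<beta> a)) (seen parts (mem_moved pr P) (new_place pr P) (new_place pr P (\<beta> a))) (bd P (new_place pr P (\<beta> a)))
        (deg (new_place pr P (\<beta> a))) (c_entry C2 a) (c_lastok C2 a)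
      = (mem_at 0 N (swap pr P (\<beta> a)), None, bd P (new_place pr P (\<beta> a)), report N (swap pr P (\<beta> a)))" by (intro allI impI) (rule out3)
  note n3 = fits_next[OF fit2 ids, where pres = pr3 and nbr = nbr and bck = bck and deg = deg and mm' = "\<lambda>x. mem_at 0 N (swap pr P x)"
      and mv = "\<lambda>_. None" and w' = "bd P" and rp' = "\<lambda>x. report N (swap pr P x)", OF o3 s2, folded C3_def]
  show "fits bh parts k (swap pr P \<circ> \<beta>) (place N) (mem_at 0 N) (report N) (bd N) C3"
    unfolding fits_def
  proof (intro conjI allI)
    show "(swap pr P \<circ> \<beta>) ` {..<k} = parts" unfolding image_comp[symmetric] im by (rule swap_parts[OF mP])
    show "c_wb C3 u = enc_board (bd N u)" for u unfolding NP moved_simps by (rule n3(1))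
    fix a
    show "a < k \<longrightarrow> c_pos C3 a = place N ((swap pr P \<circ> \<beta>) a) \<and> c_alive C3 a = (place N ((swap pr P \<circ> \<beta>) a) \<noteq> bh)
      \<and> c_rep C3 a = report N ((swap pr P \<circ> \<beta>) a) \<and> (place N ((swap pr P \<circ> \<beta>) a) \<noteq> bh \<longrightarrow> c_mem C3 a = enc_mem (mem_at 0 N ((swap pr P \<circ> \<beta>) a)))"
      unfolding comp_apply
    proof
    assume a: "a < k"
    obtain g r where gr: "\<beta> a = (g, r)" "g < G" using part a by blast
    let ?x = "swap pr P (\<beta> a)"
    have plN: "place N ?x = new_place pr P (\<beta> a)" unfolding gr(1) NP by (rule new_place_moved[OF mP gr(2)])
    have c2: "c_pos C2 a = new_place pr P (\<beta> a)" "c_alive C2 a = (new_place pr P (\<beta> a) \<noteq> bh)" "c_rep C2 a = report P (\<beta> a)"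
      "new_place pr P (\<beta> a) \<noteq> bh \<Longrightarrow> c_mem C2 a = enc_mem (mem_moved pr P (\<beta> a))"
      using fit2 a by (auto simp: fits_def)
    show "c_pos C3 a = place N ?x \<and> c_alive C3 a = (place N ?x \<noteq> bh)
      \<and> c_rep C3 a = report N ?x \<and> (place N ?x \<noteq> bh \<longrightarrow> c_mem C3 a = enc_mem (mem_at 0 N ?x))"
    proof (cases "new_place pr P (\<beta> a) \<noteq> bh \<and> report P (\<beta> a) = None")
      case True
      then have l: "new_place pr P (\<beta> a) \<noteq> bh" "report P (\<beta> a) = None" by auto
      show ?thesis using n3(3)[OF a l] n3(4)[OF a l] l plN by (simp add: nomove)
    next
      case False
      note u = n3(2)[OF a False]
      show ?thesis
      proof (cases "new_place pr P (\<beta> a) = bh")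
        case True
        have "report P (\<beta> a) = None"
        proof (rule ccontr)
          assume "report P (\<beta> a) \<noteq> None"
          then obtain ps where "report P (g, r) = Some ps" unfolding gr(1) by blast
          then have "md P g = Found" "r = Keeper" using reportD by blast+
          then show False using found_stays[of P g pr r] True midD(2)[OF mP gr(2)] gr by simp
        qed
        \<comment> \<open>Only a keeper reports, and a keeper stays at a safe home, so no destroyed
          agent is cast as one.\<close>
        moreover have "report N ?x = None"
        proof (rule ccontr)
          assume n: "report N ?x \<noteq> None"
          obtain h r' where x: "?x = (h, r')" by (rule prod.exhaust)
          have "?x \<in> swap pr P ` parts" using gr by simp
          then have "h < G" unfolding swap_parts[OF mP] x by simp
          moreover obtain ps where "report N (h, r') = Some ps" using n unfolding x by blast
          then have "r' = Keeper" using reportD by blast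
          ultimately show False using plN[unfolded x] True consistentD(2)[OF iN, of h] by simp
        qed
        ultimately show ?thesis using u c2 True plN by simp
      next
        case al: False
        then obtain ps where ps: "report P (g, r) = Some ps" using False gr by auto
        then have F: "md P g = Found" "r = Keeper" using reportD by blast+
        then have sx: "?x = (g, r)" using gr by (simp add: swap_def)
        have N: "md N g = Found" "pt N g = pt P g" using F by (simp_all add: NP next_mode_def)
        then have "report N ?x = report P (\<beta> a)" using sx F gr by (simp add: report_def)
        moreover have "mem_at 0 N ?x = mem_moved pr P (\<beta> a)"
          using sx gr N F found_stays[OF F(1), of pr r] by (simp add: mem_at_def mem_moved_def entry_def away_def)
        ultimately show ?thesis using u c2 al plN by simp
      qed
    qed
    qed
  qed
  have inp: "\<beta> a \<in> parts" if "a < k" for a using im that by blast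
  show "c_mem C1 a = c_mem C0 a \<or> (\<exists>x\<in>parts. c_mem C1 a = enc_mem (mem_at 1 P x))" if "a < k" for a
  proof (cases "place M (\<beta> a) \<noteq> bh \<and> report M (\<beta> a) = None")
    case True
    show ?thesis
      by (rule disjI2, rule bexI[OF _ inp[OF that]], rule conjunct1[OF n1(3)[OF that conjunct1[OF True] conjunct2[OF True]]])
  next
    case False
    show ?thesis
      by (rule disjI1, rule conjunct1[OF conjunct2[OF n1(2)[OF that False]]])
  qed
  show "c_mem C2 a = c_mem C1 a \<or> (\<exists>x\<in>parts. c_mem C2 a = enc_mem (mem_moved pr P x))" if "a < k" for a
  proof (cases "new_place pr P (\<beta> a) \<noteq> bh \<and> report P (\<beta> a) = None")
    case True
    show ?thesis
      by (rule disjI2, rule bexI[OF _ inp[OF that]], rule conjunct1[OF n2(3)[OF that conjunct1[OF True] conjunct2[OF True]]])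
  next
    case False
    show ?thesis
      by (rule disjI1, rule conjunct1[OF conjunct2[OF n2(2)[OF that False]]])
  qed
  show "c_mem C3 a = c_mem C2 a \<or> (\<exists>x\<in>parts. c_mem C3 a = enc_mem (mem_at 0 N x))" if "a < k" for a
  proof -
    have "swap pr P (\<beta> a) \<in> swap pr P ` parts" using inp[OF that] by (rule imageI)
    then have "swap pr P (\<beta> a) \<in> parts" unfolding swap_parts[OF mP] .
    show ?thesis
    proof (cases "new_place pr P (\<beta> a) \<noteq> bh \<and> report P (\<beta> a) = None")
      case True
      show ?thesis
        by (rule disjI2, rule bexI[OF _ \<open>swap pr P (\<beta> a) \<in> parts\<close>],
            rule conjunct1[OF n3(3)[OF that conjunct1[OF True] conjunct2[OF True]]])
    next
      case False
      show ?thesis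
        by (rule disjI1, rule conjunct1[OF conjunct2[OF n3(2)[OF that False]]])
    qed
  qed
qed

end

section \<open>The first round: ranks, trios and roles\<close>

text \<open>A larger ID has a larger rank, so ranking maps \<open>{..<k}\<close> injectively into
  itself and hence onto itself.\<close>

lemma rank_bij:
  fixes ids :: "nat \<Rightarrow> nat"
  assumes "inj_on ids {..<k}"
  shows "(\<lambda>a. card {b. b < k \<and> ids b < ids a}) ` {..<k} = {..<k}"
proof (rule endo_inj_surj)
  let ?r = "\<lambda>a. card {b. b < k \<and> ids b < ids a}"
  have lt: "?r a < card {b. b < k \<and> ids b < m}" if "a < k" "ids a < m" for a m
  proof (rule psubset_card_mono)
    have "a \<in> {b. b < k \<and> ids b < m}" using that by simp
    moreover have "a \<notin> {b. b < k \<and> ids b < ids a}" by simp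
    moreover have "{b. b < k \<and> ids b < ids a} \<subseteq> {b. b < k \<and> ids b < m}" using that(2) by (auto dest: less_trans)
    ultimately show "{b. b < k \<and> ids b < ids a} \<subset> {b. b < k \<and> ids b < m}" by blast
  qed simp
  have le: "card {b. b < k \<and> ids b < m} \<le> k" for m
    using card_mono[of "{..<k}" "{b. b < k \<and> ids b < m}"] by (simp add: subset_eq)
  show "?r ` {..<k} \<subseteq> {..<k}"
  proof (intro subsetI, elim imageE)
    fix x a assume a: "x = ?r a" "a \<in> {..<k}"
    then have "?r a < card {b. b < k \<and> ids b < Suc (ids a)}" by (intro lt) auto
    then show "x \<in> {..<k}" using le[of "Suc (ids a)"] a(1) by simp
  qed
  show "inj_on ?r {..<k}"
  proof (rule inj_onI)
    fix a b assume ab: "a \<in> {..<k}" "b \<in> {..<k}" "?r a = ?r b"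
    have "ids a = ids b"
    proof (cases "ids a" "ids b" rule: linorder_cases)
      case less
      then show ?thesis using lt[of a "ids b"] ab by simp
    next
      case greater
      then show ?thesis using lt[of b "ids a"] ab by simp
    qed
    then show "a = b" using inj_onD[OF assms] ab by blast
  qed
qed simp

lemma role_of_no [simp]: "role_of (role_no r) = r"
  by (cases r) (auto simp: role_of_def role_no_def)

lemma parts_image: "(\<lambda>i. (i div 3, role_of (i mod 3))) ` {..<3 * G} = {..<G} \<times> UNIV"
proof
  show "(\<lambda>i. (i div 3, role_of (i mod 3))) ` {..<3 * G} \<subseteq> {..<G} \<times> UNIV" by auto
  show "{..<G} \<times> UNIV \<subseteq> (\<lambda>i. (i div 3, role_of (i mod 3))) ` {..<3 * G}"
  proof
    fix x :: "nat \<times> role" assume "x \<in> {..<G} \<times> UNIV"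
    then obtain g r where x: "x = (g, r)" "g < G" by auto
    have r: "role_no r < 3" by (cases r) (auto simp: role_no_def)
    have "(3 * g + role_no r) div 3 = g" "(3 * g + role_no r) mod 3 = role_no r" using r by auto
    then show "x \<in> (\<lambda>i. (i div 3, role_of (i mod 3))) ` {..<3 * G}"
      using x r by (intro image_eqI[of _ _ "3 * g + role_no r"]) auto
  qed
qed

definition mem_le :: "nat \<Rightarrow> memory \<Rightarrow> bool" where
  "mem_le b m \<longleftrightarrow> (\<forall>v\<in>set (memory_nos m). v \<le> b)"

lemma role_mode_no_le: "role_no r \<le> 5" "mode_no m \<le> 5"
  by (cases r; simp add: role_no_def) (cases m; simp add: mode_no_def)

definition blank :: board where
  "blank = \<lparr>low = 0, high = 0, rot = 0, irot = 0\<rparr>"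

lemma enc_blank [simp]: "enc_board blank = []"
  by (simp add: blank_def enc_board_def board_nos_def)

context trios begin

definition start :: "nat \<Rightarrow> state" where
  "start s = \<lparr>hm = \<lambda>_. s, md = \<lambda>_. Idle, pt = \<lambda>_. 0, bd = \<lambda>_. blank\<rparr>"

text \<open>Round 1 distributes the roles. Step \<open>i\<close> then occupies rounds
  \<open>3 * i + 2\<close> to \<open>3 * i + 4\<close>, and agents move only in the first of
  these.\<close>

primrec trace :: "(nat \<Rightarrow> nat set \<Rightarrow> bool) \<Rightarrow> nat \<Rightarrow> nat \<Rightarrow> state" where
  "trace present s 0 = start s"
| "trace present s (Suc i) = step (present (3 * i + 2)) (trace present s i)"

lemma deg_pos:
  assumes "u < n" shows "0 < deg u"
proof -
  define v :: nat where "v = (if u = 0 then 1 else 0)"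
  have v: "v < n" "v \<noteq> u" using n2 by (auto simp: v_def)
  have "connected_on n (Edges n deg nbr)" using graph by (auto simp: port_graph_def)
  then obtain x y where "x \<in> {u}" "y \<notin> {u}" "{x, y} \<in> Edges n deg nbr"
    using crossing_edge[of n "Edges n deg nbr" u "{u}" v] assms v by blast
  then obtain w p where w: "w < n" "p < deg w" "{u, y} = {w, nbr w p}" by (auto simp: Edges_def)
  then consider "u = w" | "u = nbr w p" by (auto simp: doubleton_eq_iff)
  then show ?thesis
  proof cases
    case 2
    then show ?thesis using nbrD(3)[OF w(1,2)] by auto
  qed (use w in auto)
qed

lemma deg_less:
  assumes "u < n" shows "deg u < n"
proof -
  have "card (nbr u ` {..<deg u}) = deg u"
    using nbr_inj[OF assms] by (subst card_image) (auto simp: inj_on_def)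
  moreover have "nbr u ` {..<deg u} \<subseteq> {..<n} - {u}" using nbrD(1,2)[OF assms] by auto
  then have "card (nbr u ` {..<deg u}) \<le> card ({..<n} - {u})" by (intro card_mono) auto
  ultimately show ?thesis using assms by simp
qed

lemma consistent_start:
  assumes "s < n" "s \<noteq> bh" shows "consistent (start s)"
proof -
  have "unknown (start s) u = {..<deg u}" for u by (auto simp: start_def blank_def unk_def)
  moreover have "board_ok (deg u) (bd (start s) u)" if "u < n" for u
    using deg_pos[OF that] by (simp add: start_def blank_def board_ok_def)
  moreover have "hm (start s) g = s" "md (start s) g = Idle" for g by (simp_all add: start_def)
  ultimately show ?thesis using assms by (simp add: consistent_def holds_def)
qed

lemma consistent_trace: "s < n \<Longrightarrow> s \<noteq> bh \<Longrightarrow> consistent (trace present s i)"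
  by (induction i) (auto simp: consistent_start consistent_step)

lemma first_round:
  fixes pr :: "nat set \<Rightarrow> bool"
  assumes s: "s < n" "s \<noteq> bh" and ids: "inj_on ids {..<3 * G}"
  defines "C1 \<equiv> next_cfg bhs_algo deg nbr bck bh (3 * G) ids pr (init_cfg bhs_algo s ids)"
  shows "\<exists>\<beta>. fits bh parts (3 * G) \<beta> (place (start s)) (mem_at 0 (start s)) (report (start s)) (bd (start s)) C1"
    "\<And>a. a < 3 * G \<Longrightarrow> \<exists>x\<in>parts. c_mem C1 a = enc_mem (mem_at 0 (start s) x)"
proof -
  let ?k = "3 * G" and ?C0 = "init_cfg bhs_algo s ids"
  define rank where "rank a = card {b. b < ?k \<and> ids b < ids a}" for a
  define \<beta> where "\<beta> a = (rank a div 3, role_of (rank a mod 3))" for a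
  have im: "\<beta> ` {..<?k} = parts"
  proof -
    have "\<beta> ` {..<?k} = (\<lambda>i. (i div 3, role_of (i mod 3))) ` (rank ` {..<?k})"
      by (simp add: image_image \<beta>_def)
    also have "rank ` {..<?k} = {..<?k}" unfolding rank_def by (rule rank_bij[OF ids])
    also note parts_image
    finally show ?thesis .
  qed
  have fit0: "fits bh {..<?k} ?k (\<lambda>a. a) (\<lambda>_. s) (\<lambda>a. Fresh (ids a)) (\<lambda>_. None) (\<lambda>_. blank) ?C0"
    using s by (auto simp: fits_def init_cfg_def bhs_algo_def)
  have seen0: "seen {..<?k} (\<lambda>a. Fresh (ids a)) (\<lambda>_. s) s = (\<lambda>a. Fresh (ids a)) ` {..<?k}"
    by (auto simp: seen_def)
  have rk: "card {j. j < ids a \<and> Fresh j \<in> (\<lambda>a. Fresh (ids a)) ` {..<?k}} = rank a" for a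
  proof -
    have "{j. j < ids a \<and> Fresh j \<in> (\<lambda>a. Fresh (ids a)) ` {..<?k}} = ids ` {b. b < ?k \<and> ids b < ids a}" by auto
    moreover have "inj_on ids {b. b < ?k \<and> ids b < ids a}" by (rule inj_on_subset[OF ids]) auto
    ultimately show ?thesis by (simp add: card_image rank_def)
  qed
  have m0: "mem_at 0 (start s) (\<beta> a) = Agent 0 (rank a div 3) (role_of (rank a mod 3)) Idle 0 0 False" for a
    by (simp add: mem_at_def start_def \<beta>_def entry_def away_def)
  have out: "\<forall>a<?k. s \<noteq> bh \<longrightarrow> None = None \<longrightarrow>
      act (Fresh (ids a)) (seen {..<?k} (\<lambda>a. Fresh (ids a)) (\<lambda>_. s) s) blank (deg s) (c_entry ?C0 a) (c_lastok ?C0 a)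
       = (mem_at 0 (start s) (\<beta> a), None, blank, None)"
    unfolding seen0 act_def memory.case Let_def rk m0 by simp
  have same: "\<forall>u. (\<forall>x\<in>{..<?k}. s = u \<longrightarrow> u \<noteq> bh \<longrightarrow> None \<noteq> None) \<longrightarrow> blank = blank" by simp
  note nx = fits_next[OF fit0 ids, where pres = pr and nbr = nbr and bck = bck and deg = deg and mm' = "\<lambda>a. mem_at 0 (start s) (\<beta> a)"
      and mv = "\<lambda>_. None" and w' = "\<lambda>_. blank" and rp' = "\<lambda>_. None", OF out same, folded C1_def]
  have "fits bh parts ?k \<beta> (place (start s)) (mem_at 0 (start s)) (report (start s)) (bd (start s)) C1"
    unfolding fits_def
  proof (intro conjI allI)
    show "\<beta> ` {..<?k} = parts" by (rule im)
    show "c_wb C1 u = enc_board (bd (start s) u)" for u using nx(1) by (simp add: start_def)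
    fix a
    have pl: "place (start s) x = s" "report (start s) x = None" for x
      by (cases x, simp add: start_def loc_def report_def)+
    show "a < ?k \<longrightarrow> c_pos C1 a = place (start s) (\<beta> a) \<and> c_alive C1 a = (place (start s) (\<beta> a) \<noteq> bh)
      \<and> c_rep C1 a = report (start s) (\<beta> a) \<and> (place (start s) (\<beta> a) \<noteq> bh \<longrightarrow> c_mem C1 a = enc_mem (mem_at 0 (start s) (\<beta> a)))"
      unfolding pl using nx(3)[of a] nx(4)[of a] s(2) by (simp add: try_move_def)
  qed
  then show "\<exists>\<beta>. fits bh parts ?k \<beta> (place (start s)) (mem_at 0 (start s)) (report (start s)) (bd (start s)) C1" by blast
  show "\<exists>x\<in>parts. c_mem C1 a = enc_mem (mem_at 0 (start s) x)" if "a < ?k" for a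
    using nx(3)[OF that s(2)] im that by (intro bexI[of _ "\<beta> a"]) auto
qed

subsection \<open>Bounds on memory and whiteboards\<close>

text \<open>Complements \<open>consistent\<close>, which leaves open the port of an idle trio,
  although it occupies memory, and the board at the black hole.\<close>

definition small :: "state \<Rightarrow> bool" where
  "small M \<longleftrightarrow> (\<forall>g<G. pt M g < n) \<and> bd M bh = blank"

lemma small_start: "small (start s)"
  using n2 by (simp add: small_def start_def)

lemma small_planned:
  assumes "consistent M" "small M"
  shows "small (planned M)"
proof -
  have "snd (assign M g) < n" if g: "g < G" for g
  proof -
    have u: "deg (hm M g) < n" using deg_less consistentD(1)[OF assms(1) g] by blast
    show ?thesis
      by (rule assign_cases[OF g, of M])
        (use assms(2) g u choiceD(2)[of M "hm M g"] in \<open>auto simp: small_def intro: less_trans\<close>)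
  qed
  moreover have "\<not> lively M bh" by (simp add: lively_def)
  ultimately show ?thesis using assms(2) by (simp add: small_def)
qed

lemma small_moved: "small M \<Longrightarrow> small (moved pr M)"
  by (simp add: small_def)

lemma small_trace: "s < n \<Longrightarrow> s \<noteq> bh \<Longrightarrow> small (trace present s i)"
  by (induction i) (auto simp: small_start step_def small_moved small_planned consistent_trace)

lemma port_less:
  assumes M: "consistent M \<or> mid M" and g: "g < G" "md M g \<noteq> Idle"
  shows "bck (hm M g) (pt M g) < n"
proof -
  have h: "hm M g < n" "pt M g < deg (hm M g)" using M g consistentD(1,3) midD(1,3) by blast+
  show ?thesis using nbrD(1,3)[OF h] deg_less[of "nbr (hm M g) (pt M g)"] by simp
qed

text \<open>Ports are below \<open>n\<close> and trio numbers below \<open>G\<close>; the summand 5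
  covers the numbers of roles and modes, the clock and the flag.\<close>

lemma mem_at_le:
  assumes M: "consistent M \<or> mid M" and s: "small M" and x: "x \<in> parts" and c: "c \<le> 2"
  shows "mem_le (n + G + 5) (mem_at c M x)"
proof -
  obtain g r where gr: "x = (g, r)" "g < G" using x by auto
  have "entry M g r < n" using port_less[OF M gr(2)] n2 by (auto simp: entry_def away_def)
  moreover have "pt M g < n" using s gr by (simp add: small_def)
  ultimately show ?thesis
    using gr c role_mode_no_le(1)[of r] role_mode_no_le(2)[of "md M g"] by (simp add: mem_le_def mem_at_def)
qed

lemma mem_moved_le:
  assumes M: "mid M" and s: "small M" and x: "x \<in> parts"
  shows "mem_le (n + G + 5) (mem_moved pr M x)"
proof -
  obtain g r where gr: "x = (g, r)" "g < G" using x by auto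
  have "entry M g r < n" using port_less[of M g] M gr n2 by (auto simp: entry_def away_def)
  moreover have p: "pt M g < n" using s gr by (simp add: small_def)
  moreover have "went pr M g r \<Longrightarrow> md M g \<noteq> Idle" by (auto simp: went_def attempt_def)
  then have "went pr M g r \<Longrightarrow> arrival M g r < n" using port_less[of M g] M gr p by (auto simp: arrival_def)
  ultimately show ?thesis
    using gr role_mode_no_le(1)[of r] role_mode_no_le(2)[of "md M g"] by (cases "went pr M g r") (simp_all add: mem_le_def mem_moved_def)
qed

lemma board_le:
  assumes M: "consistent M \<or> mid M" and s: "small M" and u: "u < n"
  shows "\<forall>v\<in>set (board_nos (bd M u)). v \<le> n + G + 5"
proof (cases "u = bh")
  case True
  then show ?thesis using s by (simp add: small_def blank_def board_nos_def)
next
  case False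
  then have "board_ok (deg u) (bd M u)" using M consistentD(12) midD(12) u by blast
  then show ?thesis using deg_less[OF u] by (auto simp: board_ok_def board_nos_def)
qed

end

lemma enc_mem_length:
  assumes "mem_le b m" "real b \<le> B" "1 \<le> B"
  shows "real (length (enc_mem m)) \<le> 7 * (3 + 2 * log 2 B)"
proof -
  have "real (length (enc_mem m)) \<le> real (length (memory_nos m)) * (3 + 2 * log 2 B)"
    unfolding enc_mem_def using assms by (intro length_concat_bits) (auto simp: mem_le_def)
  also have "\<dots> \<le> 7 * (3 + 2 * log 2 B)"
    using assms(3) by (intro mult_right_mono) (cases m; simp)+
  finally show ?thesis .
qed

lemma enc_board_length:
  assumes "\<forall>v\<in>set (board_nos w). v \<le> b" "real b \<le> B" "1 \<le> B"
  shows "real (length (enc_board w)) \<le> 7 * (3 + 2 * log 2 B)"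
proof -
  have "real (length (enc_board w)) \<le> real (length (board_nos w)) * (3 + 2 * log 2 B)"
    unfolding enc_board_def using assms by (intro length_concat_bits) auto
  also have "\<dots> \<le> 7 * (3 + 2 * log 2 B)"
    using assms(3) by (intro mult_right_mono) (auto simp: board_nos_def)
  finally show ?thesis .
qed

subsection \<open>The time bound\<close>

text \<open>The left side is twice the sum of the three leading terms in the binomial expansion of
  \<open>(D + 1) ^ (m + 2)\<close>; doubling clears the denominator of the binomial
  coefficient.\<close>

lemma binomial_two_terms:
  "D ^ m * ((m + 2) * (m + 1) + 2 * (m + 2) * D + 2 * D\<^sup>2) \<le> 2 * (D + 1 :: nat) ^ (m + 2)"
proof (induction m)
  case (Suc m)
  define q where "q = (m + 2) * (m + 1) + 2 * (m + 2) * D + 2 * D\<^sup>2"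
  define q' where "q' = (Suc m + 2) * (Suc m + 1) + 2 * (Suc m + 2) * D + 2 * D\<^sup>2"
  have "q' * D \<le> q * (D + 1)"
    by (simp add: q_def q'_def algebra_simps power2_eq_square)
  then have "D ^ m * (q' * D) \<le> D ^ m * (q * (D + 1))" by (rule mult_left_mono) simp
  also have "\<dots> = (D ^ m * q) * (D + 1)" by (simp only: mult.assoc)
  also have "\<dots> \<le> 2 * (D + 1) ^ (m + 2) * (D + 1)"
    using Suc unfolding q_def by (rule mult_right_mono) simp
  finally have "D ^ Suc m * q' \<le> 2 * (D + 1) ^ (Suc m + 2)"
    by (simp add: mult.commute mult.left_commute)
  then show ?case unfolding q'_def .
qed (simp add: power2_eq_square algebra_simps)

lemma exponential_dominates:
  assumes "1 \<le> D"
  shows "5 * m * D ^ m + 1 \<le> (D + 1 :: nat) ^ (m + 2)"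
proof -
  \<comment> \<open>The right side exceeds the left by \<open>(m - 2) * (m - 3)\<close>, which is
    never negative at an integer.\<close>
  have sq: "10 * m + 2 \<le> (m + 2) * (m + 1) + 2 * (m + 2) + 2"
  proof (cases "m \<le> 3")
    case True
    then have "m = 0 \<or> m = 1 \<or> m = 2 \<or> m = 3" by auto
    then show ?thesis by auto
  next
    case False
    then obtain k where "m = 4 + k" using le_Suc_ex[of 4 m] by auto
    then show ?thesis by (simp add: algebra_simps)
  qed
  have "2 * (5 * m * D ^ m + 1) \<le> D ^ m * (10 * m + 2)"
    using assms by (simp add: algebra_simps)
  also have "\<dots> \<le> D ^ m * ((m + 2) * (m + 1) + 2 * (m + 2) * D + 2 * D\<^sup>2)"
  proof (intro mult_left_mono)
    have "2 * (m + 2) * 1 \<le> 2 * (m + 2) * D" using assms by (rule mult_le_mono2)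
    moreover have "2 \<le> 2 * D\<^sup>2" using assms by simp
    ultimately show "10 * m + 2 \<le> (m + 2) * (m + 1) + 2 * (m + 2) * D + 2 * D\<^sup>2" using sq by linarith
  qed simp
  also have "\<dots> \<le> 2 * (D + 1) ^ (m + 2)" by (rule binomial_two_terms)
  finally show ?thesis by simp
qed

text \<open>Three rounds per step plus the first round. With \<open>m = n - 1\<close> and
  \<open>4 * (m * D) + 1\<close> raised to \<open>5 * (m * D)\<close>, a common factor
  \<open>3 * N * m * D\<close> splits off, and \<open>exponential_dominates\<close> compares what
  remains.\<close>

lemma round_bound:
  assumes n: "2 \<le> n" and D: "1 \<le> D" and f: "1 \<le> f"
  shows "3 * ((4 * ((n - 1) * D) + 1) * (D ^ (n - 1) * ((n - 1) * (D + 1)) ^ (2 * f - 1) * ((n - 1) * D ^ (n - 1)))) + 1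
    \<le> 3 * D ^ n * (D + 1) ^ (2 * f + n) * (n - 1) ^ (2 * f)"
proof -
  obtain m where m: "n = Suc m" "1 \<le> m" using n by (cases n) auto
  obtain h where h: "2 * f = Suc h" using f by (cases "2 * f") auto
  define N where "N = D ^ m * (m * (D + 1)) ^ h"
  have N: "1 \<le> N" using D m by (simp add: N_def)
  have mD: "1 \<le> m * D" using D m by simp
  have "3 * ((4 * (m * D) + 1) * (N * (m * D ^ m))) + 1 \<le> 3 * ((5 * (m * D)) * (N * (m * D ^ m))) + N * (3 * (m * D))"
  proof -
    have "(4 * (m * D) + 1) * (N * (m * D ^ m)) \<le> (5 * (m * D)) * (N * (m * D ^ m))"
      using mD by (intro mult_right_mono) auto
    moreover have "1 \<le> N * (3 * (m * D))" using N mD by simp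
    ultimately show ?thesis by linarith
  qed
  also have "\<dots> = N * (3 * (m * D)) * (5 * m * D ^ m + 1)" by (simp add: algebra_simps)
  also have "\<dots> \<le> N * (3 * (m * D)) * (D + 1) ^ (m + 2)"
    using exponential_dominates[OF D, of m] by (rule mult_left_mono) simp
  also have "\<dots> = 3 * D ^ n * (D + 1) ^ (2 * f + n) * (n - 1) ^ (2 * f)"
    unfolding h m N_def power_mult_distrib by (simp add: power_add algebra_simps)
  finally show ?thesis using m h by (simp add: N_def)
qed

section \<open>Correct reports and sizes in every round\<close>

context trios begin

definition sound :: "nat \<Rightarrow> nat \<Rightarrow> cfg \<Rightarrow> bool" where
  "sound k b C \<longleftrightarrow> (\<forall>a<k. \<forall>ps. c_rep C a = Some ps \<longrightarrow> leads_to_bh deg nbr bh (c_pos C a) ps)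
     \<and> (\<forall>v<n. \<exists>w. c_wb C v = enc_board w \<and> (\<forall>x\<in>set (board_nos w). x \<le> b))"

definition mem_sound :: "nat \<Rightarrow> nat \<Rightarrow> cfg \<Rightarrow> bool" where
  "mem_sound k b C \<longleftrightarrow> (\<forall>a<k. \<exists>m. c_mem C a = enc_mem m \<and> mem_le b m)"

lemma fits_sound:
  assumes fit: "fits bh parts k \<beta> pos mm (report P) (bd P) C"
    and P: "consistent P \<or> mid P" and s: "small P" and b: "n + G + 5 \<le> b"
    and pos: "\<And>g r. md P g = Found \<Longrightarrow> r = Keeper \<Longrightarrow> pos (g, r) = hm P g"
  shows "sound k b C"
  unfolding sound_def
proof (intro conjI allI impI)
  fix a ps assume a: "a < k" and rep: "c_rep C a = Some ps"
  obtain g r where gr: "\<beta> a = (g, r)" "g < G" using fit a by (cases "\<beta> a") (force simp: fits_def)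
  have "report P (g, r) = Some ps" "c_pos C a = pos (g, r)" using fit a rep gr by (auto simp: fits_def)
  then have F: "md P g = Found" "r = Keeper" "ps = [pt P g]" using reportD by blast+
  have "hm P g \<noteq> bh" "pt P g < deg (hm P g)" "far P g = bh"
    using P F(1) consistentD(2,3,5)[of P g] midD(2,3,5)[of P g] gr(2) by auto
  then show "leads_to_bh deg nbr bh (c_pos C a) ps"
    using pos[OF F(1,2)] \<open>c_pos C a = pos (g, r)\<close> F(3) by (simp add: far_def)
next
  fix v assume "v < n"
  then have "\<forall>x\<in>set (board_nos (bd P v)). x \<le> b" using board_le[OF P s] b by (meson le_trans)
  moreover have "c_wb C v = enc_board (bd P v)" using fit by (simp add: fits_def)
  ultimately show "\<exists>w. c_wb C v = enc_board w \<and> (\<forall>x\<in>set (board_nos w). x \<le> b)" by blast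
qed

lemma mem_sound_next:
  assumes "mem_sound k b C" "\<And>a. a < k \<Longrightarrow> c_mem C' a = c_mem C a \<or> (\<exists>x\<in>parts. c_mem C' a = enc_mem (mm x))"
    and "\<And>x. x \<in> parts \<Longrightarrow> mem_le b (mm x)"
  shows "mem_sound k b C'"
  unfolding mem_sound_def
proof (intro allI impI)
  fix a assume a: "a < k"
  show "\<exists>m. c_mem C' a = enc_mem m \<and> mem_le b m"
    using assms(2)[OF a]
  proof
    assume "c_mem C' a = c_mem C a"
    then show ?thesis using assms(1) a by (simp add: mem_sound_def)
  next
    assume "\<exists>x\<in>parts. c_mem C' a = enc_mem (mm x)"
    then show ?thesis using assms(3) by blast
  qed
qed

lemma mem_le_mono: "mem_le b m \<Longrightarrow> b \<le> b' \<Longrightarrow> mem_le b' m"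
  by (auto simp: mem_le_def)

text \<open>The simulation is anchored at rounds \<open>3 * i + 1\<close>, between two abstract
  steps. Reports and sizes have to be controlled in all rounds and are therefore also stated for the
  two rounds in between.\<close>

lemma run_tracks:
  fixes present :: "nat \<Rightarrow> nat set \<Rightarrow> bool"
  assumes s: "s < n" "s \<noteq> bh" and ids: "inj_on ids {..<3 * G}" "\<forall>a<3 * G. ids a \<le> b" and b: "n + G + 5 \<le> b"
  defines "R \<equiv> run bhs_algo deg nbr bck bh s (3 * G) ids present" and "T \<equiv> trace present s"
  shows "(\<exists>\<beta>. fits bh parts (3 * G) \<beta> (place (T i)) (mem_at 0 (T i)) (report (T i)) (bd (T i)) (R (3 * i + 1)))
      \<and> mem_sound (3 * G) b (R (3 * i + 1))"
    "(sound (3 * G) b (R (3 * i + 1)) \<and> mem_sound (3 * G) b (R (3 * i + 1)))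
     \<and> (sound (3 * G) b (R (3 * i + 2)) \<and> mem_sound (3 * G) b (R (3 * i + 2)))
     \<and> (sound (3 * G) b (R (3 * i + 3)) \<and> mem_sound (3 * G) b (R (3 * i + 3)))"
proof -
  have T: "consistent (T i)" "small (T i)" "mid (planned (T i))" "small (planned (T i))" for i
    using consistent_trace[OF s] small_trace[OF s] mid_planned small_planned by (auto simp: T_def)
  have TS: "T (Suc i) = moved (present (3 * i + 2)) (planned (T i))" for i by (simp add: T_def step_def)
  have R1: "R (3 * i + 2) = next_cfg bhs_algo deg nbr bck bh (3 * G) ids (present (3 * i + 2)) (R (3 * i + 1))"
    and R2: "R (3 * i + 3) = next_cfg bhs_algo deg nbr bck bh (3 * G) ids (present (3 * i + 3)) (R (3 * i + 2))"
    and R3: "R (3 * Suc i + 1) = next_cfg bhs_algo deg nbr bck bh (3 * G) ids (present (3 * i + 4)) (R (3 * i + 3))" for i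
    by (simp_all add: R_def numeral_eq_Suc)
  have le: "mem_le b (mem_at 0 (T i) x)" "mem_le b (mem_at 1 (planned (T i)) x)"
    "mem_le b (mem_moved pr (planned (T i)) x)" if x: "x \<in> parts" for x i pr
  proof -
    have "mem_le (n + G + 5) (mem_at 0 (T i) x)" using mem_at_le[of "T i" x 0] T x by blast
    then show "mem_le b (mem_at 0 (T i) x)" using b by (rule mem_le_mono)
    have "mem_le (n + G + 5) (mem_at 1 (planned (T i)) x)" using mem_at_le[of "planned (T i)" x 1] T x by simp
    then show "mem_le b (mem_at 1 (planned (T i)) x)" using b by (rule mem_le_mono)
    have "mem_le (n + G + 5) (mem_moved pr (planned (T i)) x)" using mem_moved_le T x by blast
    then show "mem_le b (mem_moved pr (planned (T i)) x)" using b by (rule mem_le_mono)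
  qed
  have all: "(\<exists>\<beta>. fits bh parts (3 * G) \<beta> (place (T (Suc i))) (mem_at 0 (T (Suc i))) (report (T (Suc i))) (bd (T (Suc i))) (R (3 * Suc i + 1)))
      \<and> mem_sound (3 * G) b (R (3 * Suc i + 1))
      \<and> sound (3 * G) b (R (3 * i + 1)) \<and> sound (3 * G) b (R (3 * i + 2)) \<and> mem_sound (3 * G) b (R (3 * i + 2))
      \<and> sound (3 * G) b (R (3 * i + 3)) \<and> mem_sound (3 * G) b (R (3 * i + 3))"
    if fit: "fits bh parts (3 * G) \<beta> (place (T i)) (mem_at 0 (T i)) (report (T i)) (bd (T i)) (R (3 * i + 1))"
      and ms: "mem_sound (3 * G) b (R (3 * i + 1))" for i \<beta>
  proof -
    note r1 = three_rounds(1)[OF T(1) ids(1) fit, where pr = "present (3 * i + 2)", folded R1]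
    note r2 = three_rounds(2)[OF T(1) ids(1) fit, where pr = "present (3 * i + 2)" and ?pr2.0 = "present (3 * i + 3)", folded R1, folded R2]
    note r3 = three_rounds(3)[OF T(1) ids(1) fit, where pr = "present (3 * i + 2)" and ?pr2.0 = "present (3 * i + 3)" and ?pr3.0 = "present (3 * i + 4)", folded R1, folded R2, folded R3, folded TS]
    note r4 = three_rounds(4)[OF T(1) ids(1) fit, where pr = "present (3 * i + 2)", folded R1]
    note r5 = three_rounds(5)[OF T(1) ids(1) fit, where pr = "present (3 * i + 2)" and ?pr2.0 = "present (3 * i + 3)", folded R1, folded R2]
    note r6 = three_rounds(6)[OF T(1) ids(1) fit, where pr = "present (3 * i + 2)" and ?pr2.0 = "present (3 * i + 3)" and ?pr3.0 = "present (3 * i + 4)", folded R1, folded R2, folded R3, folded TS]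
    have m2: "mem_sound (3 * G) b (R (3 * i + 2))" by (rule mem_sound_next[OF ms r4 le(2)])
    have m3: "mem_sound (3 * G) b (R (3 * i + 3))" by (rule mem_sound_next[OF m2 r5 le(3)])
    have m4: "mem_sound (3 * G) b (R (3 * Suc i + 1))" by (rule mem_sound_next[OF m3 r6 le(1)])
    have s1: "sound (3 * G) b (R (3 * i + 1))"
      by (rule fits_sound[OF fit _ T(2) b]) (use T(1) in \<open>auto simp: loc_def\<close>)
    have fp: "new_place (present (3 * i + 2)) (planned (T i)) (g, r') = hm (planned (T i)) g"
      if "md (planned (T i)) g = Found" "r' = Keeper" for g r'
      using found_stays[OF that(1), of "present (3 * i + 2)" r'] that(2) by simp
    have s2: "sound (3 * G) b (R (3 * i + 2))"
      by (rule fits_sound[OF r1 _ T(4) b fp]) (use T(3) in auto)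
    have s3: "sound (3 * G) b (R (3 * i + 3))"
      by (rule fits_sound[OF r2 _ T(4) b fp]) (use T(3) in auto)
    show ?thesis using r3 m2 m3 m4 s1 s2 s3 by blast
  qed
  show A: "(\<exists>\<beta>. fits bh parts (3 * G) \<beta> (place (T i)) (mem_at 0 (T i)) (report (T i)) (bd (T i)) (R (3 * i + 1)))
      \<and> mem_sound (3 * G) b (R (3 * i + 1))" for i
  proof (induction i)
    case 0
    have e: "R (3 * 0 + 1) = next_cfg bhs_algo deg nbr bck bh (3 * G) ids (present 1) (init_cfg bhs_algo s ids)"
      by (simp add: R_def)
    have "mem_sound (3 * G) b (init_cfg bhs_algo s ids)"
      using ids(2) by (auto simp: mem_sound_def init_cfg_def bhs_algo_def mem_le_def)
    then have "mem_sound (3 * G) b (R (3 * 0 + 1))"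
      unfolding e
    proof (rule mem_sound_next)
      show "c_mem (next_cfg bhs_algo deg nbr bck bh (3 * G) ids (present 1) (init_cfg bhs_algo s ids)) a =
          c_mem (init_cfg bhs_algo s ids) a \<or>
        (\<exists>x\<in>parts. c_mem (next_cfg bhs_algo deg nbr bck bh (3 * G) ids (present 1) (init_cfg bhs_algo s ids)) a
          = enc_mem (mem_at 0 (start s) x))" if "a < 3 * G" for a
        using first_round(2)[OF s ids(1) that] by (rule disjI2)
      show "mem_le b (mem_at 0 (start s) x)" if "x \<in> parts" for x
        using le(1)[OF that, of 0] by (simp add: T_def)
    qed
    then show ?case using first_round(1)[OF s ids(1), of "present 1"] unfolding e T_def by simp
  next
    case (Suc i)
    then show ?case using all by blast
  qed
  show "(sound (3 * G) b (R (3 * i + 1)) \<and> mem_sound (3 * G) b (R (3 * i + 1)))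
     \<and> (sound (3 * G) b (R (3 * i + 2)) \<and> mem_sound (3 * G) b (R (3 * i + 2)))
     \<and> (sound (3 * G) b (R (3 * i + 3)) \<and> mem_sound (3 * G) b (R (3 * i + 3)))"
    using A[of i] all by blast
qed

lemma run_sound:
  assumes s: "s < n" "s \<noteq> bh" and ids: "inj_on ids {..<3 * G}" "\<forall>a<3 * G. ids a \<le> b" and b: "n + G + 5 \<le> b"
  shows "sound (3 * G) b (run bhs_algo deg nbr bck bh s (3 * G) ids present t)"
    "mem_sound (3 * G) b (run bhs_algo deg nbr bck bh s (3 * G) ids present t)"
proof -
  let ?R = "run bhs_algo deg nbr bck bh s (3 * G) ids present"
  have "sound (3 * G) b (?R t) \<and> mem_sound (3 * G) b (?R t)"
  proof (cases t)
    case 0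
    have "c_wb (?R 0) v = enc_board blank" for v by (simp add: init_cfg_def)
    moreover have "board_nos blank = []" by (simp add: board_nos_def blank_def)
    ultimately have "\<exists>w. c_wb (?R 0) v = enc_board w \<and> (\<forall>x\<in>set (board_nos w). x \<le> b)" for v
      by (intro exI[of _ blank]) simp
    moreover have "mem_sound (3 * G) b (?R 0)"
      using ids(2) by (auto simp: mem_sound_def init_cfg_def bhs_algo_def mem_le_def)
    ultimately show ?thesis using 0 by (simp add: sound_def init_cfg_def)
  next
    case (Suc t')
    note r = run_tracks(2)[OF s ids b, of present "t' div 3"]
    have "t' mod 3 < 3" by simp
    then have "t' mod 3 = 0 \<or> t' mod 3 = 1 \<or> t' mod 3 = 2" by linarith
    moreover have "t = 3 * (t' div 3) + (t' mod 3) + 1" using Suc by simp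
    ultimately consider "t = 3 * (t' div 3) + 1" | "t = 3 * (t' div 3) + 2" | "t = 3 * (t' div 3) + 3" by linarith
    then show ?thesis using r by cases simp_all
  qed
  then show "sound (3 * G) b (?R t)" "mem_sound (3 * G) b (?R t)" by auto
qed

lemma run_found:
  assumes s: "s < n" "s \<noteq> bh" and ids: "inj_on ids {..<3 * G}"
    and F: "g < G" "md (trace present s i) g = Found"
  shows "\<exists>a<3 * G. c_alive (run bhs_algo deg nbr bck bh s (3 * G) ids present (3 * i + 1)) a
      \<and> c_rep (run bhs_algo deg nbr bck bh s (3 * G) ids present (3 * i + 1)) a \<noteq> None"
proof -
  let ?C = "run bhs_algo deg nbr bck bh s (3 * G) ids present (3 * i + 1)" and ?M = "trace present s i"
  obtain b where b: "\<forall>a<3 * G. ids a \<le> b" "n + G + 5 \<le> b"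
  proof
    \<comment> \<open>Any common bound on the IDs will do here, and their sum is one.\<close>
    show "\<forall>a<3 * G. ids a \<le> (\<Sum>a<3 * G. ids a) + (n + G + 5)"
      by (auto intro!: trans_le_add1 member_le_sum)
  qed simp
  obtain \<beta> where fit: "fits bh parts (3 * G) \<beta> (place ?M) (mem_at 0 ?M) (report ?M) (bd ?M) ?C"
    using run_tracks(1)[OF s ids b, of present i] by blast
  have "(g, Keeper) \<in> \<beta> ` {..<3 * G}" using fit F(1) by (simp add: fits_def)
  then obtain a where a: "a < 3 * G" "\<beta> a = (g, Keeper)" by auto
  have "hm ?M g \<noteq> bh" using consistentD(2)[OF consistent_trace[OF s] F(1)] .
  then show ?thesis
    using fit a F by (intro exI[of _ a]) (auto simp: fits_def report_def)
qed

end

text \<open>With 8 a power of two, the left side is \<open>63 + 14 * c * log 2 n\<close>, where 63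
  is \<open>7 * (3 + 2 * 3)\<close>; the constant is absorbed because \<open>log 2 n\<close> is at
  least 1.\<close>

lemma log_bound_real:
  assumes "2 \<le> n" "1 < c"
  shows "7 * (3 + 2 * log 2 (8 * real n powr c)) \<le> (63 + 14 * c) / ln 2 * ln (real n)"
proof -
  have l: "log 2 (8 * real n powr c) = 3 + c * (ln (real n) / ln 2)"
  proof -
    have "log 2 (8 :: real) = 3" using log_pow_cancel[of "2 :: real" 3] by simp
    moreover have "log 2 (8 * real n powr c) = log 2 8 + log 2 (real n powr c)"
      using assms by (intro log_mult_pos) auto
    moreover have "log 2 (real n powr c) = c * log 2 (real n)" using assms by (simp add: log_powr)
    ultimately show ?thesis by (simp add: log_def[of 2 "real n"])
  qed
  have "1 \<le> ln (real n) / ln 2" using assms by simp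
  then show ?thesis unfolding l by (simp add: field_simps)
qed

theorem theorem9:
  shows "\<exists>alg :: algo. \<forall>c :: real. c > 1 \<longrightarrow> (\<exists>K :: real.
    \<forall>f n deg nbr back bh s ids present.
      f \<ge> 1 \<and> port_graph n deg nbr back \<and> bh < n \<and> s < n \<and> s \<noteq> bh
      \<and> valid_ids c n (6 * f) ids \<and> f_adversary f n deg nbr present \<longrightarrow>
      (let R = run alg deg nbr back bh s (6 * f) ids present; \<Delta> = max_degree n deg in
         (\<forall>t a ps. a < 6 * f \<and> c_rep (R t) a = Some ps \<longrightarrow> leads_to_bh deg nbr bh (c_pos (R t) a) ps)
       \<and> (\<exists>t \<le> 3 * \<Delta> ^ n * (\<Delta> + 1) ^ (2 * f + n) * (n - 1) ^ (2 * f).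
            \<exists>a < 6 * f. c_alive (R t) a \<and> c_rep (R t) a \<noteq> None)
       \<and> (\<forall>t a. a < 6 * f \<longrightarrow> real (length (c_mem (R t) a)) \<le> K * ln (real n))
       \<and> (\<forall>t v. v < n \<longrightarrow> real (length (c_wb (R t) v)) \<le> K * ln (real n))))"
proof (intro exI[of _ bhs_algo] allI impI)
  fix c :: real assume c: "c > 1"
  show "\<exists>K :: real. \<forall>f n deg nbr bck bh s ids present.
      f \<ge> 1 \<and> port_graph n deg nbr bck \<and> bh < n \<and> s < n \<and> s \<noteq> bh
      \<and> valid_ids c n (6 * f) ids \<and> f_adversary f n deg nbr present \<longrightarrow>
      (let R = run bhs_algo deg nbr bck bh s (6 * f) ids present; \<Delta> = max_degree n deg in
         (\<forall>t a ps. a < 6 * f \<and> c_rep (R t) a = Some ps \<longrightarrow> leads_to_bh deg nbr bh (c_pos (R t) a) ps)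
       \<and> (\<exists>t \<le> 3 * \<Delta> ^ n * (\<Delta> + 1) ^ (2 * f + n) * (n - 1) ^ (2 * f).
            \<exists>a < 6 * f. c_alive (R t) a \<and> c_rep (R t) a \<noteq> None)
       \<and> (\<forall>t a. a < 6 * f \<longrightarrow> real (length (c_mem (R t) a)) \<le> K * ln (real n))
       \<and> (\<forall>t v. v < n \<longrightarrow> real (length (c_wb (R t) v)) \<le> K * ln (real n)))"
    unfolding Let_def
  proof (intro exI[of _ "(63 + 14 * c) / ln 2"] allI impI)
    fix f n deg nbr bck bh s ids present
    assume A: "f \<ge> 1 \<and> port_graph n deg nbr bck \<and> bh < n \<and> s < n \<and> s \<noteq> bh
      \<and> valid_ids c n (6 * f) ids \<and> f_adversary f n deg nbr present"
    let ?D = "max_degree n deg" and ?K = "(63 + 14 * c) / ln 2"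
    have f: "1 \<le> f" and s: "s < n" "s \<noteq> bh" and n2: "2 \<le> n" using A by auto
    interpret trios n deg nbr bck bh "2 * f" by unfold_locales (use A n2 in auto)
    have k: "3 * (2 * f) = 6 * f" by simp
    have inj: "inj_on ids {..<3 * (2 * f)}" using A by (simp add: valid_ids_def)
    interpret execution n deg nbr bck bh f "\<lambda>i. present (3 * i + 2)" "trace present s"
    proof
      show "consistent (trace present s 0)" using consistent_trace[OF s] .
      show "trace present s (Suc i) = step (present (3 * i + 2)) (trace present s i)" for i by simp
      show "connected_on n {e \<in> Edges n deg nbr. present (3 * i + 2) e}"
        "card {e \<in> Edges n deg nbr. \<not> present (3 * i + 2) e} \<le> f" for i
        using A by (auto simp: f_adversary_def)
    qed
    let ?R = "run bhs_algo deg nbr bck bh s (3 * (2 * f)) ids present"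
    have D: "deg u \<le> ?D" if "u < n" for u using that by (simp add: max_degree_def)
    have D1: "1 \<le> ?D" using deg_pos[OF s(1)] D[OF s(1)] by simp
    \<comment> \<open>\<open>b\<close> is to bound the IDs and \<open>n + 2 * f + 5\<close>. Each of
      \<open>n\<close> and \<open>2 * f\<close> is at most \<open>n powr c\<close>, and 5 is at most
      five times that; 8 leaves room for the sum and is a power of two.\<close>
    define b where "b = nat \<lfloor>8 * real n powr c\<rfloor>"
    have npc: "real n \<le> real n powr c" using powr_mono[of 1 c "real n"] c n2 by simp
    have ids_le: "\<forall>a<6 * f. 1 \<le> ids a \<and> real (ids a) \<le> real n powr c" using A by (simp add: valid_ids_def)
    \<comment> \<open>The \<open>6 * f\<close> distinct IDs lie between 1 and
      \<open>n powr c\<close>. So the number of agents is polynomial in \<open>n\<close>, and trio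
      numbers fit into logarithmic memory.\<close>
    have f_le: "real (6 * f) \<le> real n powr c"
    proof -
      have "card (ids ` {..<6 * f}) \<le> card {1..nat \<lfloor>real n powr c\<rfloor>}"
        using ids_le by (intro card_mono) (auto simp: le_nat_floor)
      then have "6 * f \<le> nat \<lfloor>real n powr c\<rfloor>" using inj k by (simp add: card_image)
      then have "real (6 * f) \<le> real (nat \<lfloor>real n powr c\<rfloor>)" by (rule of_nat_mono)
      also have "\<dots> \<le> real n powr c" by (rule of_nat_floor) simp
      finally show ?thesis .
    qed
    have n1: "1 \<le> real n powr c" using npc n2 by simp
    have b: "n + 2 * f + 5 \<le> b"
      unfolding b_def using npc f_le n1 by (intro le_nat_floor) simp
    have idb: "\<forall>a<3 * (2 * f). ids a \<le> b"
      unfolding b_def using ids_le n1 k by (auto intro!: le_nat_floor intro: order_trans)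
    have bB: "real b \<le> 8 * real n powr c" "1 \<le> 8 * real n powr c"
      using n1 by (auto simp: b_def intro: of_nat_floor)
    have K: "7 * (3 + 2 * log 2 (8 * real n powr c)) \<le> ?K * ln (real n)" by (rule log_bound_real[OF n2 c])
    note snd = run_sound[OF s inj idb b, of present]
    show "(\<forall>t a ps. a < 6 * f \<and> c_rep (run bhs_algo deg nbr bck bh s (6 * f) ids present t) a = Some ps \<longrightarrow>
          leads_to_bh deg nbr bh (c_pos (run bhs_algo deg nbr bck bh s (6 * f) ids present t) a) ps)
       \<and> (\<exists>t \<le> 3 * ?D ^ n * (?D + 1) ^ (2 * f + n) * (n - 1) ^ (2 * f).
            \<exists>a < 6 * f. c_alive (run bhs_algo deg nbr bck bh s (6 * f) ids present t) a
              \<and> c_rep (run bhs_algo deg nbr bck bh s (6 * f) ids present t) a \<noteq> None)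
       \<and> (\<forall>t a. a < 6 * f \<longrightarrow> real (length (c_mem (run bhs_algo deg nbr bck bh s (6 * f) ids present t) a)) \<le> ?K * ln (real n))
       \<and> (\<forall>t v. v < n \<longrightarrow> real (length (c_wb (run bhs_algo deg nbr bck bh s (6 * f) ids present t) v)) \<le> ?K * ln (real n))"
      unfolding k[symmetric]
    proof (intro conjI allI impI)
      fix t a ps assume "a < 3 * (2 * f) \<and> c_rep (?R t) a = Some ps"
      then show "leads_to_bh deg nbr bh (c_pos (?R t) a) ps" using snd(1)[of t] unfolding sound_def by blast
    next
      fix t a assume "a < 3 * (2 * f)"
      then obtain m where m: "c_mem (?R t) a = enc_mem m" "mem_le b m" using snd(2)[of t] unfolding mem_sound_def by blast
      show "real (length (c_mem (?R t) a)) \<le> ?K * ln (real n)"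
        unfolding m(1) using enc_mem_length[OF m(2) bB] K by linarith
    next
      fix t v assume "v < n"
      then obtain w where w: "c_wb (?R t) v = enc_board w" "\<forall>x\<in>set (board_nos w). x \<le> b"
        using snd(1)[of t] unfolding sound_def by blast
      show "real (length (c_wb (?R t) v)) \<le> ?K * ln (real n)"
        unfolding w(1) using enc_board_length[OF w(2) bB] K by linarith
    next
      let ?T = "(4 * ((n - 1) * ?D) + 1) * (?D ^ (n - 1) * ((n - 1) * (?D + 1)) ^ (2 * f - 1) * ((n - 1) * ?D ^ (n - 1)))"
      obtain i g where i: "i \<le> ?T" "g < 2 * f" "md (trace present s i) g = Found"
        using found_in_time[OF f D] by blast
      have "3 * i + 1 \<le> 3 * ?T + 1" using i(1) by simp
      also have "\<dots> \<le> 3 * ?D ^ n * (?D + 1) ^ (2 * f + n) * (n - 1) ^ (2 * f)"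
        by (rule round_bound[OF n2 D1 f])
      finally show "\<exists>t \<le> 3 * ?D ^ n * (?D + 1) ^ (2 * f + n) * (n - 1) ^ (2 * f).
            \<exists>a < 3 * (2 * f). c_alive (?R t) a \<and> c_rep (?R t) a \<noteq> None"
        using run_found[OF s inj i(2,3)] by blast
    qed
  qed
qed

end
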